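(* Let $X$ be a (nonempty) compact Hausdorff space, $\alpha:X\to X$ continuous, $A:C(X)\to C(X)$ a transfer operator for $(X,\alpha)$, and let $Y\subset X$ be a (nonempty, closed, forward $\alpha$-invariant) subset such that $A$ is $Y$-compatible. Then $$\lambda(\psi)\ \ge\ \lambda_Y(\psi)=\max_{\mu\in M_\alpha(Y)}\bigl(\mu[\psi]+\tau_Y(\mu)\bigr),\qquad \psi\in C(X,\mathbb R).$$ Moreover, if $A$ is $X_\alpha$-compatible, then $$\lambda(\psi)=\lambda_{X_\alpha}(\psi)=\max_{\mu\in M_\alpha(X)}\bigl(\mu[\psi]+\tau_{X_\alpha}(\mu)\bigr),\qquad \psi\in C(X,\mathbb R).$$
   Context: A transfer operator for $(X,\alpha)$ is a positive linear operator $A:C(X)\to C(X)$ with $A((f\circ\alpha)g)=f\,Ag$ for all $f,g\in C(X)$. $C(X,\mathbb R)$ is the space of real-valued continuous functions. $M_\alpha(X)$ is the set of regular Borel $\alpha$-invariant probability measures on $X$; write $\mu[f]=\int f\,d\mu$. Essential set: $x\in X$ is essential if for every neighborhood $V$ of $x$ there is $\mu\in M_\alpha(X)$ with $\mu(V)>0$; $X_\alpha$ is the (closed) set of all essential points. It satisfies $\alpha(X_\alpha)=X_\alpha$, and every $\mu\in M_\alpha(X)$ is supported in $X_\alpha$. Trace: for $x\in X$ let $\nu_x$ be the regular Borel measure (possibly $0$) with $\int f\,d\nu_x=[Af](x)$ for $f\in C(X)$; its support lies in $\alpha^{-1}(x)$. For a closed set $Y$ with $\alpha(Y)\subset Y$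 (forward $\alpha$-invariant), $A$ is called $Y$-compatible if for every $f\in C(Y)$ the function $x\mapsto\int_Y f\,d\nu_x$ is continuous on $Y$. In that case $[A_Yf](x):=\int_Y f\,d\nu_x$ ($f\in C(Y)$, $x\in Y$) defines a transfer operator $A_Y:C(Y)\to C(Y)$ for $(Y,\alpha|_Y)$. $M_\alpha(Y)$ is the set of regular Borel $\alpha$-invariant probability measures on $Y$, viewed as a subset of $M_\alpha(X)$ by setting $\mu(X\setminus Y)=0$. Spectral potential: for $\psi\in C(X,\mathbb R)$, $A_\psi f:=A(e^\psi f)$ and $\lambda(\psi):=\lim_{n\to\infty}\frac1n\ln\|A_\psi^n\|$ (logarithm of the spectral radius of $A_\psi$, with $\ln0=-\infty$). $\lambda_Y(\psi)$ is defined in the same way using $A_Y$ on $C(Y)$ and $\psi|_Y$. $t$-entropy: for $\mu\in M_\alpha(Y)$, $$\tau_Y(\mu):=\inf_{n\in\mathbb N}\frac1n\inf_G\sum_{g\in G}\mu[g]\ln\frac{\mu[A_Y^ng]}{\mu[g]},$$ where $G$ runs over all (finite) continuous partitions of unity in $C(Y)$ by nonnegative functions, a summand with $\mu[g]=0$ is set equal to $0$, and $\ln 0=-\infty$. $\tau_{X_\alpha}$ is the case $Y=X_\alpha$. *)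

theory Defs
  imports "HOL-Probability.Probability"
begin

text \<open>The compact space \<open>X\<close> is the universe of a Hausdorff type. For \<open>S \<subseteq> X\<close>, an element of the
  complex function space \<open>C(S)\<close> is represented by its extension by \<open>0\<close> to the whole type, so that
  functions on \<open>S\<close> correspond one-to-one to their representatives.\<close>

definition cfun :: "'a::topological_space set \<Rightarrow> ('a \<Rightarrow> complex) set" where
  "cfun S = {f. continuous_on S f \<and> (\<forall>x. x \<notin> S \<longrightarrow> f x = 0)}"

definition transfer_operator ::
    "('a::topological_space \<Rightarrow> 'a) \<Rightarrow> (('a \<Rightarrow> complex) \<Rightarrow> ('a \<Rightarrow> complex)) \<Rightarrow> bool" where
  "transfer_operator \<alpha> A \<longleftrightarrow>
     (\<forall>f\<in>cfun UNIV. A f \<in> cfun UNIV) \<and>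
     (\<forall>f\<in>cfun UNIV. \<forall>g\<in>cfun UNIV. A (\<lambda>x. f x + g x) = (\<lambda>x. A f x + A g x)) \<and>
     (\<forall>c. \<forall>f\<in>cfun UNIV. A (\<lambda>x. c * f x) = (\<lambda>x. c * A f x)) \<and>
     (\<forall>f\<in>cfun UNIV. (\<forall>x. f x \<in> \<real>\<^sub>\<ge>\<^sub>0) \<longrightarrow> (\<forall>x. A f x \<in> \<real>\<^sub>\<ge>\<^sub>0)) \<and>
     (\<forall>f\<in>cfun UNIV. \<forall>g\<in>cfun UNIV. A (\<lambda>x. f (\<alpha> x) * g x) = (\<lambda>x. f x * A g x))"

definition regular_borel_measure :: "'a::topological_space measure \<Rightarrow> bool" where
  "regular_borel_measure \<mu> \<longleftrightarrow>
     sets \<mu> = sets borel \<and> finite_measure \<mu> \<and>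
     (\<forall>B\<in>sets borel.
        emeasure \<mu> B = (SUP K\<in>{K. compact K \<and> K \<in> sets borel \<and> K \<subseteq> B}. emeasure \<mu> K) \<and>
        emeasure \<mu> B = (INF U\<in>{U. open U \<and> B \<subseteq> U}. emeasure \<mu> U))"

definition invariant_measures :: "('a::topological_space \<Rightarrow> 'a) \<Rightarrow> 'a measure set" where
  "invariant_measures \<alpha> =
     {\<mu>. regular_borel_measure \<mu> \<and> prob_space \<mu> \<and> distr \<mu> borel \<alpha> = \<mu>}"

definition invariant_measures_on ::
    "('a::topological_space \<Rightarrow> 'a) \<Rightarrow> 'a set \<Rightarrow> 'a measure set" where
  "invariant_measures_on \<alpha> Y = {\<mu> \<in> invariant_measures \<alpha>. emeasure \<mu> (UNIV - Y) = 0}"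

definition essential_set :: "('a::topological_space \<Rightarrow> 'a) \<Rightarrow> 'a set" where
  "essential_set \<alpha> =
     {x. \<forall>V. open V \<and> x \<in> V \<longrightarrow> (\<exists>\<mu>\<in>invariant_measures \<alpha>. emeasure \<mu> V > 0)}"

text \<open>For a transfer operator on a compact Hausdorff space, the measure described below exists and
  is unique by the Riesz representation theorem.\<close>

definition kernel_measure ::
    "(('a::topological_space \<Rightarrow> complex) \<Rightarrow> ('a \<Rightarrow> complex)) \<Rightarrow> 'a \<Rightarrow> 'a measure" where
  "kernel_measure A x =
     (THE \<nu>. regular_borel_measure \<nu> \<and> (\<forall>f\<in>cfun UNIV. (\<integral>z. f z \<partial>\<nu>) = A f x))"

definition compatible ::
    "(('a::topological_space \<Rightarrow> complex) \<Rightarrow> ('a \<Rightarrow> complex)) \<Rightarrow> 'a set \<Rightarrow> bool" where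
  "compatible A Y \<longleftrightarrow>
     (\<forall>f\<in>cfun Y. continuous_on Y (\<lambda>x. set_lebesgue_integral (kernel_measure A x) Y f))"

definition trace_operator ::
    "(('a::topological_space \<Rightarrow> complex) \<Rightarrow> ('a \<Rightarrow> complex)) \<Rightarrow> 'a set
      \<Rightarrow> ('a \<Rightarrow> complex) \<Rightarrow> ('a \<Rightarrow> complex)" where
  "trace_operator A Y f =
     (\<lambda>x. if x \<in> Y then set_lebesgue_integral (kernel_measure A x) Y f else 0)"

definition sup_norm :: "'a set \<Rightarrow> ('a \<Rightarrow> complex) \<Rightarrow> real" where
  "sup_norm S f = (SUP x\<in>S. norm (f x))"

definition op_norm ::
    "'a::topological_space set \<Rightarrow> (('a \<Rightarrow> complex) \<Rightarrow> ('a \<Rightarrow> complex)) \<Rightarrow> real" where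
  "op_norm S T = (SUP f\<in>{f \<in> cfun S. sup_norm S f \<le> 1}. sup_norm S (T f))"

definition eln :: "real \<Rightarrow> ereal" where
  "eln r = (if r > 0 then ereal (ln r) else -\<infinity>)"

definition weighted ::
    "(('a \<Rightarrow> complex) \<Rightarrow> ('a \<Rightarrow> complex)) \<Rightarrow> ('a \<Rightarrow> real)
      \<Rightarrow> ('a \<Rightarrow> complex) \<Rightarrow> ('a \<Rightarrow> complex)" where
  "weighted T \<psi> f = T (\<lambda>x. complex_of_real (exp (\<psi> x)) * f x)"

text \<open>\<open>T\<close> is an operator on \<open>C(S)\<close>; only the restriction of \<open>\<psi>\<close> to \<open>S\<close> matters, because the elements
  of \<open>cfun S\<close> vanish off \<open>S\<close>.\<close>

definition spectral_potential ::
    "'a::topological_space set \<Rightarrow> (('a \<Rightarrow> complex) \<Rightarrow> ('a \<Rightarrow> complex)) \<Rightarrow> ('a \<Rightarrow> real) \<Rightarrow> ereal"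
  where
  "spectral_potential S T \<psi> =
     lim (\<lambda>n. eln (op_norm S (weighted T \<psi> ^^ n)) / ereal (real n))"

definition partitions_of_unity :: "'a::topological_space set \<Rightarrow> ('a \<Rightarrow> complex) set set" where
  "partitions_of_unity S =
     {G. finite G \<and> G \<subseteq> cfun S \<and> (\<forall>g\<in>G. \<forall>x. g x \<in> \<real>\<^sub>\<ge>\<^sub>0) \<and> (\<forall>x\<in>S. (\<Sum>g\<in>G. g x) = 1)}"

text \<open>The integrals of elements of a partition of unity and of their images under a positive
  operator are nonnegative reals; \<^const>\<open>Re\<close> only changes the type.\<close>

definition mean :: "'a measure \<Rightarrow> ('a \<Rightarrow> complex) \<Rightarrow> real" where
  "mean \<mu> f = Re (\<integral>x. f x \<partial>\<mu>)"

definition t_entropy ::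
    "'a::topological_space set \<Rightarrow> (('a \<Rightarrow> complex) \<Rightarrow> ('a \<Rightarrow> complex)) \<Rightarrow> 'a measure \<Rightarrow> ereal"
  where
  "t_entropy S T \<mu> =
     (INF n\<in>{n::nat. n \<ge> 1}. ereal (1 / real n) *
        (INF G\<in>partitions_of_unity S.
           (\<Sum>g\<in>G. if mean \<mu> g = 0 then 0
                   else ereal (mean \<mu> g) * eln (mean \<mu> ((T ^^ n) g) / mean \<mu> g))))"

definition is_max_over :: "ereal \<Rightarrow> ('b \<Rightarrow> ereal) \<Rightarrow> 'b set \<Rightarrow> bool" where
  "is_max_over v F M \<longleftrightarrow> (\<exists>m\<in>M. F m = v) \<and> (\<forall>m\<in>M. F m \<le> v)"

end

theory Submission
  imports Defs
begin

text \<open>Let \<open>S\<^sub>n \<phi>\<close> denote Birkhoff sums. Positivity and the homological identity give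
  \<open>\<parallel>A\<^sub>\<phi>\<^sup>n\<parallel> = sup A\<^sup>n e^(S\<^sub>n \<phi>)\<close>, so the spectral potential \<open>\<lambda>\<close> is convex, monotone, translation
  equivariant and invariant under adding coboundaries. By Hahn--Banach it has a subgradient \<open>\<mu>\<close> at
  every \<open>\<psi>\<close> with \<open>\<lambda>(\<psi>) > -\<infinity>\<close>, and by Riesz \<open>\<mu>\<close> is an invariant probability measure.

  The inequality \<open>\<mu>[\<psi>] + \<tau>(\<mu>) \<le> \<lambda>(\<psi>)\<close> is Jensen's inequality for a partition of unity on whose
  members \<open>S\<^sub>n \<psi>\<close> is nearly constant. It is an equality for a subgradient: for a partition \<open>G\<close> and
  weights \<open>a\<^sub>g\<close> the function \<open>v = \<Sum> e^(a\<^sub>g) A\<^sup>n g\<close> dominates \<open>A\<^sup>n e^(\<Sum> a\<^sub>g g)\<close>, so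
  \<open>\<phi> = (\<Sum> a\<^sub>g g - ln v \<circ> \<alpha>\<^sup>n) / n\<close> has \<open>\<lambda>(\<phi>) \<le> 0\<close>; the subgradient inequality at \<open>\<phi>\<close> with
  \<open>a\<^sub>g = ln (\<mu>[g] / \<mu>[A\<^sup>n g])\<close> is the required lower bound for the sum over \<open>G\<close>.

  For the essential set, a subgradient does not see a penalty vanishing on that set, whereas a
  large penalty off the set reduces the growth of \<open>A\<^sub>\<psi>\<^sup>n\<close> to that of the trace.\<close>

section \<open>Regular measures on compact Hausdorff spaces\<close>

text \<open>Three points shape the proof. The indicator of \<open>Y\<close> is in general
  discontinuous, so the trace inherits nothing formally from \<open>A\<close>: its homological
  identity rests on every kernel being carried by a fibre of \<alpha>, and its comparison with
  \<open>A\<close> on the regularity of the kernels. As X need not be metrizable, regularity has to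
  be carried along throughout; it makes kernels and invariant measures unique, and the Riesz theorem
  is proved in a form that provides it. Finally \<lambda> may be \<open>-\<infinity>\<close>, where
  no subgradient exists; there the inequality forces the value \<open>-\<infinity>\<close> for every
  invariant measure, and only the existence of one is at stake. To keep extended values out of the
  convex analysis, subgradients are derived from a relation between potentials and real bounds, an
  exponential growth estimate, rather than from \<lambda> as a function. Both X and \<open>Y\<close>
  are instances of one abstract setting of real operators on functions continuous on a compact set,
  so the variational argument is made once, and the complex operators return only for norms and
  entropies.\<close>

lemma compact_t2_normal_space:
  assumes "compact (UNIV :: 'a::t2_space set)"
  shows "normal_space (euclidean :: 'a topology)"
proof (rule compact_Hausdorff_or_regular_imp_normal_space)
  show "compact_space (euclidean :: 'a topology)"
    using assms by (simp add: compact_space_def)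
  show "Hausdorff_space (euclidean :: 'a topology) \<or> regular_space (euclidean :: 'a topology)"
    unfolding Hausdorff_space_def disjnt_def by (metis hausdorff open_openin)
qed

lemma Urysohn_function:
  fixes S T :: "'a::t2_space set"
  assumes "compact (UNIV :: 'a set)" "closed S" "closed T" "S \<inter> T = {}"
  obtains f :: "'a \<Rightarrow> real" where "continuous_on UNIV f" "\<And>x. 0 \<le> f x" "\<And>x. f x \<le> 1"
    "\<And>x. x \<in> S \<Longrightarrow> f x = 1" "\<And>x. x \<in> T \<Longrightarrow> f x = 0"
proof -
  obtain f where "continuous_map (euclidean :: 'a topology) (top_of_set {0..1::real}) f"
      "f ` T \<subseteq> {0}" "f ` S \<subseteq> {1}"
    using Urysohn_lemma[OF compact_t2_normal_space[OF assms(1)], of T S 0 1] assms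
    by (auto simp: disjnt_def Int_commute)
  then show thesis
    by (intro that[of f]) (auto simp: continuous_map_in_subtopology image_subset_iff)
qed

lemma continuous_extension:
  fixes f :: "'a::t2_space \<Rightarrow> real"
  assumes "compact (UNIV :: 'a set)" "closed S" "continuous_on S f"
  obtains g where "continuous_on UNIV g" "\<And>x. x \<in> S \<Longrightarrow> g x = f x"
proof -
  obtain g where "continuous_map (euclidean :: 'a topology) euclideanreal g" "\<And>x. x \<in> S \<Longrightarrow> g x = f x"
    using Tietze_extension_realinterval[OF compact_t2_normal_space[OF assms(1)], of S UNIV f] assms
    by auto
  then show thesis
    by (intro that[of g]) auto
qed

section \<open>Riesz representation by an outer measure built from continuous bumps\<close>

locale positive_functional =
  fixes L :: "('a::t2_space \<Rightarrow> real) \<Rightarrow> real"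
  assumes compact: "compact (UNIV :: 'a set)"
    and add: "continuous_on UNIV f \<Longrightarrow> continuous_on UNIV g \<Longrightarrow> L (\<lambda>x. f x + g x) = L f + L g"
    and scale: "continuous_on UNIV f \<Longrightarrow> L (\<lambda>x. c * f x) = c * L f"
    and nonneg: "continuous_on UNIV f \<Longrightarrow> (\<And>x. 0 \<le> f x) \<Longrightarrow> 0 \<le> L f"
begin

lemma mono:
  assumes "continuous_on UNIV f" "continuous_on UNIV g" "\<And>x. f x \<le> g x"
  shows "L f \<le> L g"
proof -
  have "0 \<le> L (\<lambda>x. g x + (-1) * f x)"
    using assms by (intro nonneg continuous_intros) auto
  also have "\<dots> = L g - L f"
    using assms by (subst add) (auto intro!: continuous_intros simp: scale[of f "-1", simplified])
  finally show ?thesis by simp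
qed

lemma sum:
  assumes "finite I" "\<And>i. i \<in> I \<Longrightarrow> continuous_on UNIV (f i)"
  shows "L (\<lambda>x. \<Sum>i\<in>I. f i x) = (\<Sum>i\<in>I. L (f i))"
  using assms
proof (induction I rule: finite_induct)
  case empty
  then show ?case using scale[of "\<lambda>_. 0" 0] by simp
next
  case (insert i I)
  then show ?case by (simp add: add continuous_on_sum)
qed

definition bumps :: "'a set \<Rightarrow> ('a \<Rightarrow> real) set" where
  "bumps U = {f. continuous_on UNIV f \<and> (\<forall>x. 0 \<le> f x \<and> f x \<le> 1) \<and> (\<forall>x. x \<notin> U \<longrightarrow> f x = 0)}"

definition content_of_open :: "'a set \<Rightarrow> ennreal" where
  "content_of_open U = (SUP f\<in>bumps U. ennreal (L f))"

lemma bumps_mono: "U \<subseteq> V \<Longrightarrow> bumps U \<subseteq> bumps V"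
  by (auto simp: bumps_def)

lemma content_of_open_mono: "U \<subseteq> V \<Longrightarrow> content_of_open U \<le> content_of_open V"
  unfolding content_of_open_def using bumps_mono by (intro SUP_subset_mono) auto

lemma le_content_of_open: "f \<in> bumps U \<Longrightarrow> ennreal (L f) \<le> content_of_open U"
  unfolding content_of_open_def by (rule SUP_upper)

text \<open>Cutting a bump off at height \<open>\<delta>\<close> makes it vanish outside the compact set \<open>{x. \<delta> \<le> f x}\<close> and
  changes the functional by at most \<open>\<delta> * L 1\<close>.\<close>

definition cut :: "real \<Rightarrow> ('a \<Rightarrow> real) \<Rightarrow> 'a \<Rightarrow> real" where
  "cut \<delta> f x = max 0 (f x - \<delta>)"

lemma continuous_cut: "continuous_on UNIV f \<Longrightarrow> continuous_on UNIV (cut \<delta> f)"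
  unfolding cut_def by (intro continuous_intros)

lemma cut_bump: "f \<in> bumps U \<Longrightarrow> 0 < \<delta> \<Longrightarrow> cut \<delta> f \<in> bumps {x. \<delta> \<le> f x}"
  unfolding bumps_def using continuous_cut[of f \<delta>] by (auto simp: cut_def max_def) (smt (verit))+

lemma closed_superlevel: "f \<in> bumps U \<Longrightarrow> closed {x. \<delta> \<le> f x}"
  unfolding bumps_def by (intro closed_Collect_le continuous_intros) auto

lemma L_le_cut:
  assumes "f \<in> bumps U" "0 < \<delta>"
  shows "L f \<le> L (cut \<delta> f) + \<delta> * L (\<lambda>_. 1)"
proof -
  have c: "continuous_on UNIV f" using assms by (simp add: bumps_def)
  have "L f \<le> L (\<lambda>x. cut \<delta> f x + \<delta> * 1)"
    by (intro mono continuous_intros c continuous_cut) (simp add: cut_def)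
  also have "\<dots> = L (cut \<delta> f) + \<delta> * L (\<lambda>_. 1)"
    using c by (subst add) (auto intro!: continuous_intros continuous_cut simp: scale[of "\<lambda>_. 1" \<delta>, simplified])
  finally show ?thesis .
qed

lemma L1_nonneg: "0 \<le> L (\<lambda>_. 1)"
  by (rule nonneg) auto

text \<open>Allows a supremum over bumps to be estimated on their cuts only, since the error
  \<open>\<delta> * L 1\<close> can be made arbitrarily small.\<close>

lemma L_le_by_cuts:
  assumes "f \<in> bumps U" "\<And>\<delta>. 0 < \<delta> \<Longrightarrow> ennreal (L (cut \<delta> f)) \<le> b"
  shows "ennreal (L f) \<le> b"
proof (rule ennreal_le_epsilon)
  fix e :: real assume e: "0 < e"
  define \<delta> where "\<delta> = e / (L (\<lambda>_. 1) + 1)"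
  have \<delta>: "0 < \<delta>" "\<delta> * L (\<lambda>_. 1) \<le> e"
    using e L1_nonneg by (auto simp: \<delta>_def field_simps add_pos_nonneg)
  have "0 \<le> L (cut \<delta> f)"
    using assms(1) by (intro nonneg continuous_cut) (auto simp: bumps_def cut_def)
  have "ennreal (L f) \<le> ennreal (L (cut \<delta> f) + e)"
    using L_le_cut[OF assms(1) \<delta>(1)] \<delta>(2) by (intro ennreal_leI) auto
  also have "\<dots> = ennreal (L (cut \<delta> f)) + ennreal e"
    using e \<open>0 \<le> L (cut \<delta> f)\<close> by simp
  also have "\<dots> \<le> b + ennreal e"
    using assms(2)[OF \<delta>(1)] by (intro add_right_mono)
  finally show "ennreal (L f) \<le> b + ennreal e" .
qed

text \<open>A Urysohn function equal to 1 on the part of the superlevel set outside \<open>V\<close>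
  and to 0 off \<open>U\<close> divides the cut into a bump of \<open>U\<close> and a bump of
  \<open>V\<close>.\<close>

lemma content_of_open_Un:
  assumes "open U" "open V"
  shows "content_of_open (U \<union> V) \<le> content_of_open U + content_of_open V"
  unfolding content_of_open_def[of "U \<union> V"]
proof (rule SUP_least, rule L_le_by_cuts)
  fix f \<delta> assume f: "f \<in> bumps (U \<union> V)" and \<delta>: "0 < (\<delta>::real)"
  let ?K = "{x. \<delta> \<le> f x}"
  have "?K \<subseteq> U \<union> V" using f \<delta> by (auto simp: bumps_def)
  then have "closed (?K - V)" "closed (- U)" "(?K - V) \<inter> - U = {}"
    using closed_superlevel[OF f, of \<delta>] assms by auto
  then obtain g :: "'a \<Rightarrow> real" where g: "continuous_on UNIV g" "\<And>x. 0 \<le> g x" "\<And>x. g x \<le> 1"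
      "\<And>x. x \<in> ?K - V \<Longrightarrow> g x = 1" "\<And>x. x \<in> - U \<Longrightarrow> g x = 0"
    by (rule Urysohn_function[OF compact]) blast
  have h: "cut \<delta> f \<in> bumps ?K" using cut_bump f \<delta> by auto
  then have c: "continuous_on UNIV (cut \<delta> f)" by (simp add: bumps_def)
  have U: "(\<lambda>x. g x * cut \<delta> f x) \<in> bumps U" and V: "(\<lambda>x. (1 - g x) * cut \<delta> f x) \<in> bumps V"
    using h g c by (auto simp: bumps_def mult_le_one intro!: continuous_intros) metis+
  have "L (cut \<delta> f) = L (\<lambda>x. g x * cut \<delta> f x + (1 - g x) * cut \<delta> f x)"
    by (simp add: algebra_simps)
  also have "\<dots> = L (\<lambda>x. g x * cut \<delta> f x) + L (\<lambda>x. (1 - g x) * cut \<delta> f x)"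
    by (intro add continuous_intros c g)
  also have "ennreal \<dots> = ennreal (L (\<lambda>x. g x * cut \<delta> f x)) + ennreal (L (\<lambda>x. (1 - g x) * cut \<delta> f x))"
    using U V by (intro ennreal_plus nonneg) (auto simp: bumps_def)
  also have "\<dots> \<le> content_of_open U + content_of_open V"
    by (intro add_mono le_content_of_open U V)
  finally show "ennreal (L (cut \<delta> f)) \<le> content_of_open U + content_of_open V" .
qed

lemma content_of_open_empty: "content_of_open {} = 0"
proof -
  have "bumps {} = {\<lambda>_. 0}" by (auto simp: bumps_def)
  then show ?thesis using scale[of "\<lambda>_. 0" 0] by (simp add: content_of_open_def)
qed

lemma content_of_open_finite_Union:
  assumes "\<And>i. open (U i)"
  shows "content_of_open (\<Union>i<(n::nat). U i) \<le> (\<Sum>i<n. content_of_open (U i))"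
proof (induction n)
  case 0
  then show ?case by (simp add: content_of_open_empty)
next
  case (Suc n)
  have "(\<Union>i<Suc n. U i) = (\<Union>i<n. U i) \<union> U n" by (auto simp: less_Suc_eq)
  then have "content_of_open (\<Union>i<Suc n. U i) \<le> content_of_open (\<Union>i<n. U i) + content_of_open (U n)"
    using content_of_open_Un[OF open_UN assms, of "{..<n}" U n] assms by (simp add: Un_commute)
  also have "\<dots> \<le> (\<Sum>i<Suc n. content_of_open (U i))"
    using Suc by (simp add: add_right_mono)
  finally show ?case .
qed

text \<open>A cut vanishes off a compact superlevel set, which finitely many of the
  \<open>U i\<close> cover; countable subadditivity thus reduces to the finite case.\<close>

lemma content_of_open_UN:
  assumes "\<And>i. open (U i)"
  shows "content_of_open (\<Union>i::nat. U i) \<le> (\<Sum>i. content_of_open (U i))"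
  unfolding content_of_open_def[of "\<Union>i. U i"]
proof (rule SUP_least, rule L_le_by_cuts)
  fix f \<delta> assume f: "f \<in> bumps (\<Union>i. U i)" and \<delta>: "0 < (\<delta>::real)"
  let ?K = "{x. \<delta> \<le> f x}"
  have K: "?K \<subseteq> (\<Union>i. U i)"
  proof
    fix x assume "x \<in> ?K"
    then have "f x \<noteq> 0" using \<delta> by auto
    then show "x \<in> (\<Union>i. U i)" using f unfolding bumps_def by blast
  qed
  have "compact ?K"
    using closed_superlevel[OF f] compact closed_Int_compact[of ?K UNIV] by auto
  then obtain I where I: "finite I" "?K \<subseteq> (\<Union>i\<in>I. U i)"
    using K assms by (meson compactE_image UNIV_I)
  obtain n where "I \<subseteq> {..<n}" using I(1) by (metis finite_nat_iff_bounded)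
  then have "?K \<subseteq> (\<Union>i<n. U i)" using I(2) by (meson UN_mono order_refl order_trans)
  then have "cut \<delta> f \<in> bumps (\<Union>i<n. U i)"
    using cut_bump[OF f \<delta>] bumps_mono by blast
  then have "ennreal (L (cut \<delta> f)) \<le> content_of_open (\<Union>i<n. U i)" by (rule le_content_of_open)
  also have "\<dots> \<le> (\<Sum>i<n. content_of_open (U i))" by (rule content_of_open_finite_Union[OF assms])
  also have "\<dots> \<le> (\<Sum>i. content_of_open (U i))" by (rule sum_le_suminf) auto
  finally show "ennreal (L (cut \<delta> f)) \<le> (\<Sum>i. content_of_open (U i))" .
qed

definition outer :: "'a set \<Rightarrow> ennreal" where
  "outer E = (INF U\<in>{U. open U \<and> E \<subseteq> U}. content_of_open U)"

lemma outer_open: "open U \<Longrightarrow> outer U = content_of_open U"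
  unfolding outer_def by (intro antisym INF_lower INF_greatest) (auto intro: content_of_open_mono)

lemma outer_mono: "E \<subseteq> F \<Longrightarrow> outer E \<le> outer F"
  unfolding outer_def by (rule INF_superset_mono) auto

lemma outer_le: "open U \<Longrightarrow> E \<subseteq> U \<Longrightarrow> outer E \<le> content_of_open U"
  unfolding outer_def by (rule INF_lower) auto

lemma outer_UN: "outer (\<Union>i::nat. E i) \<le> (\<Sum>i. outer (E i))"
proof (rule ennreal_le_epsilon)
  fix e :: real assume "0 < e" "(\<Sum>i. outer (E i)) < top"
  then have "outer (E n) < outer (E n) + e * (1/2)^Suc n" for n
    by (auto simp add: less_top dest!: ennreal_suminf_lessD)
  then have "\<exists>U. (open U \<and> E n \<subseteq> U) \<and> content_of_open U < outer (E n) + e * (1/2)^Suc n" for n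
    unfolding outer_def INF_less_iff by auto
  then obtain U where U: "\<And>n. open (U n)" "\<And>n. E n \<subseteq> U n"
      "\<And>n. content_of_open (U n) < outer (E n) + e * (1/2)^Suc n"
    by metis
  have "outer (\<Union>i. E i) \<le> content_of_open (\<Union>i. U i)"
    using U by (intro outer_le) auto
  also have "\<dots> \<le> (\<Sum>i. content_of_open (U i))"
    by (rule content_of_open_UN[OF U(1)])
  also have "\<dots> \<le> (\<Sum>n. outer (E n) + e * (1/2) ^ Suc n)"
    using U(3) by (intro suminf_le allI) (auto intro: less_imp_le)
  also have "... = (\<Sum>n. outer (E n)) + (\<Sum>n. ennreal e * ennreal ((1/2) ^ Suc n))"
    using \<open>0 < e\<close> by (subst suminf_add[symmetric])
                     (auto simp del: ennreal_suminf_cmult simp add: ennreal_mult[symmetric])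
  also have "\<dots> = (\<Sum>n. outer (E n)) + e"
    unfolding ennreal_suminf_cmult
    by (subst suminf_ennreal_eq[OF zero_le_power power_half_series]) auto
  finally show "outer (\<Union>i. E i) \<le> (\<Sum>n. outer (E n)) + e" .
qed

lemma outer_empty: "outer {} = 0"
  using content_of_open_empty by (simp add: outer_open)

lemma outer_measure_space_outer: "outer_measure_space (Pow UNIV) outer"
  unfolding outer_measure_space_def positive_def increasing_def countably_subadditive_def
  using outer_UN outer_mono outer_empty by auto

text \<open>Caratheodory's condition tested on an open set \<open>V\<close>. A cut bump of
  \<open>V \<inter> U\<close> vanishes off a closed set \<open>?K\<close> inside
  \<open>V \<inter> U\<close>, so adding to it any bump of \<open>V - ?K\<close> again gives a bump
  of \<open>V\<close>, and \<open>V - ?K\<close> contains \<open>V - U\<close>.\<close>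

lemma content_of_open_split:
  assumes "open U" "open V"
  shows "outer (V \<inter> U) + outer (V - U) \<le> content_of_open V"
proof -
  have "ennreal (L f) \<le> content_of_open V - outer (V - U)" if f: "f \<in> bumps (V \<inter> U)" for f
  proof (rule L_le_by_cuts[OF f])
    fix \<delta> :: real assume \<delta>: "0 < \<delta>"
    let ?K = "{x. \<delta> \<le> f x}"
    have K: "?K \<subseteq> V \<inter> U" using f \<delta> by (auto simp: bumps_def)
    have h: "cut \<delta> f \<in> bumps ?K" using cut_bump[OF f \<delta>] .
    have "outer (V - U) \<le> content_of_open (V - ?K)"
      using K assms closed_superlevel[OF f] by (intro outer_le open_Diff) auto
    also have "\<dots> \<le> content_of_open V - ennreal (L (cut \<delta> f))"
      unfolding content_of_open_def[of "V - _"]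
    proof (rule SUP_least)
      fix g assume g: "g \<in> bumps (V - ?K)"
      have "cut \<delta> f x + g x \<le> 1" "0 \<le> cut \<delta> f x + g x" for x
        using h g by (cases "x \<in> ?K"; auto simp: bumps_def)+
      moreover have "x \<notin> V \<Longrightarrow> cut \<delta> f x + g x = 0" for x
        using h g K by (cases "x \<in> ?K") (auto simp: bumps_def)
      ultimately have "(\<lambda>x. cut \<delta> f x + g x) \<in> bumps V"
        using h g by (auto simp: bumps_def intro!: continuous_intros)
      then have "ennreal (L (\<lambda>x. cut \<delta> f x + g x)) \<le> content_of_open V"
        by (rule le_content_of_open)
      moreover have "L (\<lambda>x. cut \<delta> f x + g x) = L (cut \<delta> f) + L g"
        using h g by (intro add) (auto simp: bumps_def)
      moreover have "0 \<le> L (cut \<delta> f)" "0 \<le> L g"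
        using h g by (auto intro!: nonneg simp: bumps_def)
      ultimately have "ennreal (L g) + ennreal (L (cut \<delta> f)) \<le> content_of_open V"
        by (simp add: add.commute flip: ennreal_plus)
      then show "ennreal (L g) \<le> content_of_open V - ennreal (L (cut \<delta> f))"
        by (simp add: ennreal_le_minus_iff add.commute)
    qed
    finally have "outer (V - U) + ennreal (L (cut \<delta> f)) \<le> content_of_open V"
      using le_content_of_open[of "cut \<delta> f" V] h K bumps_mono[of ?K V]
      by (subst (asm) ennreal_le_minus_iff) (auto simp: add.commute)
    then show "ennreal (L (cut \<delta> f)) \<le> content_of_open V - outer (V - U)"
      by (simp add: ennreal_le_minus_iff add.commute)
  qed
  then have "content_of_open (V \<inter> U) \<le> content_of_open V - outer (V - U)"
    unfolding content_of_open_def[of "V \<inter> U"] by (rule SUP_least)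
  moreover have "outer (V - U) \<le> content_of_open V"
    using assms by (intro outer_le) auto
  ultimately show ?thesis
    using assms by (auto simp: outer_open open_Int ennreal_le_minus_iff add.commute)
qed

lemma open_in_lambda_system:
  assumes "open U"
  shows "U \<in> lambda_system UNIV (Pow UNIV) outer"
proof -
  have "outer (U \<inter> E) + outer ((UNIV - U) \<inter> E) = outer E" for E
  proof (rule antisym)
    show "outer (U \<inter> E) + outer ((UNIV - U) \<inter> E) \<le> outer E"
      unfolding outer_def[of E]
    proof (rule INF_greatest)
      fix V assume V: "V \<in> {V. open V \<and> E \<subseteq> V}"
      then have "outer (U \<inter> E) + outer ((UNIV - U) \<inter> E) \<le> outer (V \<inter> U) + outer (V - U)"
        by (intro add_mono outer_mono) auto
      also have "\<dots> \<le> content_of_open V"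
        using V assms by (intro content_of_open_split) auto
      finally show "outer (U \<inter> E) + outer ((UNIV - U) \<inter> E) \<le> content_of_open V" .
    qed
    have "subadditive (Pow UNIV) outer"
      using outer_measure_space_outer sigma_algebra_Pow
      by (metis outer_measure_space_def ring_of_sets.countably_subadditive_subadditive
          ring_of_sets_Pow)
    then have "outer ((U \<inter> E) \<union> ((UNIV - U) \<inter> E)) \<le> outer (U \<inter> E) + outer ((UNIV - U) \<inter> E)"
      by (rule subadditiveD) auto
    moreover have "(U \<inter> E) \<union> ((UNIV - U) \<inter> E) = E" by auto
    ultimately show "outer E \<le> outer (U \<inter> E) + outer ((UNIV - U) \<inter> E)" by simp
  qed
  then show ?thesis by (auto simp: lambda_system_def)
qed

definition riesz_measure :: "'a measure" where
  "riesz_measure = measure_of UNIV (sets borel) outer"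

lemma sets_riesz_measure [simp, measurable_cong]: "sets riesz_measure = sets borel"
  unfolding riesz_measure_def using sets.sets_measure_of_eq[of borel] by simp

lemma space_riesz_measure [simp]: "space riesz_measure = UNIV"
  using sets_eq_imp_space_eq[OF sets_riesz_measure] by simp

lemma emeasure_riesz_measure:
  assumes "B \<in> sets borel"
  shows "emeasure riesz_measure B = outer B"
  unfolding riesz_measure_def
proof (rule emeasure_measure_of_sigma)
  have ms: "measure_space UNIV (lambda_system UNIV (Pow UNIV) outer) outer"
    using sigma_algebra.caratheodory_lemma[OF sigma_algebra_Pow outer_measure_space_outer] by simp
  then have "sigma_algebra UNIV (lambda_system UNIV (Pow UNIV) outer)"
    by (simp add: measure_space_def)
  then have sub: "sets borel \<subseteq> lambda_system UNIV (Pow UNIV) outer"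
    using sigma_algebra.sigma_sets_subset[of UNIV "lambda_system UNIV (Pow UNIV) outer" "{S. open S}"]
      open_in_lambda_system by (auto simp: borel_def)
  show "sigma_algebra UNIV (sets (borel :: 'a measure))"
    using sets.sigma_algebra_axioms[of "borel :: 'a measure"] by simp
  show "positive (sets borel) outer" by (simp add: positive_def outer_empty)
  show "countably_additive (sets borel) outer"
    using ms sub unfolding measure_space_def countably_additive_def by blast
  show "B \<in> sets borel" by fact
qed

lemma finite_riesz_measure: "finite_measure riesz_measure"
proof
  have "content_of_open UNIV \<le> ennreal (L (\<lambda>_. 1))"
    unfolding content_of_open_def by (intro SUP_least ennreal_leI mono) (auto simp: bumps_def)
  then show "emeasure riesz_measure (space riesz_measure) \<noteq> \<infinity>"
    by (auto simp: emeasure_riesz_measure outer_open top_unique)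
qed

lemma emeasure_riesz_measure_UNIV: "emeasure riesz_measure UNIV = ennreal (L (\<lambda>_. 1))"
proof -
  have "(\<lambda>_. 1) \<in> bumps UNIV" by (auto simp: bumps_def)
  then have "content_of_open UNIV = ennreal (L (\<lambda>_. 1))"
    unfolding content_of_open_def
    by (intro antisym SUP_upper SUP_least ennreal_leI mono) (auto simp: bumps_def)
  then show ?thesis by (simp add: emeasure_riesz_measure outer_open)
qed

end

section \<open>Regular Borel measures: a criterion and approximation\<close>

text \<open>On a compact space outer regularity yields inner regularity: the complement of an open
  set around \<open>-B\<close> is a compact subset of \<open>B\<close>, and finiteness turns the
  excess of one into the deficit of the other.\<close>

lemma regular_borel_measureI:
  fixes M :: "'a::t2_space measure"
  assumes comp: "compact (UNIV :: 'a set)" and sets: "sets M = sets borel" and fin: "finite_measure M"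
    and out: "\<And>B. B \<in> sets borel \<Longrightarrow> (INF U\<in>{U. open U \<and> B \<subseteq> U}. emeasure M U) \<le> emeasure M B"
  shows "regular_borel_measure M"
  unfolding regular_borel_measure_def
proof (intro conjI ballI sets fin)
  interpret finite_measure M by (rule fin)
  have sp: "space M = UNIV" using sets_eq_imp_space_eq[OF sets] by simp
  fix B :: "'a set" assume B: "B \<in> sets borel"
  show "emeasure M B = (INF U\<in>{U. open U \<and> B \<subseteq> U}. emeasure M U)"
    using B sets by (intro antisym INF_greatest out emeasure_mono) auto
  show "emeasure M B = (SUP K\<in>{K. compact K \<and> K \<in> sets borel \<and> K \<subseteq> B}. emeasure M K)"
  proof (rule antisym)
    show "(SUP K\<in>{K. compact K \<and> K \<in> sets borel \<and> K \<subseteq> B}. emeasure M K) \<le> emeasure M B"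
      using B sets by (intro SUP_least emeasure_mono) auto
    show "emeasure M B \<le> (SUP K\<in>{K. compact K \<and> K \<in> sets borel \<and> K \<subseteq> B}. emeasure M K)"
    proof (rule ennreal_le_epsilon)
      fix e :: real assume e: "0 < e"
      have "(INF U\<in>{U. open U \<and> -B \<subseteq> U}. emeasure M U) < emeasure M (-B) + ennreal e"
        using e out[of "-B"] B by (intro le_less_trans[OF out]) (auto simp: emeasure_eq_measure)
      then obtain U where U: "open U" "-B \<subseteq> U" "emeasure M U < emeasure M (-B) + ennreal e"
        by (auto simp: INF_less_iff)
      have "compact (-U)" using U comp closed_Int_compact[of "-U" UNIV] by auto
      have "measure M U < measure M (-B) + e"
        using U(3) e by (simp add: emeasure_eq_measure ennreal_less_iff flip: ennreal_plus)
      moreover have "measure M (-B) = measure M UNIV - measure M B" "measure M (-U) = measure M UNIV - measure M U"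
        using B U sets sp finite_measure_compl[of B] finite_measure_compl[of U] by (auto simp: Compl_eq_Diff_UNIV)
      ultimately have "measure M B \<le> measure M (-U) + e" by simp
      then have "emeasure M B \<le> emeasure M (-U) + ennreal e"
        using e by (simp add: emeasure_eq_measure flip: ennreal_plus)
      also have "emeasure M (-U) \<le> (SUP K\<in>{K. compact K \<and> K \<in> sets borel \<and> K \<subseteq> B}. emeasure M K)"
        using U \<open>compact (-U)\<close> by (intro SUP_upper) auto
      finally show "emeasure M B \<le> (SUP K\<in>{K. compact K \<and> K \<in> sets borel \<and> K \<subseteq> B}. emeasure M K) + ennreal e"
        by (simp add: add_right_mono)
    qed
  qed
qed

lemma regular_borel_measure_simps:
  assumes "regular_borel_measure M"
  shows "sets M = sets borel" "space M = UNIV" "finite_measure M"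
  using assms sets_eq_imp_space_eq[of M borel] unfolding regular_borel_measure_def by auto

lemma regular_borel_measure_outer:
  assumes "regular_borel_measure M" "B \<in> sets borel"
  shows "emeasure M B = (INF U\<in>{U. open U \<and> B \<subseteq> U}. emeasure M U)"
  using assms unfolding regular_borel_measure_def by blast

lemma regular_borel_measure_inner:
  assumes "regular_borel_measure M" "B \<in> sets borel"
  shows "emeasure M B = (SUP K\<in>{K. compact K \<and> K \<in> sets borel \<and> K \<subseteq> B}. emeasure M K)"
  using assms unfolding regular_borel_measure_def by blast

lemma regular_borel_measure_outer_approx:
  assumes M: "regular_borel_measure M" and B: "B \<in> sets borel" and e: "(0::real) < e"
  obtains U where "open U" "B \<subseteq> U" "measure M U < measure M B + e"
proof -
  interpret finite_measure M using regular_borel_measure_simps[OF M] by simp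
  have "ennreal (measure M B) < ennreal (measure M B + e)"
    using e by (intro ennreal_lessI) (auto simp: add_nonneg_pos)
  then have "(INF U\<in>{U. open U \<and> B \<subseteq> U}. emeasure M U) < ennreal (measure M B + e)"
    using regular_borel_measure_outer[OF M B] emeasure_eq_measure[of B] by simp
  then show thesis
    using that by (auto simp: INF_less_iff emeasure_eq_measure ennreal_less_iff)
qed

lemma regular_borel_measure_inner_approx:
  assumes M: "regular_borel_measure M" and B: "B \<in> sets borel" and e: "(0::real) < e"
  obtains K where "compact K" "K \<in> sets borel" "K \<subseteq> B" "measure M B < measure M K + e"
proof (rule ccontr)
  interpret finite_measure M using regular_borel_measure_simps[OF M] by simp
  assume "\<not> thesis"
  with that have *: "measure M K + e \<le> measure M B" if "compact K" "K \<in> sets borel" "K \<subseteq> B" for K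
    using that by force
  have "emeasure M B \<le> ennreal (measure M B - e)"
    unfolding regular_borel_measure_inner[OF M B]
    by (rule SUP_least) (use * in \<open>auto simp: emeasure_eq_measure intro!: ennreal_leI dest!: *\<close>)
  then show False
    using e *[of "{}"] by (simp add: emeasure_eq_measure)
qed

lemma integrable_continuous_compact:
  fixes f :: "'a::t2_space \<Rightarrow> 'b::{banach,second_countable_topology}"
  assumes comp: "compact (UNIV :: 'a set)" and M: "sets M = sets borel" "finite_measure M"
    and f: "continuous_on UNIV f"
  shows "integrable M f"
proof -
  interpret finite_measure M by fact
  have "bounded (range f)"
    using comp f by (intro compact_imp_bounded compact_continuous_image)
  then obtain B where "\<And>x. norm (f x) \<le> B" by (auto simp: bounded_iff)
  then show ?thesis
    using borel_measurable_continuous_onI[OF f] M(1)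
    by (intro integrable_const_bound[of f B]) (auto cong: measurable_cong_sets)
qed

lemma sum_clamp:
  fixes t :: real
  assumes "0 \<le> t"
  shows "(\<Sum>i<n. max 0 (min 1 (t - real i))) = min t (real n)"
  using assms by (induction n) auto

section \<open>Integration against the Riesz measure\<close>

context positive_functional
begin

lemma regular_riesz_measure: "regular_borel_measure riesz_measure"
proof (rule regular_borel_measureI[OF compact sets_riesz_measure finite_riesz_measure])
  fix B :: "'a set" assume "B \<in> sets borel"
  then show "(INF U\<in>{U. open U \<and> B \<subseteq> U}. emeasure riesz_measure U) \<le> emeasure riesz_measure B"
    unfolding emeasure_riesz_measure[OF \<open>B \<in> sets borel\<close>] outer_def[of B]
    by (intro order_eq_refl INF_cong) (auto simp: emeasure_riesz_measure outer_open)
qed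

lemma integrable_riesz_measure: "continuous_on UNIV f \<Longrightarrow> integrable riesz_measure (f :: 'a \<Rightarrow> real)"
  by (intro integrable_continuous_compact compact finite_riesz_measure) auto

text \<open>The function \<open>f\<close> is sliced horizontally: \<open>n * f\<close> is the sum of the functions
  \<open>clamp (n * f - i)\<close>, each of which is squeezed between the indicators of two consecutive
  superlevel sets.\<close>

lemma L_le_integral_unit:
  assumes f: "continuous_on UNIV f" "\<And>x. 0 \<le> f x" "\<And>x. f x \<le> 1"
  shows "L f \<le> (\<integral>x. f x \<partial>riesz_measure)"
proof (rule field_le_epsilon)
  interpret finite_measure riesz_measure by (rule finite_riesz_measure)
  fix e :: real assume e: "0 < e"
  obtain n where n: "n \<noteq> 0" "L (\<lambda>_. 1) / real n < e"
    using real_arch_inverse[of "e / (L (\<lambda>_. 1) + 1)"] e L1_nonneg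
    by (auto simp: field_simps)
  define u where "u i x = max 0 (min 1 (real n * f x - real i))" for i x
  define U where "U i = {x. real i < real n * f x}" for i
  have u: "continuous_on UNIV (u i)" for i
    unfolding u_def by (intro continuous_intros f)
  have nf: "(\<Sum>i<n. u i x) = real n * f x" for x
    using f(2,3)[of x] n unfolding u_def by (subst sum_clamp) (auto simp: mult_le_cancel_left1)
  have oU: "open (U i)" for i
    unfolding U_def by (intro open_Collect_less continuous_intros f)
  have meas: "measure riesz_measure (U i) = enn2real (content_of_open (U i))" for i
    using oU by (simp add: measure_def emeasure_riesz_measure outer_open)
  have Lu: "L (u i) \<le> measure riesz_measure (U i)" for i
  proof -
    have "u i \<in> bumps (U i)" using u by (auto simp: bumps_def u_def U_def)
    then have "ennreal (L (u i)) \<le> emeasure riesz_measure (U i)"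
      using oU by (simp add: emeasure_riesz_measure outer_open le_content_of_open)
    then show ?thesis by (simp add: emeasure_eq_measure)
  qed
  have uI: "measure riesz_measure (U (Suc i)) \<le> (\<integral>x. u i x \<partial>riesz_measure)" for i
  proof -
    have "measure riesz_measure (U (Suc i)) = (\<integral>x. indicator (U (Suc i)) x \<partial>riesz_measure)"
      using oU by simp
    also have "\<dots> \<le> (\<integral>x. u i x \<partial>riesz_measure)"
      using oU[of "Suc i"] by (intro integral_mono[OF integrable_real_indicator integrable_riesz_measure[OF u]])
        (auto simp: U_def u_def indicator_def less_top[symmetric] split: if_splits)
    finally show ?thesis .
  qed
  have "real n * L f = L (\<lambda>x. \<Sum>i<n. u i x)"
    using scale[OF f(1)] by (simp add: nf)
  also have "\<dots> = (\<Sum>i<n. L (u i))" by (rule sum) (auto simp: u)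
  also have "\<dots> \<le> (\<Sum>i<n. measure riesz_measure (U i))" by (intro sum_mono Lu)
  \<comment> \<open>One more superlevel set is added so that the index can be shifted by one. The
    shift costs the measure of \<open>U 0\<close>, which is at most \<open>L 1\<close> and becomes
    negligible after division by \<open>n\<close>.\<close>
  also have "\<dots> \<le> (\<Sum>i<Suc n. measure riesz_measure (U i))" by simp
  also have "\<dots> = measure riesz_measure (U 0) + (\<Sum>i<n. measure riesz_measure (U (Suc i)))"
    by (rule sum.lessThan_Suc_shift)
  also have "\<dots> \<le> L (\<lambda>_. 1) + (\<Sum>i<n. \<integral>x. u i x \<partial>riesz_measure)"
  proof (intro add_mono sum_mono uI)
    show "measure riesz_measure (U 0) \<le> L (\<lambda>_. 1)"
      using finite_measure_mono[of "U 0" UNIV] L1_nonneg emeasure_riesz_measure_UNIV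
      by (simp add: measure_def[of _ UNIV])
  qed
  also have "(\<Sum>i<n. \<integral>x. u i x \<partial>riesz_measure) = real n * (\<integral>x. f x \<partial>riesz_measure)"
    using u by (subst Bochner_Integration.integral_sum[symmetric]) (auto intro: integrable_riesz_measure simp: nf)
  finally have "L f \<le> L (\<lambda>_. 1) / real n + (\<integral>x. f x \<partial>riesz_measure)"
    using n by (simp add: field_simps)
  then show "L f \<le> (\<integral>x. f x \<partial>riesz_measure) + e" using n by simp
qed

text \<open>An affine change of scale moves the values of \<open>f\<close> into the unit interval;
  the constants match because the total mass is \<open>L 1\<close>.\<close>

lemma L_le_integral:
  assumes f: "continuous_on UNIV f"
  shows "L f \<le> (\<integral>x. f x \<partial>riesz_measure)"
proof -
  interpret finite_measure riesz_measure by (rule finite_riesz_measure)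
  have "bounded (range f)"
    using compact f by (intro compact_imp_bounded compact_continuous_image)
  then obtain B where B: "0 < B" "\<And>x. \<bar>f x\<bar> \<le> B" by (auto simp: bounded_pos)
  define g where "g x = f x * (1 / (2 * B)) + 1/2" for x
  have gc: "continuous_on UNIV g" unfolding g_def by (intro continuous_intros f)
  have fg: "f = (\<lambda>x. 2 * B * g x + (- B) * 1)" using B by (auto simp: g_def field_simps)
  have m: "measure riesz_measure UNIV = L (\<lambda>_. 1)"
    using emeasure_riesz_measure_UNIV L1_nonneg by (simp add: measure_def)
  have g01: "0 \<le> g x \<and> g x \<le> 1" for x
  proof -
    have "- B \<le> f x" "f x \<le> B" using B(2)[of x] by auto
    then have "- (1/2) \<le> f x * (1 / (2 * B))" "f x * (1 / (2 * B)) \<le> 1/2"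
      using B(1) by (auto simp: field_simps)
    then show ?thesis unfolding g_def by simp
  qed
  have "L f = 2 * B * L g + (- B) * L (\<lambda>_. 1)"
    using add[of "\<lambda>x. 2 * B * g x" "\<lambda>_. - B * 1"] gc
    by (subst fg) (simp add: continuous_on_mult_left scale[OF gc] scale[of "\<lambda>_. 1" "-B", simplified])
  also have "\<dots> \<le> 2 * B * (\<integral>x. g x \<partial>riesz_measure) + (- B) * measure riesz_measure UNIV"
    unfolding m using L_le_integral_unit[OF gc] g01 B by simp
  also have "\<dots> = (\<integral>x. f x \<partial>riesz_measure)"
    by (subst fg, subst Bochner_Integration.integral_add)
       (auto intro!: integrable_riesz_measure continuous_intros gc)
  finally show ?thesis .
qed

text \<open>The inequality for \<open>-f\<close> is the reverse inequality for
  \<open>f\<close>.\<close>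

theorem integral_riesz_measure:
  assumes f: "continuous_on UNIV f"
  shows "(\<integral>x. f x \<partial>riesz_measure) = L f"
  using L_le_integral[OF f] L_le_integral[of "\<lambda>x. (-1) * f x"] scale[OF f, of "-1"] f
  by (auto intro!: antisym continuous_intros)

end

section \<open>Uniqueness and images of regular measures\<close>

lemma emeasure_closed_le_integral:
  fixes M :: "'a::t2_space measure" and f :: "'a \<Rightarrow> real"
  assumes comp: "compact (UNIV :: 'a set)" and M: "sets M = sets borel" "finite_measure M"
    and f: "continuous_on UNIV f" "\<And>x. 0 \<le> f x" "\<And>x. x \<in> K \<Longrightarrow> 1 \<le> f x" and K: "closed K"
  shows "emeasure M K \<le> ennreal (\<integral>x. f x \<partial>M)"
proof -
  interpret finite_measure M by fact
  have "measure M K = (\<integral>x. indicator K x \<partial>M)"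
    using sets_eq_imp_space_eq[OF M(1)] by simp
  also have "\<dots> \<le> (\<integral>x. f x \<partial>M)"
    using K M(1) f(2,3)
    by (intro integral_mono[OF integrable_real_indicator integrable_continuous_compact[OF comp M f(1)]])
      (auto simp: indicator_def less_top[symmetric])
  finally show ?thesis by (simp add: emeasure_eq_measure ennreal_leI)
qed

lemma integral_le_emeasure_open:
  fixes M :: "'a::t2_space measure" and f :: "'a \<Rightarrow> real"
  assumes comp: "compact (UNIV :: 'a set)" and M: "sets M = sets borel" "finite_measure M"
    and f: "continuous_on UNIV f" "\<And>x. f x \<le> 1" "\<And>x. x \<notin> U \<Longrightarrow> f x \<le> 0" and U: "open U"
  shows "ennreal (\<integral>x. f x \<partial>M) \<le> emeasure M U"
proof -
  interpret finite_measure M by fact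
  have "(\<integral>x. f x \<partial>M) \<le> (\<integral>x. indicator U x \<partial>M)"
    using U M(1) f(2,3)
    by (intro integral_mono[OF integrable_continuous_compact[OF comp M f(1)] integrable_real_indicator])
      (auto simp: indicator_def less_top[symmetric])
  also have "\<dots> = measure M U"
    using sets_eq_imp_space_eq[OF M(1)] by simp
  finally show ?thesis by (simp add: emeasure_eq_measure ennreal_leI)
qed

text \<open>A Urysohn function fits between a compact set inside \<open>B\<close> and an open set
  around \<open>B\<close>; regularity of \<open>M\<close> from inside and of \<open>N\<close> from
  outside does the rest. Used in both directions this makes a regular measure determined by the
  integrals of continuous functions.\<close>

lemma regular_borel_measure_le:
  fixes M N :: "'a::t2_space measure"
  assumes comp: "compact (UNIV :: 'a set)" and M: "regular_borel_measure M" and N: "regular_borel_measure N"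
    and eq: "\<And>f::'a \<Rightarrow> real. continuous_on UNIV f \<Longrightarrow> (\<integral>x. f x \<partial>M) = (\<integral>x. f x \<partial>N)"
    and B: "B \<in> sets borel"
  shows "emeasure M B \<le> emeasure N B"
  unfolding regular_borel_measure_inner[OF M B] regular_borel_measure_outer[OF N B]
proof (rule SUP_least, rule INF_greatest, clarify)
  fix K U assume KU: "compact K" "K \<subseteq> B" "open U" "B \<subseteq> U"
  then have K: "closed K" by (simp add: compact_imp_closed)
  have "closed (-U)" "K \<inter> -U = {}" using KU by auto
  with K obtain f :: "'a \<Rightarrow> real" where f: "continuous_on UNIV f" "\<And>x. 0 \<le> f x" "\<And>x. f x \<le> 1"
    "\<And>x. x \<in> K \<Longrightarrow> f x = 1" "\<And>x. x \<in> -U \<Longrightarrow> f x = 0"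
    by (rule Urysohn_function[OF comp]) blast
  have "emeasure M K \<le> ennreal (\<integral>x. f x \<partial>M)"
    using regular_borel_measure_simps[OF M] f K by (intro emeasure_closed_le_integral[OF comp]) auto
  also have "\<dots> = ennreal (\<integral>x. f x \<partial>N)" by (simp add: eq f)
  also have "\<dots> \<le> emeasure N U"
    using regular_borel_measure_simps[OF N] f KU by (intro integral_le_emeasure_open[OF comp]) auto
  finally show "emeasure M K \<le> emeasure N U" .
qed

lemma regular_borel_measure_eqI:
  fixes M N :: "'a::t2_space measure"
  assumes comp: "compact (UNIV :: 'a set)" and M: "regular_borel_measure M" and N: "regular_borel_measure N"
    and eq: "\<And>f::'a \<Rightarrow> real. continuous_on UNIV f \<Longrightarrow> (\<integral>x. f x \<partial>M) = (\<integral>x. f x \<partial>N)"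
  shows "M = N"
  using regular_borel_measure_simps(1)[OF M] regular_borel_measure_simps(1)[OF N]
    regular_borel_measure_le[OF comp M N eq] regular_borel_measure_le[OF comp N M eq[symmetric]]
  by (intro measure_eqI antisym) auto

text \<open>Outer approximation of the image measure comes from inner approximation of the original
  one: a compact set in the complement of the preimage of \<open>B\<close> has a closed image that
  misses \<open>B\<close>.\<close>

lemma regular_borel_measure_distr:
  fixes M :: "'a::t2_space measure" and \<alpha> :: "'a \<Rightarrow> 'a"
  assumes comp: "compact (UNIV :: 'a set)" and M: "regular_borel_measure M" and \<alpha>: "continuous_on UNIV \<alpha>"
  shows "regular_borel_measure (distr M borel \<alpha>)"
proof (rule regular_borel_measureI[OF comp])
  note Ms [simp] = regular_borel_measure_simps[OF M]
  interpret finite_measure M by (rule Ms)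
  have m: "\<alpha> \<in> measurable M borel"
    using borel_measurable_continuous_onI[OF \<alpha>] by (simp cong: measurable_cong_sets)
  have vb: "\<alpha> -` C \<in> sets borel" if "C \<in> sets borel" for C using measurable_sets[OF m that] by simp
  show "finite_measure (distr M borel \<alpha>)" by (rule finite_measure_distr[OF m])
  fix B :: "'a set" assume B: "B \<in> sets borel"
  show "(INF U\<in>{U. open U \<and> B \<subseteq> U}. emeasure (distr M borel \<alpha>) U) \<le> emeasure (distr M borel \<alpha>) B"
  proof (rule ennreal_le_epsilon)
    fix e :: real assume e: "0 < e"
    obtain K where K: "compact K" "K \<in> sets borel" "K \<subseteq> - \<alpha> -` B" "measure M (- \<alpha> -` B) < measure M K + e"
      using regular_borel_measure_inner_approx[OF M, of "- \<alpha> -` B"] vb[OF B] e by auto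
    define U where "U = - \<alpha> ` K"
    have "compact (\<alpha> ` K)" using K \<alpha> by (intro compact_continuous_image) (auto intro: continuous_on_subset)
    then have U: "open U" "B \<subseteq> U" using K by (auto simp: U_def compact_imp_closed)
    have "measure M (\<alpha> -` U) \<le> measure M (- K)"
      using K U vb by (intro finite_measure_mono) (auto simp: U_def)
    also have "\<dots> \<le> measure M (\<alpha> -` B) + e"
      using finite_measure_compl[of K] finite_measure_compl[of "\<alpha> -` B"] K vb[OF B]
      by (simp add: Compl_eq_Diff_UNIV)
    finally have "emeasure (distr M borel \<alpha>) U \<le> emeasure (distr M borel \<alpha>) B + ennreal e"
      using U B e by (simp add: emeasure_distr[OF m] emeasure_eq_measure flip: ennreal_plus)
    moreover have "(INF U\<in>{U. open U \<and> B \<subseteq> U}. emeasure (distr M borel \<alpha>) U) \<le> emeasure (distr M borel \<alpha>) U"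
      using U by (intro INF_lower) auto
    ultimately show "(INF U\<in>{U. open U \<and> B \<subseteq> U}. emeasure (distr M borel \<alpha>) U)
        \<le> emeasure (distr M borel \<alpha>) B + ennreal e" by simp
  qed
qed simp

section \<open>Invariant states from convex functions\<close>

text \<open>A sublinear function \<open>p\<close> on \<open>V\<close> is encoded by its strict epigraph \<open>{(f, r). p f < r}\<close>.\<close>

definition proper_cone :: "('a \<Rightarrow> real) set \<Rightarrow> (('a \<Rightarrow> real) \<times> real) set \<Rightarrow> bool" where
  "proper_cone V E \<longleftrightarrow>
     (\<forall>f r. (f, r) \<in> E \<longrightarrow> f \<in> V) \<and>
     (\<forall>f r g s. (f, r) \<in> E \<longrightarrow> (g, s) \<in> E \<longrightarrow> ((\<lambda>x. f x + g x), r + s) \<in> E) \<and>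
     (\<forall>f r t. (f, r) \<in> E \<longrightarrow> 0 < t \<longrightarrow> ((\<lambda>x. t * f x), t * r) \<in> E) \<and>
     (\<forall>r. ((\<lambda>_. 0), r) \<in> E \<longrightarrow> 0 < r)"

lemma proper_coneD:
  assumes "proper_cone V E"
  shows "(f, r) \<in> E \<Longrightarrow> f \<in> V"
    "(f, r) \<in> E \<Longrightarrow> (g, s) \<in> E \<Longrightarrow> ((\<lambda>x. f x + g x), r + s) \<in> E"
    "(f, r) \<in> E \<Longrightarrow> 0 < t \<Longrightarrow> ((\<lambda>x. t * f x), t * r) \<in> E"
    "((\<lambda>_. 0), r) \<in> E \<Longrightarrow> 0 < r"
  using assms unfolding proper_cone_def by blast+

lemma maximal_proper_cone:
  assumes "proper_cone V E0"
  obtains E where "proper_cone V E" "E0 \<subseteq> E" "\<And>E'. proper_cone V E' \<Longrightarrow> E \<subseteq> E' \<Longrightarrow> E' = E"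
proof -
  let ?A = "{E. proper_cone V E \<and> E0 \<subseteq> E}"
  have "\<exists>M\<in>?A. \<forall>X\<in>?A. M \<subseteq> X \<longrightarrow> X = M"
  proof (rule subset_Zorn_nonempty)
    show "?A \<noteq> {}" using assms by blast
    fix C assume C: "C \<noteq> {}" "subset.chain ?A C"
    then have pc: "\<And>E. E \<in> C \<Longrightarrow> proper_cone V E" and "\<And>E. E \<in> C \<Longrightarrow> E0 \<subseteq> E"
      by (auto simp: subset_chain_def)
    with C have "E0 \<subseteq> \<Union>C" by blast
    moreover have "proper_cone V (\<Union>C)"
      unfolding proper_cone_def
    proof (intro conjI allI impI)
      fix f r g s assume "(f, r) \<in> \<Union>C" "(g, s) \<in> \<Union>C"
      then obtain E F where EF: "E \<in> C" "F \<in> C" "(f, r) \<in> E" "(g, s) \<in> F" by blast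
      then have "E \<subseteq> F \<or> F \<subseteq> E" using C(2) by (auto simp: subset_chain_def)
      then obtain G where "G \<in> C" "(f, r) \<in> G" "(g, s) \<in> G" using EF by blast
      then show "((\<lambda>x. f x + g x), r + s) \<in> \<Union>C" using proper_coneD(2)[OF pc] by blast
    qed (use proper_coneD[OF pc] in blast)+
    ultimately show "\<Union>C \<in> ?A" by blast
  qed
  then obtain M where "proper_cone V M" "E0 \<subseteq> M" "\<And>X. proper_cone V X \<Longrightarrow> E0 \<subseteq> X \<Longrightarrow> M \<subseteq> X \<Longrightarrow> X = M"
    by auto
  then show thesis by (intro that[of M]) auto
qed

text \<open>The extension step of Hahn-Banach. If no bound \<open>s \<le> - r0\<close> for
  \<open>-f\<close> occurs in \<open>E\<close>, then adding nonnegative multiples of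
  \<open>(f, r0)\<close> to the elements of \<open>E\<close> keeps the cone proper. By maximality
  nothing new arises, yet \<open>(0, r - r0) + (f, r0)\<close> is the excluded pair
  \<open>(f, r)\<close>.\<close>

lemma maximal_proper_cone_dichotomy:
  assumes V: "\<And>f g. f \<in> V \<Longrightarrow> g \<in> V \<Longrightarrow> (\<lambda>x. f x + g x) \<in> V" "\<And>f c. f \<in> V \<Longrightarrow> (\<lambda>x. c * f x) \<in> V"
    and E: "proper_cone V E" "\<And>E'. proper_cone V E' \<Longrightarrow> E \<subseteq> E' \<Longrightarrow> E' = E"
    and E0: "\<And>r. 0 < r \<Longrightarrow> ((\<lambda>_. 0), r) \<in> E"
    and f: "f \<in> V" and notin: "(f, r) \<notin> E" and "r0 < r"
  shows "\<exists>s\<le>- r0. ((\<lambda>x. - f x), s) \<in> E"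
proof (rule ccontr)
  assume no: "\<not> ?thesis"
  let ?E' = "{((\<lambda>x. g x + t * f x), s + t * r0) | g s t. (g, s) \<in> E \<and> 0 \<le> t}"
  have "proper_cone V ?E'"
    unfolding proper_cone_def
  proof (intro conjI allI impI)
    fix h u assume "(h, u) \<in> ?E'"
    then show "h \<in> V" using f proper_coneD(1)[OF E(1)] by (auto intro!: V)
  next
    fix h1 u1 h2 u2 assume "(h1, u1) \<in> ?E'" "(h2, u2) \<in> ?E'"
    then obtain g1 s1 t1 g2 s2 t2 where *: "h1 = (\<lambda>x. g1 x + t1 * f x)" "u1 = s1 + t1 * r0"
        "h2 = (\<lambda>x. g2 x + t2 * f x)" "u2 = s2 + t2 * r0"
        "(g1, s1) \<in> E" "(g2, s2) \<in> E" "0 \<le> t1" "0 \<le> t2" by blast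
    then have "((\<lambda>x. g1 x + g2 x), s1 + s2) \<in> E" using proper_coneD(2)[OF E(1)] by blast
    moreover have "(\<lambda>x. h1 x + h2 x) = (\<lambda>x. (g1 x + g2 x) + (t1 + t2) * f x)" "u1 + u2 = (s1 + s2) + (t1 + t2) * r0"
      using * by (auto simp: algebra_simps)
    ultimately show "((\<lambda>x. h1 x + h2 x), u1 + u2) \<in> ?E'"
      using *(7,8) by (intro CollectI exI[of _ "\<lambda>x. g1 x + g2 x"] exI[of _ "s1 + s2"] exI[of _ "t1 + t2"]) auto
  next
    fix h u c assume "(h, u) \<in> ?E'" and c: "0 < (c::real)"
    then obtain g s t where *: "h = (\<lambda>x. g x + t * f x)" "u = s + t * r0" "(g, s) \<in> E" "0 \<le> t" by blast
    then have "((\<lambda>x. c * g x), c * s) \<in> E" using proper_coneD(3)[OF E(1)] c by blast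
    moreover have "(\<lambda>x. c * h x) = (\<lambda>x. c * g x + (c * t) * f x)" "c * u = c * s + (c * t) * r0"
      using * by (auto simp: algebra_simps)
    ultimately show "((\<lambda>x. c * h x), c * u) \<in> ?E'"
      using *(4) c by (intro CollectI exI[of _ "\<lambda>x. c * g x"] exI[of _ "c * s"] exI[of _ "c * t"]) auto
  next
    fix u assume "((\<lambda>_. 0), u) \<in> ?E'"
    then obtain g s t where *: "\<And>x. g x + t * f x = 0" "u = s + t * r0" "(g, s) \<in> E" "0 \<le> t"
      by (auto simp: fun_eq_iff)
    show "0 < u"
    proof (cases "t = 0")
      case True
      then have "g = (\<lambda>_. 0)" using *(1) by auto
      then show ?thesis using *(2,3) True proper_coneD(4)[OF E(1)] by auto
    next
      case False
      then have t: "0 < t" using *(4) by simp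
      \<comment> \<open>Here \<open>g = - t * f\<close>, so after division by \<open>t\<close> the
        assumption on \<open>-f\<close> bounds \<open>s / t\<close> from below by
        \<open>- r0\<close>.\<close>
      have "(\<lambda>x. (1/t) * g x) = (\<lambda>x. - f x)"
      proof
        fix x show "(1/t) * g x = - f x" using *(1)[of x] t by (simp add: field_simps)
      qed
      then have "((\<lambda>x. - f x), (1/t) * s) \<in> E" using proper_coneD(3)[OF E(1) *(3), of "1/t"] t by simp
      then have "- r0 < (1/t) * s" using no by (meson not_le_imp_less)
      then show ?thesis using t *(2) by (simp add: field_simps)
    qed
  qed
  moreover have "E \<subseteq> ?E'"
  proof
    fix p assume "p \<in> E"
    then show "p \<in> ?E'"
      by (intro CollectI exI[of _ "0::real"] exI[of _ "fst p"] exI[of _ "snd p"]) auto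
  qed
  ultimately have "?E' = E" using E(2) by blast
  moreover have "(f, (r - r0) + 1 * r0) \<in> ?E'"
    using E0[of "r - r0"] \<open>r0 < r\<close> by (intro CollectI exI[of _ "\<lambda>_. 0::real"] exI[of _ "r - r0"] exI[of _ "1::real"]) auto
  ultimately show False using notin by simp
qed

text \<open>The functional is the infimum of the bounds occurring in a maximal cone. The cone
  operations make it subadditive and positively homogeneous, and the dichotomy makes it odd, hence
  linear.\<close>

lemma dominated_linear_functional:
  assumes V: "\<And>f g. f \<in> V \<Longrightarrow> g \<in> V \<Longrightarrow> (\<lambda>x. f x + g x) \<in> V" "\<And>f c. f \<in> V \<Longrightarrow> (\<lambda>x. c * f x) \<in> V"
    and cone: "proper_cone V E0" and tot: "\<And>f. f \<in> V \<Longrightarrow> \<exists>r. (f, r) \<in> E0"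
    and zero: "\<And>r. 0 < r \<Longrightarrow> ((\<lambda>_. 0), r) \<in> E0"
  obtains m :: "('a \<Rightarrow> real) \<Rightarrow> real" where
    "\<And>f g. f \<in> V \<Longrightarrow> g \<in> V \<Longrightarrow> m (\<lambda>x. f x + g x) = m f + m g"
    "\<And>f c. f \<in> V \<Longrightarrow> m (\<lambda>x. c * f x) = c * m f"
    "\<And>f r. (f, r) \<in> E0 \<Longrightarrow> m f \<le> r"
proof -
  obtain E where E: "proper_cone V E" "E0 \<subseteq> E" "\<And>E'. proper_cone V E' \<Longrightarrow> E \<subseteq> E' \<Longrightarrow> E' = E"
    using maximal_proper_cone[OF cone] by blast
  note Ed = proper_coneD[OF E(1)]
  have E0: "\<And>r. 0 < r \<Longrightarrow> ((\<lambda>_. 0), r) \<in> E" using zero E(2) by blast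
  define m where "m f = Inf {r. (f, r) \<in> E}" for f
  have neg: "(\<lambda>x. - f x) \<in> V" if "f \<in> V" for f using V(2)[OF that, of "-1"] by simp
  have ne: "{r. (f, r) \<in> E} \<noteq> {}" if "f \<in> V" for f using tot[OF that] E(2) by blast
  have pos: "0 < r + s" if "(f, r) \<in> E" "((\<lambda>x. - f x), s) \<in> E" for f r s
    using Ed(2)[OF that] Ed(4)[of "r + s"] by simp
  have bdd: "bdd_below {r. (f, r) \<in> E}" if f: "f \<in> V" for f
  proof -
    obtain s where s: "((\<lambda>x. - f x), s) \<in> E" using ne[OF neg[OF f]] by blast
    have "- s \<le> r" if "(f, r) \<in> E" for r using pos[OF that s] by simp
    then show ?thesis by (auto intro: bdd_belowI[of _ "-s"])
  qed
  have le: "m f \<le> r" if "(f, r) \<in> E" for f r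
    unfolding m_def using that bdd Ed(1) by (intro cInf_lower) auto
  have less: "\<exists>r<b. (f, r) \<in> E" if "f \<in> V" "m f < b" for f b
    using that cInf_lessD[OF ne[OF that(1)], of b] unfolding m_def by auto
  have sub: "m (\<lambda>x. f x + g x) \<le> m f + m g" if fg: "f \<in> V" "g \<in> V" for f g
  proof (rule field_le_epsilon)
    fix e :: real assume "0 < e"
    then obtain r s where "r < m f + e/2" "(f, r) \<in> E" "s < m g + e/2" "(g, s) \<in> E"
      using less[OF fg(1), of "m f + e/2"] less[OF fg(2), of "m g + e/2"] by auto
    then show "m (\<lambda>x. f x + g x) \<le> m f + m g + e" using le[OF Ed(2)] by fastforce
  qed
  have mneg: "m (\<lambda>x. - f x) = - m f" if f: "f \<in> V" for f
  proof (rule antisym)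
    have "m (\<lambda>x. - f x) \<le> - r0" if r0: "r0 < m f" for r0
    proof -
      obtain r where r: "r0 < r" "r < m f" using dense[OF r0] by blast
      then have "(f, r) \<notin> E" using le by force
      then obtain s where "s \<le> - r0" "((\<lambda>x. - f x), s) \<in> E"
        using maximal_proper_cone_dichotomy[OF V E(1,3) E0 f _ r(1)] by blast
      then show ?thesis using le by force
    qed
    then show "m (\<lambda>x. - f x) \<le> - m f"
      by (meson dense_le le_minus_iff)
    have "0 \<le> m (\<lambda>_. 0)" using ne[OF V(2)[OF f, of 0]] Ed(4) unfolding m_def
      by (intro cInf_greatest) (auto intro: less_imp_le)
    then show "- m f \<le> m (\<lambda>x. - f x)" using sub[OF f neg[OF f]] by simp
  qed
  have madd: "m (\<lambda>x. f x + g x) = m f + m g" if fg: "f \<in> V" "g \<in> V" for f g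
    using sub[OF fg] sub[OF V(1)[OF fg] neg[OF fg(2)]] mneg[OF fg(2)] by simp
  have mscale_le: "m (\<lambda>x. c * f x) \<le> c * m f" if c: "0 < c" and f: "f \<in> V" for c f
  proof -
    have "m (\<lambda>x. c * f x) / c \<le> m f + e" if e: "0 < e" for e
    proof -
      obtain r where "r < m f + e" "(f, r) \<in> E" using less[OF f, of "m f + e"] e by auto
      then have "m (\<lambda>x. c * f x) \<le> c * r" using le[OF Ed(3)] c by blast
      then have "m (\<lambda>x. c * f x) / c \<le> r" using c by (simp add: field_simps)
      then show ?thesis using \<open>r < m f + e\<close> by simp
    qed
    then have "m (\<lambda>x. c * f x) / c \<le> m f" by (rule field_le_epsilon)
    then show ?thesis using c by (simp add: field_simps)
  qed
  have mscale_pos: "m (\<lambda>x. c * f x) = c * m f" if c: "0 < c" and f: "f \<in> V" for c f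
    using mscale_le[OF c f] mscale_le[of "1/c", OF _ V(2)[OF f, of c]] c by (simp add: field_simps)
  have mscale: "m (\<lambda>x. c * f x) = c * m f" if f: "f \<in> V" for c f
  proof (cases c "0::real" rule: linorder_cases)
    case less
    then show ?thesis using mscale_pos[of "-c" f] mneg[OF V(2)[OF f, of "-c"]] f by simp
  next
    case equal
    then show ?thesis using madd[OF V(2)[OF f, of 0] V(2)[OF f, of 0]] by simp
  next
    case greater
    then show ?thesis using mscale_pos f by blast
  qed
  show thesis
    by (rule that[of m]) (use madd mscale le E(2) in auto)
qed

section \<open>Invariant states as subgradients of convex functions\<close>

lemma continuous_bounded_compact:
  fixes f :: "'a::topological_space \<Rightarrow> real"
  assumes "compact Y" "continuous_on Y f"
  obtains B where "0 < B" "\<And>x. x \<in> Y \<Longrightarrow> \<bar>f x\<bar> \<le> B"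
proof -
  have "bounded (f ` Y)" using assms by (intro compact_imp_bounded compact_continuous_image)
  then show thesis using that by (auto simp: bounded_pos)
qed

text \<open>States are linear functionals on \<open>C(Y)\<close>, applied to arbitrary functions on the ambient type
  that are continuous on \<open>Y\<close>.\<close>

definition invariant_state :: "('a::topological_space \<Rightarrow> 'a) \<Rightarrow> 'a set \<Rightarrow> (('a \<Rightarrow> real) \<Rightarrow> real) \<Rightarrow> bool" where
  "invariant_state \<alpha> Y m \<longleftrightarrow>
     (\<forall>f g. continuous_on Y f \<longrightarrow> continuous_on Y g \<longrightarrow> m (\<lambda>x. f x + g x) = m f + m g) \<and>
     (\<forall>f c. continuous_on Y f \<longrightarrow> m (\<lambda>x. c * f x) = c * m f) \<and>
     (\<forall>f. continuous_on Y f \<longrightarrow> (\<forall>x\<in>Y. 0 \<le> f x) \<longrightarrow> 0 \<le> m f) \<and>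
     m (\<lambda>_. 1) = 1 \<and>
     (\<forall>f. continuous_on Y f \<longrightarrow> m (\<lambda>x. f (\<alpha> x)) = m f)"

text \<open>\<open>Q \<phi> c\<close> stands for an inequality \<open>F \<phi> \<le> c\<close> (or \<open>F \<phi> < c\<close>) for a convex function \<open>F\<close>; the state
  obtained is a subgradient of \<open>F\<close> at \<open>\<psi>\<close>, where \<open>F \<psi> = l\<close>.\<close>

lemma invariant_subgradient:
  fixes \<psi> :: "'a::topological_space \<Rightarrow> real"
  assumes Y: "compact Y" and \<alpha>: "continuous_on Y \<alpha>" "\<alpha> ` Y \<subseteq> Y" and \<psi>: "continuous_on Y \<psi>"
    and convex: "\<And>\<phi>1 \<phi>2 c1 c2 a b. \<lbrakk>Q \<phi>1 c1; Q \<phi>2 c2; continuous_on Y \<phi>1; continuous_on Y \<phi>2;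
      0 < a; 0 < b; a + b = 1\<rbrakk> \<Longrightarrow> Q (\<lambda>x. a * \<phi>1 x + b * \<phi>2 x) (a * c1 + b * c2)"
    and mono: "\<And>\<phi> \<phi>' c d. \<lbrakk>Q \<phi> c; continuous_on Y \<phi>; continuous_on Y \<phi>'; \<And>x. x \<in> Y \<Longrightarrow> \<phi>' x \<le> \<phi> x + d\<rbrakk> \<Longrightarrow> Q \<phi>' (c + d)"
    and cob: "\<And>\<phi> f c. \<lbrakk>Q \<phi> c; continuous_on Y \<phi>; continuous_on Y f\<rbrakk> \<Longrightarrow> Q (\<lambda>x. \<phi> x + (f (\<alpha> x) - f x)) c"
    and lower: "\<And>c. Q \<psi> c \<Longrightarrow> l \<le> c" and upper: "\<And>e. 0 < e \<Longrightarrow> Q \<psi> (l + e)"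
  obtains m where "invariant_state \<alpha> Y m"
    "\<And>\<phi> c. continuous_on Y \<phi> \<Longrightarrow> Q \<phi> c \<Longrightarrow> l + (m \<phi> - m \<psi>) \<le> c"
proof -
  let ?V = "{f :: 'a \<Rightarrow> real. continuous_on Y f}"
  \<comment> \<open>\<open>(\<phi>, r)\<close> lies in \<open>E0\<close> when some difference
    quotient \<open>(F (\<psi> + t * \<phi>) - l) / t\<close> is below \<open>r\<close>. So
    \<open>E0\<close> is the strict epigraph of the directional derivative of \<open>F\<close> at
    \<psi>, and a linear functional below it is a subgradient.\<close>
  define E0 where "E0 = {(\<phi>, r). continuous_on Y \<phi> \<and> (\<exists>t c. 0 < t \<and> Q (\<lambda>x. \<psi> x + t * \<phi> x) c \<and> c - l < t * r)}"
  have E0I: "(\<phi>, r) \<in> E0" if "continuous_on Y \<phi>" "0 < t" "Q (\<lambda>x. \<psi> x + t * \<phi> x) c" "c - l < t * r" for \<phi> r t c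
    using that unfolding E0_def by blast
  have up: "(\<phi>, r) \<in> E0" if \<phi>: "continuous_on Y \<phi>" and "\<And>x. x \<in> Y \<Longrightarrow> \<phi> x \<le> d" "d < r" for \<phi> d r
  proof -
    have "Q (\<lambda>x. \<psi> x + 1 * \<phi> x) (l + (r - d)/2 + d)"
      by (rule mono[of \<psi>]) (use that upper[of "(r - d)/2"] \<psi> in \<open>auto intro!: continuous_intros\<close>)
    then show ?thesis using that by (intro E0I[of \<phi> 1]) (auto simp: field_simps)
  qed
  have cone: "proper_cone ?V E0"
    unfolding proper_cone_def
  proof (intro conjI allI impI)
    fix f r assume "(f, r) \<in> E0" then show "f \<in> ?V" by (auto simp: E0_def)
  next
    fix f r g s assume "(f, r) \<in> E0" "(g, s) \<in> E0"
    then obtain t c u d where *: "continuous_on Y f" "0 < t" "Q (\<lambda>x. \<psi> x + t * f x) c" "c - l < t * r"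
      "continuous_on Y g" "0 < u" "Q (\<lambda>x. \<psi> x + u * g x) d" "d - l < u * s" unfolding E0_def by blast
    \<comment> \<open>The weights are chosen with \<open>a * t = b * u\<close>, so that the convex
      combination is one step of that length in the direction \<open>f + g\<close>.\<close>
    define a where "a = u / (t + u)"
    define b where "b = t / (t + u)"
    have ab: "0 < a" "0 < b" "a + b = 1" "a * t = b * u"
      using * unfolding a_def b_def by (auto simp flip: add_divide_distrib)
    have "Q (\<lambda>x. a * (\<psi> x + t * f x) + b * (\<psi> x + u * g x)) (a * c + b * d)"
      using * ab \<psi> by (intro convex) (auto intro!: continuous_intros)
    moreover have "a * (\<psi> x + t * f x) + b * (\<psi> x + u * g x) = \<psi> x + (a * t) * (f x + g x)" for x
    proof -
      have "a * (\<psi> x + t * f x) + b * (\<psi> x + u * g x) = (a + b) * \<psi> x + (a * t) * f x + (b * u) * g x"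
        by (simp add: algebra_simps)
      then show ?thesis using ab by (simp add: algebra_simps)
    qed
    moreover have "a * c + b * d - l < a * t * (r + s)"
    proof -
      have "a * c + b * d - l = a * (c - l) + b * (d - l)"
        using ab(3) by (simp add: algebra_simps flip: distrib_left distrib_right)
      also have "\<dots> < a * (t * r) + b * (u * s)"
        using * ab by (intro add_strict_mono mult_strict_left_mono) auto
      also have "\<dots> = a * t * (r + s)" using ab(4) by (simp add: algebra_simps)
      finally show ?thesis .
    qed
    ultimately show "((\<lambda>x. f x + g x), r + s) \<in> E0"
      using * ab by (intro E0I[of _ "a * t"]) (auto intro!: continuous_intros)
  next
    fix f r t assume "(f, r) \<in> E0" "0 < (t::real)"
    then obtain u c where "continuous_on Y f" "0 < u" "Q (\<lambda>x. \<psi> x + u * f x) c" "c - l < u * r"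
      unfolding E0_def by blast
    then show "((\<lambda>x. t * f x), t * r) \<in> E0"
      using \<open>0 < t\<close> by (intro E0I[of _ "u / t" c]) (auto intro!: continuous_intros)
  next
    fix r assume "((\<lambda>_. 0), r) \<in> E0"
    then obtain u c where "0 < u" "Q \<psi> c" "c - l < u * r" unfolding E0_def by auto
    then have "0 < u * r" using lower by fastforce
    then show "0 < r" using \<open>0 < u\<close> by (simp add: zero_less_mult_iff)
  qed
  obtain m where m: "\<And>f g. f \<in> ?V \<Longrightarrow> g \<in> ?V \<Longrightarrow> m (\<lambda>x. f x + g x) = m f + m g"
      "\<And>f c. f \<in> ?V \<Longrightarrow> m (\<lambda>x. c * f x) = c * m f" "\<And>f r. (f, r) \<in> E0 \<Longrightarrow> m f \<le> r"
  proof (rule dominated_linear_functional[OF _ _ cone])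
    fix f :: "'a \<Rightarrow> real" assume f: "f \<in> ?V"
    then obtain B where "\<And>x. x \<in> Y \<Longrightarrow> \<bar>f x\<bar> \<le> B" using continuous_bounded_compact[OF Y] by blast
    then have "(f, B + 1) \<in> E0" using f by (intro up[of f B]) (auto simp: abs_le_iff)
    then show "\<exists>r. (f, r) \<in> E0" ..
  next
    show "0 < r \<Longrightarrow> ((\<lambda>_. 0), r) \<in> E0" for r by (intro up[of _ 0]) auto
  qed (auto intro!: continuous_intros)
  have m_le: "m f \<le> d" if "continuous_on Y f" "\<And>x. x \<in> Y \<Longrightarrow> f x \<le> d" for f d
    by (rule field_le_epsilon) (use that in \<open>auto intro!: m(3) up\<close>)
  have neg: "m (\<lambda>x. - f x) = - m f" if "continuous_on Y f" for f
    using m(2)[of f "-1"] that by simp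
  \<comment> \<open>Coboundaries preserve the bounds on \<open>F\<close>, so the derivative along
    \<open>f \<circ> \<alpha> - f\<close> is at most 0; the same for \<open>-f\<close> gives
    invariance.\<close>
  have cob_le: "m (\<lambda>x. f (\<alpha> x) - f x) \<le> 0" if f: "continuous_on Y f" for f
  proof (rule field_le_epsilon)
    fix e :: real assume e: "0 < e"
    have c: "continuous_on Y (\<lambda>x. f (\<alpha> x) - f x)"
      using f \<alpha> by (intro continuous_intros continuous_on_compose2[OF f]) auto
    show "m (\<lambda>x. f (\<alpha> x) - f x) \<le> 0 + e"
      using cob[OF upper[of "e/2"] \<psi> f] e c by (intro m(3) E0I[of _ 1 "l + e/2"]) auto
  qed
  have inv: "m (\<lambda>x. f (\<alpha> x)) = m f" if f: "continuous_on Y f" for f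
  proof -
    have c: "continuous_on Y (\<lambda>x. f (\<alpha> x))"
      using f \<alpha> by (intro continuous_on_compose2[OF f]) auto
    have "m (\<lambda>x. f (\<alpha> x) - f x) = m (\<lambda>x. f (\<alpha> x)) - m f"
      using m(1)[of "\<lambda>x. f (\<alpha> x)" "\<lambda>x. - f x"] neg[OF f] c f by (simp add: continuous_on_minus)
    moreover have "m (\<lambda>x. - f (\<alpha> x) - - f x) = - m (\<lambda>x. f (\<alpha> x) - f x)"
      using neg[of "\<lambda>x. f (\<alpha> x) - f x"] c f by (simp add: continuous_on_diff)
    ultimately show ?thesis
      using cob_le[OF f] cob_le[of "\<lambda>x. - f x"] f by (simp add: continuous_on_minus)
  qed
  have "invariant_state \<alpha> Y m"
    unfolding invariant_state_def
  proof (intro conjI allI impI)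
    fix f :: "'a \<Rightarrow> real" assume f: "continuous_on Y f" "\<forall>x\<in>Y. 0 \<le> f x"
    then have "m (\<lambda>x. - f x) \<le> 0" by (intro m_le continuous_intros) auto
    then show "0 \<le> m f" using neg f by simp
  next
    show "m (\<lambda>_. 1) = 1" using m_le[of "\<lambda>_. 1" 1] m_le[of "\<lambda>_. -1" "-1"] neg[of "\<lambda>_. 1"] by simp
  qed (use m inv in auto)
  moreover have "l + (m \<phi> - m \<psi>) \<le> c" if \<phi>: "continuous_on Y \<phi>" "Q \<phi> c" for \<phi> c
  proof -
    have "m (\<lambda>x. \<phi> x - \<psi> x) \<le> c - l"
    proof (rule field_le_epsilon)
      fix e :: real assume "0 < e"
      then show "m (\<lambda>x. \<phi> x - \<psi> x) \<le> c - l + e"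
        using \<phi> \<psi> by (intro m(3) E0I[of _ 1 c]) (auto intro!: continuous_intros)
    qed
    moreover have "m (\<lambda>x. \<phi> x - \<psi> x) = m \<phi> - m \<psi>"
      using m(1)[of \<phi> "\<lambda>x. - \<psi> x"] neg[OF \<psi>] \<phi> \<psi> by (simp add: continuous_on_minus)
    ultimately show ?thesis by simp
  qed
  ultimately show thesis by (rule that)
qed

text \<open>Krylov--Bogoliubov: at a maximum of \<open>f\<close> the coboundary \<open>f \<circ> \<alpha> - f\<close> is nonpositive, so the
  zero function is not bounded by a coboundary plus a negative constant.\<close>

lemma exists_invariant_state:
  fixes \<alpha> :: "'a::topological_space \<Rightarrow> 'a"
  assumes Y: "compact Y" "Y \<noteq> {}" and \<alpha>: "continuous_on Y \<alpha>" "\<alpha> ` Y \<subseteq> Y"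
  obtains m where "invariant_state \<alpha> Y m"
proof -
  define Q :: "('a \<Rightarrow> real) \<Rightarrow> real \<Rightarrow> bool"
    where "Q \<phi> c \<longleftrightarrow> (\<exists>f. continuous_on Y f \<and> (\<forall>x\<in>Y. \<phi> x \<le> c + (f (\<alpha> x) - f x)))" for \<phi> c
  show thesis
  proof (rule invariant_subgradient[OF Y(1) \<alpha>, of "\<lambda>_. 0" Q 0])
    fix \<phi>1 \<phi>2 c1 c2 and a b :: real assume *: "Q \<phi>1 c1" "Q \<phi>2 c2" "0 < a" "0 < b"
    then obtain f g where fg: "continuous_on Y f" "continuous_on Y g"
        "\<And>x. x \<in> Y \<Longrightarrow> \<phi>1 x \<le> c1 + (f (\<alpha> x) - f x)" "\<And>x. x \<in> Y \<Longrightarrow> \<phi>2 x \<le> c2 + (g (\<alpha> x) - g x)"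
      unfolding Q_def by blast
    have "a * \<phi>1 x + b * \<phi>2 x \<le> (a * c1 + b * c2) + ((a * f (\<alpha> x) + b * g (\<alpha> x)) - (a * f x + b * g x))"
      if "x \<in> Y" for x
      using mult_left_mono[OF fg(3)[OF that], of a] mult_left_mono[OF fg(4)[OF that], of b] *(3,4)
      by (simp add: algebra_simps)
    then show "Q (\<lambda>x. a * \<phi>1 x + b * \<phi>2 x) (a * c1 + b * c2)"
      unfolding Q_def using fg by (intro exI[of _ "\<lambda>x. a * f x + b * g x"]) (auto intro!: continuous_intros)
  next
    fix \<phi> \<phi>' :: "'a \<Rightarrow> real" and c d assume "Q \<phi> c" and d: "\<And>x. x \<in> Y \<Longrightarrow> \<phi>' x \<le> \<phi> x + d"
    then obtain f where f: "continuous_on Y f" "\<And>x. x \<in> Y \<Longrightarrow> \<phi> x \<le> c + (f (\<alpha> x) - f x)"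
      unfolding Q_def by blast
    have "\<phi>' x \<le> c + d + (f (\<alpha> x) - f x)" if "x \<in> Y" for x using f(2)[OF that] d[OF that] by simp
    then show "Q \<phi>' (c + d)" unfolding Q_def using f(1) by blast
  next
    fix \<phi> f :: "'a \<Rightarrow> real" and c assume "Q \<phi> c" and f: "continuous_on Y f"
    then obtain g where g: "continuous_on Y g" "\<And>x. x \<in> Y \<Longrightarrow> \<phi> x \<le> c + (g (\<alpha> x) - g x)"
      unfolding Q_def by blast
    have "\<phi> x + (f (\<alpha> x) - f x) \<le> c + ((g (\<alpha> x) + f (\<alpha> x)) - (g x + f x))" if "x \<in> Y" for x
      using g(2)[OF that] by simp
    then show "Q (\<lambda>x. \<phi> x + (f (\<alpha> x) - f x)) c"
      unfolding Q_def using f g(1) by (intro exI[of _ "\<lambda>x. g x + f x"]) (auto intro!: continuous_on_add)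
  next
    fix c assume "Q (\<lambda>_. 0) c"
    then obtain f where f: "continuous_on Y f" "\<And>x. x \<in> Y \<Longrightarrow> 0 \<le> c + (f (\<alpha> x) - f x)" unfolding Q_def by blast
    obtain x where "x \<in> Y" "\<And>y. y \<in> Y \<Longrightarrow> f y \<le> f x"
      using continuous_attains_sup[OF Y f(1)] by blast
    then show "0 \<le> c" using f(2)[of x] \<alpha>(2) by fastforce
  next
    fix e :: real assume "0 < e"
    then show "Q (\<lambda>_. 0) (0 + e)" unfolding Q_def by (intro exI[of _ "\<lambda>_. 0"]) auto
  qed (use that in auto)
qed

section \<open>The spectral potential\<close>

lemma ln_le_iff_le_exp: "0 < x \<Longrightarrow> ln x \<le> y \<longleftrightarrow> x \<le> exp (y :: real)"
  by (metis exp_le_cancel_iff exp_ln)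

lemma ln_less_iff_less_exp: "0 < x \<Longrightarrow> ln x < y \<longleftrightarrow> x < exp (y :: real)"
  by (metis exp_less_cancel_iff exp_ln)

text \<open>Removes the logarithm and the value \<open>-\<infinity>\<close> together: for
  \<open>a \<le> 0\<close> both sides are true.\<close>

lemma eln_div_le_iff:
  assumes "0 < n"
  shows "eln a / ereal (real n) \<le> ereal c \<longleftrightarrow> a \<le> exp (real n * c)"
proof (cases "0 < a")
  case True
  then show ?thesis
    using assms by (simp add: eln_def divide_le_eq ln_le_iff_le_exp mult.commute)
next
  case False
  then have "a \<le> exp (real n * c)" using exp_gt_zero[of "real n * c"] by linarith
  then show ?thesis using assms False by (simp add: eln_def)
qed

lemma eln_div_less_iff:
  assumes "0 < n"
  shows "eln a / ereal (real n) < ereal c \<longleftrightarrow> a < exp (real n * c)"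
proof (cases "0 < a")
  case True
  then show ?thesis
    using assms by (simp add: eln_def divide_less_eq ln_less_iff_less_exp mult.commute)
next
  case False
  then have "a < exp (real n * c)" using exp_gt_zero[of "real n * c"] by linarith
  then show ?thesis using assms False by (simp add: eln_def)
qed

lemma eln_mono: "a \<le> b \<Longrightarrow> eln a \<le> eln b"
  by (auto simp: eln_def)

lemma sum_lessThan_add: "(\<Sum>i<m + n. f i) = (\<Sum>i<m. f i) + (\<Sum>i<n. f (m + i))" for f :: "nat \<Rightarrow> 'b::comm_monoid_add"
  by (induction n) (auto simp: add.assoc)

lemma sum_residue_classes:
  "(\<Sum>i<n * q. f i) = (\<Sum>k<n. \<Sum>j<q. f (n * j + k))" for f :: "nat \<Rightarrow> 'b::comm_monoid_add"
proof (induction q)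
  case (Suc q)
  have "(\<Sum>i<n * Suc q. f i) = (\<Sum>i<n * q + n. f i)" by (simp add: add.commute)
  then show ?case by (simp add: sum_lessThan_add Suc sum.distrib)
qed simp

lemma eventually_mult_exp_le:
  fixes C c c' :: real
  assumes "c < c'"
  shows "\<exists>N. \<forall>n\<ge>N. C * exp (real n * c) \<le> exp (real n * c')"
proof -
  obtain N where N: "ln (max C 1) / (c' - c) < real N" using reals_Archimedean2 by blast
  have "C * exp (real n * c) \<le> exp (real n * c')" if n: "N \<le> n" for n
  proof -
    have "ln (max C 1) \<le> real N * (c' - c)" using N assms by (simp add: field_simps)
    also have "\<dots> \<le> real n * (c' - c)" using n assms by (intro mult_right_mono) auto
    finally have "max C 1 \<le> exp (real n * (c' - c))" by (simp add: ln_le_iff_le_exp)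
    then have "C * exp (real n * c) \<le> exp (real n * (c' - c)) * exp (real n * c)"
      by (intro mult_right_mono) auto
    then show ?thesis by (simp add: algebra_simps flip: exp_add)
  qed
  then show ?thesis by blast
qed

section \<open>Real transfer operators and the growth of their iterates\<close>

text \<open>The common real setting for the trace on \<open>Y\<close> and, with
  \<open>Y = UNIV\<close>, for \<open>A\<close> itself. Functions live on the whole type, and
  \<open>T_cong\<close> expresses that only their values on \<open>Y\<close> count.\<close>

locale transfer_on =
  fixes Y :: "'a::topological_space set" and \<alpha> :: "'a \<Rightarrow> 'a" and T :: "('a \<Rightarrow> real) \<Rightarrow> 'a \<Rightarrow> real"
  assumes compact_Y: "compact Y" and Y_ne: "Y \<noteq> {}"
    and cont_\<alpha>: "continuous_on Y \<alpha>" and \<alpha>_Y: "\<alpha> ` Y \<subseteq> Y"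
    and T_cont: "continuous_on Y f \<Longrightarrow> continuous_on Y (T f)"
    and T_add: "continuous_on Y f \<Longrightarrow> continuous_on Y g \<Longrightarrow> T (\<lambda>x. f x + g x) = (\<lambda>x. T f x + T g x)"
    and T_scale: "continuous_on Y f \<Longrightarrow> T (\<lambda>x. c * f x) = (\<lambda>x. c * T f x)"
    and T_nonneg: "continuous_on Y f \<Longrightarrow> (\<And>x. x \<in> Y \<Longrightarrow> 0 \<le> f x) \<Longrightarrow> x \<in> Y \<Longrightarrow> 0 \<le> T f x"
    and T_cong: "(\<And>x. x \<in> Y \<Longrightarrow> f x = g x) \<Longrightarrow> T f = T g"
    and T_hom: "continuous_on Y f \<Longrightarrow> continuous_on Y g \<Longrightarrow> T (\<lambda>x. f (\<alpha> x) * g x) = (\<lambda>x. f x * T g x)"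
begin

lemma funpow_Y: "x \<in> Y \<Longrightarrow> (\<alpha> ^^ n) x \<in> Y"
  using \<alpha>_Y by (induction n) auto

lemma continuous_on_funpow: "continuous_on Y (\<alpha> ^^ n)"
proof (induction n)
  case (Suc n)
  have "continuous_on Y (\<lambda>x. \<alpha> ((\<alpha> ^^ n) x))"
    by (rule continuous_on_compose2[OF cont_\<alpha> Suc]) (auto intro: funpow_Y)
  then show ?case by (simp add: comp_def)
qed (simp add: id_def)

lemma continuous_on_comp_funpow: "continuous_on Y f \<Longrightarrow> continuous_on Y (\<lambda>x. f ((\<alpha> ^^ n) x))"
  by (rule continuous_on_compose2[OF _ continuous_on_funpow]) (auto intro: funpow_Y)

lemma Tn_cont: "continuous_on Y f \<Longrightarrow> continuous_on Y ((T ^^ n) f)"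
  by (induction n) (auto intro: T_cont)

lemma Tn_add: "continuous_on Y f \<Longrightarrow> continuous_on Y g \<Longrightarrow>
    (T ^^ n) (\<lambda>x. f x + g x) = (\<lambda>x. (T ^^ n) f x + (T ^^ n) g x)"
  by (induction n) (auto simp: T_add Tn_cont)

lemma Tn_scale: "continuous_on Y f \<Longrightarrow> (T ^^ n) (\<lambda>x. c * f x) = (\<lambda>x. c * (T ^^ n) f x)"
  by (induction n) (auto simp: T_scale Tn_cont)

lemma Tn_sum: "finite I \<Longrightarrow> (\<And>i. i \<in> I \<Longrightarrow> continuous_on Y (f i)) \<Longrightarrow>
    (T ^^ n) (\<lambda>x. \<Sum>i\<in>I. f i x) = (\<lambda>x. \<Sum>i\<in>I. (T ^^ n) (f i) x)"
proof (induction I rule: finite_induct)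
  case empty
  show ?case using Tn_scale[of "\<lambda>_. 0" n 0] by simp
next
  case (insert i I)
  then show ?case using Tn_add[of "f i" "\<lambda>x. \<Sum>i\<in>I. f i x" n] by (simp add: continuous_on_sum)
qed

lemma Tn_nonneg: "continuous_on Y f \<Longrightarrow> (\<And>x. x \<in> Y \<Longrightarrow> 0 \<le> f x) \<Longrightarrow> x \<in> Y \<Longrightarrow> 0 \<le> (T ^^ n) f x"
  by (induction n arbitrary: x) (auto intro: T_nonneg Tn_cont)

lemma Tn_mono:
  assumes "continuous_on Y f" "continuous_on Y g" "\<And>x. x \<in> Y \<Longrightarrow> f x \<le> g x" "x \<in> Y"
  shows "(T ^^ n) f x \<le> (T ^^ n) g x"
proof -
  have "0 \<le> (T ^^ n) (\<lambda>x. g x + (-1) * f x) x"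
    using assms by (intro Tn_nonneg continuous_intros) auto
  also have "\<dots> = (T ^^ n) g x + (-1) * (T ^^ n) f x"
    using assms by (subst Tn_add) (auto intro!: continuous_intros simp only: Tn_scale)
  finally show ?thesis by simp
qed

lemma Tn_cong: "(\<And>x. x \<in> Y \<Longrightarrow> f x = g x) \<Longrightarrow> x \<in> Y \<Longrightarrow> (T ^^ n) f x = (T ^^ n) g x"
  by (cases n) (auto simp: funpow_Suc_right T_cong[of f g] simp del: funpow.simps(2))

lemma Tn_hom: "continuous_on Y f \<Longrightarrow> continuous_on Y g \<Longrightarrow>
    (T ^^ n) (\<lambda>x. f ((\<alpha> ^^ n) x) * g x) = (\<lambda>x. f x * (T ^^ n) g x)"
proof (induction n arbitrary: f)
  case (Suc n)
  have c: "continuous_on Y (\<lambda>x. f (\<alpha> x))" using continuous_on_comp_funpow[OF Suc(2), of 1] by simp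
  have "(T ^^ Suc n) (\<lambda>x. f ((\<alpha> ^^ Suc n) x) * g x) = T (\<lambda>x. f (\<alpha> x) * (T ^^ n) g x)"
    using Suc(1)[OF c Suc(3)] by simp
  also have "\<dots> = (\<lambda>x. f x * (T ^^ Suc n) g x)"
    using T_hom[OF Suc(2) Tn_cont[OF Suc(3)]] by simp
  finally show ?case .
qed simp

definition birkhoff :: "('a \<Rightarrow> real) \<Rightarrow> nat \<Rightarrow> 'a \<Rightarrow> real" where
  "birkhoff \<phi> n x = (\<Sum>k<n. \<phi> ((\<alpha> ^^ k) x))"

lemma continuous_birkhoff: "continuous_on Y \<phi> \<Longrightarrow> continuous_on Y (birkhoff \<phi> n)"
  unfolding birkhoff_def[abs_def] by (intro continuous_on_sum continuous_on_comp_funpow)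

lemma birkhoff_add: "birkhoff \<phi> (m + n) x = birkhoff \<phi> m ((\<alpha> ^^ n) x) + birkhoff \<phi> n x"
proof -
  have "(\<alpha> ^^ (n + i)) x = (\<alpha> ^^ i) ((\<alpha> ^^ n) x)" for i
    by (metis add.commute comp_apply funpow_add)
  then show ?thesis
    unfolding birkhoff_def add.commute[of m] sum_lessThan_add by simp
qed

text \<open>\<open>growth \<phi> n = T\<^sub>\<phi>\<^sup>n 1\<close> for the weighted operator \<open>T\<^sub>\<phi> f = T (e\<^sup>\<phi> f)\<close>, by the homological
  identity.\<close>

definition growth :: "('a \<Rightarrow> real) \<Rightarrow> nat \<Rightarrow> 'a \<Rightarrow> real" where
  "growth \<phi> n = (T ^^ n) (\<lambda>x. exp (birkhoff \<phi> n x))"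

lemma continuous_exp_birkhoff: "continuous_on Y \<phi> \<Longrightarrow> continuous_on Y (\<lambda>x. exp (birkhoff \<phi> n x))"
  by (intro continuous_on_exp continuous_birkhoff)

lemma continuous_growth: "continuous_on Y \<phi> \<Longrightarrow> continuous_on Y (growth \<phi> n)"
  unfolding growth_def by (intro Tn_cont continuous_exp_birkhoff)

lemma growth_nonneg: "continuous_on Y \<phi> \<Longrightarrow> x \<in> Y \<Longrightarrow> 0 \<le> growth \<phi> n x"
  unfolding growth_def by (intro Tn_nonneg continuous_exp_birkhoff) auto

lemma growth_add:
  assumes "continuous_on Y \<phi>"
  shows "growth \<phi> (m + n) = (T ^^ m) (\<lambda>x. exp (birkhoff \<phi> m x) * growth \<phi> n x)"
  unfolding growth_def birkhoff_add exp_add funpow_add comp_apply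
  by (subst Tn_hom) (auto intro: continuous_exp_birkhoff assms)

definition max_growth :: "('a \<Rightarrow> real) \<Rightarrow> nat \<Rightarrow> real" where
  "max_growth \<phi> n = (SUP x\<in>Y. growth \<phi> n x)"

lemma growth_le_max: "continuous_on Y \<phi> \<Longrightarrow> x \<in> Y \<Longrightarrow> growth \<phi> n x \<le> max_growth \<phi> n"
  unfolding max_growth_def
  by (intro cSUP_upper compact_imp_bounded[THEN bounded_imp_bdd_above] compact_continuous_image
      continuous_growth compact_Y)

lemma max_growth_le: "(\<And>x. x \<in> Y \<Longrightarrow> growth \<phi> n x \<le> b) \<Longrightarrow> max_growth \<phi> n \<le> b"
  unfolding max_growth_def using Y_ne by (intro cSUP_least)

lemma max_growth_nonneg: "continuous_on Y \<phi> \<Longrightarrow> 0 \<le> max_growth \<phi> n"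
  using Y_ne growth_nonneg growth_le_max by (meson ex_in_conv order_trans)

lemma max_growth_add:
  assumes \<phi>: "continuous_on Y \<phi>"
  shows "max_growth \<phi> (m + n) \<le> max_growth \<phi> m * max_growth \<phi> n"
proof (rule max_growth_le)
  fix x assume x: "x \<in> Y"
  have "growth \<phi> (m + n) x \<le> (T ^^ m) (\<lambda>x. max_growth \<phi> n * exp (birkhoff \<phi> m x)) x"
    unfolding growth_add[OF \<phi>]
    by (rule Tn_mono[OF _ _ _ x])
      (auto intro!: continuous_on_mult continuous_exp_birkhoff continuous_growth \<phi> continuous_on_const growth_le_max)
  also have "\<dots> = max_growth \<phi> n * growth \<phi> m x"
    by (simp add: Tn_scale continuous_exp_birkhoff \<phi> growth_def)
  also have "\<dots> \<le> max_growth \<phi> m * max_growth \<phi> n"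
    using growth_le_max[OF \<phi> x] max_growth_nonneg[OF \<phi>] by (simp add: mult.commute mult_right_mono)
  finally show "growth \<phi> (m + n) x \<le> max_growth \<phi> m * max_growth \<phi> n" .
qed

text \<open>For continuous \<phi> this lies between \<open>pot \<phi> < c\<close> and
  \<open>pot \<phi> \<le> c\<close>. The free constant makes it visibly stable under convex
  combinations and coboundaries, and it never mentions \<open>-\<infinity>\<close>.\<close>

definition growth_bound :: "('a \<Rightarrow> real) \<Rightarrow> real \<Rightarrow> bool" where
  "growth_bound \<phi> c \<longleftrightarrow> (\<exists>C. \<forall>n. \<forall>x\<in>Y. growth \<phi> n x \<le> C * exp (real n * c))"

text \<open>Fekete's argument: submultiplicativity handles the multiples of \<open>n\<close>, and
  \<open>C\<close> collects the finitely many remainders modulo \<open>n\<close>, each rescaled by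
  the growth rate.\<close>

lemma growth_bound_of_max_growth:
  assumes \<phi>: "continuous_on Y \<phi>" and n: "0 < n" "max_growth \<phi> n \<le> exp (real n * c)"
  shows "growth_bound \<phi> c"
proof -
  have pow: "max_growth \<phi> (q * n + r) \<le> exp (real (q * n) * c) * max_growth \<phi> r" for q r
  proof (induction q)
    case (Suc q)
    have "max_growth \<phi> (Suc q * n + r) \<le> max_growth \<phi> n * max_growth \<phi> (q * n + r)"
      using max_growth_add[OF \<phi>, of n "q * n + r"] by (simp add: add.assoc)
    also have "\<dots> \<le> exp (real n * c) * (exp (real (q * n) * c) * max_growth \<phi> r)"
      using n Suc max_growth_nonneg[OF \<phi>] by (intro mult_mono) auto
    also have "\<dots> = exp (real (Suc q * n) * c) * max_growth \<phi> r"
      by (simp add: algebra_simps flip: exp_add)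
    finally show ?case .
  qed simp
  define C where "C = (\<Sum>r<n. max_growth \<phi> r * exp (- (real r * c)))"
  have "growth \<phi> N x \<le> C * exp (real N * c)" if x: "x \<in> Y" for N x
  proof -
    let ?q = "N div n" and ?r = "N mod n"
    have "max_growth \<phi> ?r * exp (- (real ?r * c)) \<le> C"
      unfolding C_def using n max_growth_nonneg[OF \<phi>] by (intro member_le_sum) auto
    then have r: "max_growth \<phi> ?r \<le> C * exp (real ?r * c)"
      by (simp add: exp_minus field_simps)
    have "growth \<phi> N x \<le> max_growth \<phi> (?q * n + ?r)" using growth_le_max[OF \<phi> x] by simp
    also have "\<dots> \<le> exp (real (?q * n) * c) * (C * exp (real ?r * c))"
      using pow[of ?q ?r] r by (meson exp_ge_zero mult_left_mono order_trans)
    also have "\<dots> = C * exp ((real (?q * n) + real ?r) * c)"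
      by (simp add: algebra_simps exp_add)
    also have "real (?q * n) + real ?r = real N" by (metis div_mult_mod_eq of_nat_add)
    finally show ?thesis .
  qed
  then show ?thesis unfolding growth_bound_def by blast
qed

text \<open>By submultiplicativity the limit in the spectral potential is an infimum. In this form a
  single \<open>n\<close> already gives an upper bound, and likewise a strict upper bound is
  witnessed by a single \<open>n\<close>.\<close>

definition pot :: "('a \<Rightarrow> real) \<Rightarrow> ereal" where
  "pot \<phi> = (INF n\<in>{n::nat. 1 \<le> n}. eln (max_growth \<phi> n) / ereal (real n))"

lemma pot_le: "1 \<le> n \<Longrightarrow> pot \<phi> \<le> eln (max_growth \<phi> n) / ereal (real n)"
  unfolding pot_def by (rule INF_lower) auto

text \<open>The infimum may be tested along a subsequence, and the constant \<open>C\<close> is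
  absorbed by an arbitrarily small increase of the rate. The multiples of \<open>n\<close> are what
  the power lemma below controls.\<close>

lemma pot_le_of_multiples:
  assumes n: "1 \<le> n" and b: "\<And>q x. 1 \<le> q \<Longrightarrow> x \<in> Y \<Longrightarrow> growth \<phi> (n * q) x \<le> C * exp (real (n * q) * c)"
  shows "pot \<phi> \<le> ereal c"
proof (rule ereal_le_epsilon2)
  fix e :: real assume e: "0 < e"
  obtain N where N: "\<And>k. N \<le> k \<Longrightarrow> C * exp (real k * c) \<le> exp (real k * (c + e))"
    using eventually_mult_exp_le[of c "c + e" C] e by auto
  let ?N = "n * Suc N"
  have "N \<le> ?N" using n by (cases n) auto
  then have "growth \<phi> ?N x \<le> exp (real ?N * (c + e))" if "x \<in> Y" for x
    using b[of "Suc N"] N[of ?N] that by (auto intro: order_trans)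
  then have "max_growth \<phi> ?N \<le> exp (real ?N * (c + e))" by (rule max_growth_le)
  then have "eln (max_growth \<phi> ?N) / ereal (real ?N) \<le> ereal (c + e)"
    using n by (subst eln_div_le_iff) auto
  then show "pot \<phi> \<le> ereal c + ereal e"
    using pot_le[of ?N \<phi>] n by (auto intro: order_trans)
qed

lemma pot_le_of_growth_bound:
  assumes "growth_bound \<phi> c"
  shows "pot \<phi> \<le> ereal c"
proof -
  obtain C where "\<And>n x. x \<in> Y \<Longrightarrow> growth \<phi> n x \<le> C * exp (real n * c)"
    using assms unfolding growth_bound_def by blast
  then show ?thesis by (intro pot_le_of_multiples[of 1 _ C]) auto
qed

lemma growth_bound_of_pot:
  assumes "continuous_on Y \<phi>" "pot \<phi> < ereal c"
  shows "growth_bound \<phi> c"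
proof -
  obtain n where n: "1 \<le> n" "eln (max_growth \<phi> n) / ereal (real n) < ereal c"
    using assms(2) unfolding pot_def INF_less_iff by auto
  then show ?thesis
    using assms(1) by (intro growth_bound_of_max_growth[of \<phi> n]) (auto simp: eln_div_less_iff)
qed

lemma pot_less_top: "pot \<phi> < \<infinity>"
  using pot_le[of 1 \<phi>] by (auto simp: eln_def split: if_splits)

lemma pot_tendsto:
  assumes \<phi>: "continuous_on Y \<phi>"
  shows "(\<lambda>n. eln (max_growth \<phi> n) / ereal (real n)) \<longlonglongrightarrow> pot \<phi>"
proof (rule order_tendstoI)
  fix l assume "l < pot \<phi>"
  then show "\<forall>\<^sub>F n in sequentially. l < eln (max_growth \<phi> n) / ereal (real n)"
    using pot_le[of _ \<phi>] by (intro eventually_sequentiallyI[of 1]) (auto intro: less_le_trans)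
next
  fix u assume "pot \<phi> < u"
  then obtain c where c: "pot \<phi> < ereal c" "ereal c < u" using ereal_dense2 by blast
  then obtain c' where c': "ereal c < ereal c'" "ereal c' < u" using ereal_dense2 by blast
  obtain C where C: "\<And>n x. x \<in> Y \<Longrightarrow> growth \<phi> n x \<le> C * exp (real n * c)"
    using growth_bound_of_pot[OF \<phi> c(1)] unfolding growth_bound_def by blast
  obtain N where N: "\<And>n. N \<le> n \<Longrightarrow> C * exp (real n * c) \<le> exp (real n * c')"
    using eventually_mult_exp_le[of c c' C] c' by auto
  show "\<forall>\<^sub>F n in sequentially. eln (max_growth \<phi> n) / ereal (real n) < u"
  proof (intro eventually_sequentiallyI[of "Suc N"])
    fix n assume n: "Suc N \<le> n"
    then have "C * exp (real n * c) \<le> exp (real n * c')" by (intro N) simp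
    then have "max_growth \<phi> n \<le> exp (real n * c')"
      using C by (intro max_growth_le) (meson order_trans)
    then have "eln (max_growth \<phi> n) / ereal (real n) \<le> ereal c'"
      using n by (subst eln_div_le_iff) auto
    then show "eln (max_growth \<phi> n) / ereal (real n) < u" using c'(2) by simp
  qed
qed

section \<open>Stability of growth bounds: convex combinations, drift and coboundaries\<close>

text \<open>Pointwise convexity of \<open>exp\<close> is enough once the rates are subtracted:
  applied to \<open>birkhoff \<phi>i n - real n * ci\<close> it produces the constant
  \<open>a * C1 + b * C2\<close>.\<close>

lemma growth_bound_convex:
  assumes "growth_bound \<phi>1 c1" "growth_bound \<phi>2 c2" and \<phi>: "continuous_on Y \<phi>1" "continuous_on Y \<phi>2"
    and ab: "0 < a" "0 < b" "a + b = 1"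
  shows "growth_bound (\<lambda>x. a * \<phi>1 x + b * \<phi>2 x) (a * c1 + b * c2)"
proof -
  obtain C1 C2 where C: "\<And>n x. x \<in> Y \<Longrightarrow> growth \<phi>1 n x \<le> C1 * exp (real n * c1)"
      "\<And>n x. x \<in> Y \<Longrightarrow> growth \<phi>2 n x \<le> C2 * exp (real n * c2)"
    using assms(1,2) unfolding growth_bound_def by blast
  let ?\<phi> = "\<lambda>x. a * \<phi>1 x + b * \<phi>2 x" and ?c = "a * c1 + b * c2"
  have cont: "continuous_on Y ?\<phi>" by (intro continuous_intros \<phi>)
  have "growth ?\<phi> n x \<le> (a * C1 + b * C2) * exp (real n * ?c)" if x: "x \<in> Y" for n x
  proof -
    let ?k1 = "exp (real n * (?c - c1))" and ?k2 = "exp (real n * (?c - c2))"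
    have "exp (birkhoff ?\<phi> n y) \<le> (a * ?k1) * exp (birkhoff \<phi>1 n y) + (b * ?k2) * exp (birkhoff \<phi>2 n y)" for y
    proof -
      let ?u = "birkhoff \<phi>1 n y - real n * c1" and ?v = "birkhoff \<phi>2 n y - real n * c2"
      have "birkhoff ?\<phi> n y = (a * ?u + b * ?v) + real n * ?c"
        by (simp add: birkhoff_def sum.distrib algebra_simps flip: sum_distrib_left)
      moreover have "exp (a * ?u + b * ?v) \<le> a * exp ?u + b * exp ?v"
      proof -
        have a: "a = 1 - b" "b \<le> 1" using ab by auto
        show ?thesis unfolding a(1) using convex_onD[OF exp_convex, of b ?u ?v] ab(2) a(2) by simp
      qed
      ultimately have "exp (birkhoff ?\<phi> n y) \<le> (a * exp ?u + b * exp ?v) * exp (real n * ?c)"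
        by (simp add: exp_add mult_right_mono)
      also have "\<dots> = (a * ?k1) * exp (birkhoff \<phi>1 n y) + (b * ?k2) * exp (birkhoff \<phi>2 n y)"
      proof -
        have "exp ?u * exp (real n * ?c) = ?k1 * exp (birkhoff \<phi>1 n y)"
          "exp ?v * exp (real n * ?c) = ?k2 * exp (birkhoff \<phi>2 n y)"
          unfolding exp_add[symmetric] by (auto simp: algebra_simps)
        then show ?thesis by (simp only: distrib_right mult.assoc)
      qed
      finally show ?thesis .
    qed
    then have "growth ?\<phi> n x \<le> (T ^^ n) (\<lambda>y. (a * ?k1) * exp (birkhoff \<phi>1 n y) + (b * ?k2) * exp (birkhoff \<phi>2 n y)) x"
      unfolding growth_def
      by (intro Tn_mono x continuous_on_add continuous_on_mult continuous_on_const continuous_exp_birkhoff \<phi> cont)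
    also have "\<dots> = (a * ?k1) * growth \<phi>1 n x + (b * ?k2) * growth \<phi>2 n x"
      by (subst Tn_add) (auto intro!: continuous_on_mult continuous_on_const continuous_exp_birkhoff \<phi>
          simp: Tn_scale continuous_exp_birkhoff \<phi> growth_def)
    also have "\<dots> \<le> (a * ?k1) * (C1 * exp (real n * c1)) + (b * ?k2) * (C2 * exp (real n * c2))"
      using ab C[OF x] by (intro add_mono mult_left_mono) auto
    also have "\<dots> = a * C1 * (?k1 * exp (real n * c1)) + b * C2 * (?k2 * exp (real n * c2))"
      by (simp add: algebra_simps)
    also have "\<dots> = (a * C1 + b * C2) * exp (real n * ?c)"
      by (simp add: algebra_simps flip: exp_add)
    finally show ?thesis .
  qed
  then show ?thesis unfolding growth_bound_def by blast
qed

text \<open>Birkhoff sums may change by a drift \<open>d\<close> per step and by a bounded error. A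
  pointwise bound gives pure drift; a coboundary telescopes and gives pure error.\<close>

lemma growth_bound_transform:
  assumes "growth_bound \<phi> c" and \<phi>: "continuous_on Y \<phi>" "continuous_on Y \<phi>'"
    and le: "\<And>n x. x \<in> Y \<Longrightarrow> birkhoff \<phi>' n x \<le> birkhoff \<phi> n x + (real n * d + B)"
  shows "growth_bound \<phi>' (c + d)"
proof -
  obtain C where C: "\<And>n x. x \<in> Y \<Longrightarrow> growth \<phi> n x \<le> C * exp (real n * c)"
    using assms(1) unfolding growth_bound_def by blast
  have "growth \<phi>' n x \<le> (exp B * C) * exp (real n * (c + d))" if x: "x \<in> Y" for n x
  proof -
    have "growth \<phi>' n x \<le> (T ^^ n) (\<lambda>y. exp (real n * d + B) * exp (birkhoff \<phi> n y)) x"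
      unfolding growth_def
      using le by (intro Tn_mono x continuous_on_mult continuous_on_const continuous_exp_birkhoff \<phi>)
        (auto simp flip: exp_add simp: add.commute)
    also have "\<dots> = exp (real n * d + B) * growth \<phi> n x"
      by (simp add: Tn_scale continuous_exp_birkhoff \<phi> growth_def)
    also have "\<dots> \<le> exp (real n * d + B) * (C * exp (real n * c))"
      using C[OF x] by (intro mult_left_mono) auto
    also have "\<dots> = (exp B * C) * exp (real n * (c + d))"
      by (simp add: algebra_simps exp_add)
    finally show ?thesis .
  qed
  then show ?thesis unfolding growth_bound_def by blast
qed

lemma growth_bound_mono:
  assumes "growth_bound \<phi> c" "continuous_on Y \<phi>" "continuous_on Y \<phi>'" "\<And>x. x \<in> Y \<Longrightarrow> \<phi>' x \<le> \<phi> x + d"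
  shows "growth_bound \<phi>' (c + d)"
proof (rule growth_bound_transform[OF assms(1-3), of d 0])
  fix n x assume "x \<in> Y"
  then have "birkhoff \<phi>' n x \<le> (\<Sum>k<n. \<phi> ((\<alpha> ^^ k) x) + d)"
    unfolding birkhoff_def by (intro sum_mono assms(4) funpow_Y)
  then show "birkhoff \<phi>' n x \<le> birkhoff \<phi> n x + (real n * d + 0)"
    by (simp add: birkhoff_def sum.distrib)
qed

lemma growth_bound_coboundary:
  assumes "growth_bound \<phi> c" and \<phi>: "continuous_on Y \<phi>" and f: "continuous_on Y f"
  shows "growth_bound (\<lambda>x. \<phi> x + (f (\<alpha> x) - f x)) c"
proof -
  obtain B where B: "\<And>x. x \<in> Y \<Longrightarrow> \<bar>f x\<bar> \<le> B" using continuous_bounded_compact[OF compact_Y f] by blast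
  have tel: "birkhoff (\<lambda>x. \<phi> x + (f (\<alpha> x) - f x)) n x = birkhoff \<phi> n x + (f ((\<alpha> ^^ n) x) - f x)" for n x
    by (induction n) (auto simp: birkhoff_def)
  have "growth_bound (\<lambda>x. \<phi> x + (f (\<alpha> x) - f x)) (c + 0)"
  proof (rule growth_bound_transform[OF assms(1,2), of _ 0 "2 * B"])
    show "continuous_on Y (\<lambda>x. \<phi> x + (f (\<alpha> x) - f x))"
      using continuous_on_comp_funpow[OF f, of 1] by (intro continuous_intros \<phi> f) auto
    fix n x assume x: "x \<in> Y"
    show "birkhoff (\<lambda>x. \<phi> x + (f (\<alpha> x) - f x)) n x \<le> birkhoff \<phi> n x + (real n * 0 + 2 * B)"
      unfolding tel using B[OF x] B[OF funpow_Y[OF x, of n]] by (simp add: abs_le_iff)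
  qed
  then show ?thesis by simp
qed

lemma pot_subgradient:
  assumes \<psi>: "continuous_on Y \<psi>" and l: "pot \<psi> = ereal l"
  obtains m where "invariant_state \<alpha> Y m"
    "\<And>\<phi> c. continuous_on Y \<phi> \<Longrightarrow> pot \<phi> \<le> ereal c \<Longrightarrow> l + (m \<phi> - m \<psi>) \<le> c"
proof -
  obtain m where m: "invariant_state \<alpha> Y m"
      "\<And>\<phi> c. continuous_on Y \<phi> \<Longrightarrow> growth_bound \<phi> c \<Longrightarrow> l + (m \<phi> - m \<psi>) \<le> c"
  proof (rule invariant_subgradient[OF compact_Y cont_\<alpha> \<alpha>_Y \<psi>, of growth_bound l])
    show "growth_bound \<psi> c \<Longrightarrow> l \<le> c" for c
      using pot_le_of_growth_bound[of \<psi> c] l by simp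
    show "0 < e \<Longrightarrow> growth_bound \<psi> (l + e)" for e
      using growth_bound_of_pot[OF \<psi>, of "l + e"] l by simp
  qed (use growth_bound_convex growth_bound_mono growth_bound_coboundary in auto)
  have "l + (m \<phi> - m \<psi>) \<le> c" if "continuous_on Y \<phi>" "pot \<phi> \<le> ereal c" for \<phi> c
  proof (rule field_le_epsilon)
    fix e :: real assume "0 < e"
    then have "pot \<phi> < ereal (c + e)" using that(2) by (auto intro: le_less_trans)
    then show "l + (m \<phi> - m \<psi>) \<le> c + e"
      using growth_bound_of_pot[OF that(1)] m(2)[OF that(1)] by blast
  qed
  then show thesis using m(1) that by blast
qed

text \<open>The Birkhoff sum of \<open>\<phi>/n\<close> is an average over residue classes modulo \<open>n\<close>, and convexity of
  \<open>exp\<close> reduces the claim to the single classes.\<close>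

lemma pot_le_zero_of_power:
  assumes \<phi>: "continuous_on Y \<phi>" and n: "1 \<le> n" and le1: "\<And>x. x \<in> Y \<Longrightarrow> (T ^^ n) (\<lambda>x. exp (\<phi> x)) x \<le> 1"
  shows "pot (\<lambda>x. \<phi> x / real n) \<le> 0"
proof -
  \<comment> \<open>\<open>G q\<close> is the Birkhoff sum of \<phi> for the map \<alpha>^n. Each
    block of \<open>n\<close> iterates contributes a factor at most 1 by hypothesis, so the
    \<open>n * q\<close> iterates of \<open>exp (G q)\<close> stay below 1.\<close>
  define G where "G q x = (\<Sum>j<q. \<phi> ((\<alpha> ^^ (n * j)) x))" for q x
  have Gc: "continuous_on Y (G q)" for q
    unfolding G_def by (intro continuous_on_sum continuous_on_comp_funpow \<phi>)
  have eGc: "continuous_on Y (\<lambda>x. exp (G q x))" for q by (intro continuous_on_exp Gc)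
  have G1: "(T ^^ (n * q)) (\<lambda>x. exp (G q x)) x \<le> 1" if "x \<in> Y" for q x
    using that
  proof (induction q arbitrary: x)
    case (Suc q)
    have "(\<alpha> ^^ (n * Suc j)) x = (\<alpha> ^^ (n * j)) ((\<alpha> ^^ n) x)" for j x
      by (metis comp_apply funpow_add mult_Suc_right add.commute)
    then have G: "G (Suc q) x = \<phi> x + G q ((\<alpha> ^^ n) x)" for x
      unfolding G_def by (subst sum.lessThan_Suc_shift) simp
    have "(T ^^ (n * Suc q)) (\<lambda>x. exp (G (Suc q) x)) x
        = (T ^^ (n * q)) ((T ^^ n) (\<lambda>x. exp (G q ((\<alpha> ^^ n) x)) * exp (\<phi> x))) x"
      by (simp add: G exp_add mult.commute add.commute[of n] funpow_add)
    also have "\<dots> = (T ^^ (n * q)) (\<lambda>x. exp (G q x) * (T ^^ n) (\<lambda>x. exp (\<phi> x)) x) x"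
      by (subst Tn_hom) (auto intro: eGc continuous_on_exp \<phi>)
    also have "\<dots> \<le> (T ^^ (n * q)) (\<lambda>x. exp (G q x)) x"
      using le1 Suc.prems
      by (intro Tn_mono continuous_on_mult eGc Tn_cont continuous_on_exp \<phi>)
         (auto simp: mult_le_cancel_left2)
    also have "\<dots> \<le> 1" using Suc by simp
    finally show ?case .
  qed (simp add: G_def)
  obtain M where M: "\<And>x. x \<in> Y \<Longrightarrow> \<bar>\<phi> x\<bar> \<le> M" using continuous_bounded_compact[OF compact_Y \<phi>] by blast
  define D where "D = (\<Sum>k\<le>n. max_growth (\<lambda>_. 0) k)"
  have D: "(T ^^ k) (\<lambda>_. 1) x \<le> D" if "k \<le> n" "x \<in> Y" for k x
  proof -
    have "(T ^^ k) (\<lambda>_. 1) x = growth (\<lambda>_. 0) k x" by (simp add: growth_def birkhoff_def)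
    also have "\<dots> \<le> max_growth (\<lambda>_. 0) k" using that by (intro growth_le_max) auto
    also have "\<dots> \<le> D" unfolding D_def using that by (intro member_le_sum max_growth_nonneg) auto
    finally show ?thesis .
  qed
  have D0: "0 \<le> D" unfolding D_def by (intro sum_nonneg max_growth_nonneg) auto
  define C where "C = D * (D * exp M)"
  \<comment> \<open>The shift by \<alpha>^k leaves \<open>T ^^ k\<close> by the homological
    identity, at the price of \<open>T ^^ k\<close> of 1, at most \<open>D\<close>. The last summand
    of \<open>G (Suc q)\<close> costs \<open>exp M\<close>, because only \<open>n * q\<close>
    iterates remain for whole blocks, and the outer \<open>T ^^ (n - k)\<close> costs another
    \<open>D\<close>. The constant does not depend on \<open>q\<close>.\<close>
  have cls: "(T ^^ (n * Suc q)) (\<lambda>x. exp (G (Suc q) ((\<alpha> ^^ k) x))) x \<le> C" if k: "k < n" and x: "x \<in> Y" for q k x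
  proof -
    have "n * Suc q = (n - k) + (n * q + k)" using k by simp
    then have "(T ^^ (n * Suc q)) (\<lambda>x. exp (G (Suc q) ((\<alpha> ^^ k) x))) x
       = (T ^^ (n - k)) ((T ^^ (n * q)) ((T ^^ k) (\<lambda>x. exp (G (Suc q) ((\<alpha> ^^ k) x)) * 1))) x"
      by (simp only: funpow_add comp_apply mult_1_right)
    also have "\<dots> = (T ^^ (n - k)) ((T ^^ (n * q)) (\<lambda>x. exp (G (Suc q) x) * (T ^^ k) (\<lambda>_. 1) x)) x"
      by (subst Tn_hom) (auto intro: eGc)
    also have "\<dots> \<le> (T ^^ (n - k)) (\<lambda>_. (D * exp M) * 1) x"
    proof (rule Tn_mono[OF _ _ _ x])
      fix y assume y: "y \<in> Y"
      have "(T ^^ (n * q)) (\<lambda>x. exp (G (Suc q) x) * (T ^^ k) (\<lambda>_. 1) x) y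
          \<le> (T ^^ (n * q)) (\<lambda>x. (D * exp M) * exp (G q x)) y"
      proof (rule Tn_mono[OF _ _ _ y])
        fix z assume z: "z \<in> Y"
        have "G (Suc q) z \<le> G q z + M"
          unfolding G_def using M[OF funpow_Y[OF z, of "n * q"]] by (simp add: abs_le_iff)
        then have "exp (G (Suc q) z) \<le> exp (G q z) * exp M" by (simp flip: exp_add)
        then have "exp (G (Suc q) z) * (T ^^ k) (\<lambda>_. 1) z \<le> (exp (G q z) * exp M) * D"
          using D[of k z] k z by (intro mult_mono) (auto intro: Tn_nonneg)
        then show "exp (G (Suc q) z) * (T ^^ k) (\<lambda>_. 1) z \<le> (D * exp M) * exp (G q z)"
          by (simp add: mult_ac)
      qed (auto intro!: continuous_on_mult eGc Tn_cont continuous_on_const)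
      also have "\<dots> = (D * exp M) * (T ^^ (n * q)) (\<lambda>x. exp (G q x)) y"
        by (simp add: Tn_scale eGc)
      also have "\<dots> \<le> (D * exp M) * 1"
        using G1[OF y, of q] D0 by (intro mult_left_mono) auto
      finally show "(T ^^ (n * q)) (\<lambda>x. exp (G (Suc q) x) * (T ^^ k) (\<lambda>_. 1) x) y \<le> (D * exp M) * 1" .
    qed (auto intro!: continuous_on_mult eGc Tn_cont continuous_on_const)
    also have "\<dots> = (D * exp M) * (T ^^ (n - k)) (\<lambda>_. 1) x"
      using Tn_scale[of "\<lambda>_. 1" "n - k" "D * exp M"] by simp
    also have "\<dots> \<le> C" unfolding C_def using D[of "n - k" x] x D0
      by (subst mult.commute) (intro mult_right_mono, auto)
    finally show ?thesis .
  qed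
  have "growth (\<lambda>x. \<phi> x / real n) (n * q) x \<le> C * exp (real (n * q) * 0)" if q: "1 \<le> q" and x: "x \<in> Y" for q x
  proof -
    obtain p where p: "q = Suc p" using q by (cases q) auto
    have "exp (birkhoff (\<lambda>x. \<phi> x / real n) (n * q) y) \<le> (\<Sum>k<n. (1 / real n) * exp (G q ((\<alpha> ^^ k) y)))" for y
    proof -
      have "(\<alpha> ^^ (n * j + k)) y = (\<alpha> ^^ (n * j)) ((\<alpha> ^^ k) y)" for j k
        by (simp add: funpow_add)
      then have "birkhoff (\<lambda>x. \<phi> x / real n) (n * q) y = (\<Sum>k<n. (1 / real n) *\<^sub>R G q ((\<alpha> ^^ k) y))"
        unfolding birkhoff_def sum_residue_classes G_def by (simp add: sum_divide_distrib)
      also have "exp \<dots> \<le> (\<Sum>k<n. (1 / real n) * exp (G q ((\<alpha> ^^ k) y)))"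
        using n by (intro convex_on_sum[OF _ _ exp_convex]) (auto simp: lessThan_empty_iff)
      finally show ?thesis .
    qed
    then have "growth (\<lambda>x. \<phi> x / real n) (n * q) x \<le> (T ^^ (n * q)) (\<lambda>y. \<Sum>k<n. (1 / real n) * exp (G q ((\<alpha> ^^ k) y))) x"
      unfolding growth_def using n
      by (intro Tn_mono x continuous_exp_birkhoff continuous_on_sum continuous_on_mult continuous_on_const
          continuous_on_comp_funpow[OF eGc] continuous_on_divide \<phi>) auto
    also have "\<dots> = (\<Sum>k<n. (1 / real n) * (T ^^ (n * q)) (\<lambda>y. exp (G q ((\<alpha> ^^ k) y))) x)"
      by (subst Tn_sum) (auto intro!: continuous_on_mult continuous_on_const continuous_on_comp_funpow[OF eGc]
           simp only: Tn_scale[OF continuous_on_comp_funpow[OF eGc]] finite_lessThan)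
    also have "\<dots> \<le> (\<Sum>k<n. (1 / real n) * C)"
      using cls[OF _ x] by (intro sum_mono mult_left_mono) (auto simp: p)
    also have "\<dots> = C" using n by simp
    finally show ?thesis by simp
  qed
  then show ?thesis using pot_le_of_multiples[OF n, of _ C 0] by (simp add: zero_ereal_def)
qed

end

section \<open>The variational principle for states\<close>

definition rel_log :: "real \<Rightarrow> real \<Rightarrow> ereal" where
  "rel_log x y = (if x = 0 then 0 else ereal x * eln (y / x))"

lemma rel_log_less_top: "0 \<le> x \<Longrightarrow> rel_log x y < \<infinity>"
  by (auto simp: rel_log_def eln_def)

text \<open>In \<open>ereal\<close> the sum of both infinities is \<open>\<infinity>\<close>, so one
  summand \<open>-\<infinity>\<close> decides the sum only after \<open>\<infinity>\<close> has been
  excluded among the others.\<close>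

lemma sum_rel_log_MInf:
  assumes "finite I" "\<And>i. i \<in> I \<Longrightarrow> 0 \<le> x i" "i0 \<in> I" "0 < x i0" "y i0 \<le> 0"
  shows "(\<Sum>i\<in>I. rel_log (x i) (y i)) = - \<infinity>"
proof -
  have "(\<Sum>i\<in>I - {i0}. rel_log (x i) (y i)) \<noteq> \<infinity>"
    using assms(1,2) rel_log_less_top by (auto simp: sum_Pinfty)
  moreover have "rel_log (x i0) (y i0) = - \<infinity>"
    using assms(4,5) by (auto simp: rel_log_def eln_def divide_le_0_iff zero_less_divide_iff)
  ultimately show ?thesis
    using assms(1,3) by (simp add: sum.remove[of I i0])
qed

lemma sum_rel_log_real:
  assumes "\<And>i. i \<in> I \<Longrightarrow> 0 \<le> x i" "\<And>i. i \<in> I \<Longrightarrow> 0 < x i \<Longrightarrow> 0 < y i"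
  shows "(\<Sum>i\<in>I. rel_log (x i) (y i)) = ereal (\<Sum>i\<in>I. x i * ln (y i / x i))"
  unfolding sum_ereal[symmetric]
proof (rule sum.cong[OF refl])
  fix i assume "i \<in> I"
  then show "rel_log (x i) (y i) = ereal (x i * ln (y i / x i))"
    using assms[of i] by (cases "x i = 0") (auto simp: rel_log_def eln_def)
qed

text \<open>Legendre duality: for positive \<open>x\<close> and \<open>y\<close> the weights
  \<open>a i = ln (x i / y i)\<close> turn the right-hand side of the hypothesis, at \<delta> = 0,
  into the entropy sum. The extra \<delta> keeps the logarithm meaningful when all the
  \<open>y i\<close> vanish.\<close>

lemma le_sum_rel_log:
  fixes x y :: "'i \<Rightarrow> real"
  assumes I: "finite I" and x: "\<And>i. i \<in> I \<Longrightarrow> 0 \<le> x i" "(\<Sum>i\<in>I. x i) = 1"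
    and y: "\<And>i. i \<in> I \<Longrightarrow> 0 \<le> y i"
    and D: "\<And>a \<delta>. 0 < \<delta> \<Longrightarrow> D \<le> - (\<Sum>i\<in>I. a i * x i) + ln ((\<Sum>i\<in>I. exp (a i) * y i) + \<delta>)"
  shows "ereal D \<le> (\<Sum>i\<in>I. rel_log (x i) (y i))"
proof (cases "\<exists>i\<in>I. 0 < x i \<and> y i = 0")
  case True
  then obtain i0 where i0: "i0 \<in> I" "0 < x i0" "y i0 = 0" by blast
  define c where "c = ln ((\<Sum>i\<in>I. y i) + 1)"
  \<comment> \<open>The weight at \<open>i0\<close> is invisible in the logarithm because
    \<open>y i0 = 0\<close>. This choice makes the hypothesis read
    \<open>D \<le> D - 1\<close>.\<close>
  define t where "t = (c - D + 1) / x i0"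
  define a where "a i = (if i = i0 then t else 0)" for i
  have "(\<Sum>i\<in>I. a i * x i) = t * x i0"
    unfolding a_def using I i0(1) by (simp add: if_distrib[of "\<lambda>u. u * _"] sum.delta' cong: if_cong)
  moreover have "(\<Sum>i\<in>I. exp (a i) * y i) = (\<Sum>i\<in>I. y i)"
    using i0(3) by (intro sum.cong) (auto simp: a_def)
  ultimately have "D \<le> - (t * x i0) + c" using D[of 1 a] by (simp add: c_def)
  then have False using i0(2) by (simp add: t_def)
  then show ?thesis ..
next
  case False
  then have pos: "0 < y i" if "i \<in> I" "0 < x i" for i using that y[of i] by (auto simp: less_le)
  have "D \<le> (\<Sum>i\<in>I. x i * ln (y i / x i)) + e" if e: "0 < e" for e
  proof -
    define \<delta> where "\<delta> = e / (real (card I) + 1)"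
    have \<delta>: "0 < \<delta>" "(real (card I) + 1) * \<delta> = e" using e by (auto simp: \<delta>_def)
    \<comment> \<open>Where \<open>x i = 0\<close> the optimal weight would be
      \<open>-\<infinity>\<close>; the substitute keeps \<open>exp (a i) * y i\<close> below
      \<delta>, with \<open>y i + 1\<close> avoiding a zero denominator. The \<open>card I\<close>
      errors and the additional \<delta> of the hypothesis together make up
      \<open>e\<close>.\<close>
    define a where "a i = (if 0 < x i then ln (x i / y i) else ln (\<delta> / (y i + 1)))" for i
    have "exp (a i) * y i \<le> x i + \<delta>" if i: "i \<in> I" for i
    proof (cases "0 < x i")
      case True
      then show ?thesis using pos[OF i True] \<delta>(1) by (simp add: a_def)
    next
      case False
      then have "exp (a i) * y i = \<delta> * (y i / (y i + 1))"
        using y[OF i] \<delta>(1) by (simp add: a_def add_nonneg_pos)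
      also have "\<dots> \<le> \<delta> * 1" using y[OF i] \<delta>(1) by (intro mult_left_mono) auto
      finally show ?thesis using x(1)[OF i] by simp
    qed
    then have "(\<Sum>i\<in>I. exp (a i) * y i) \<le> (\<Sum>i\<in>I. x i + \<delta>)" by (rule sum_mono)
    then have le: "(\<Sum>i\<in>I. exp (a i) * y i) + \<delta> \<le> 1 + e"
      using x(2) \<delta>(2) by (simp add: sum.distrib algebra_simps)
    have "0 \<le> (\<Sum>i\<in>I. exp (a i) * y i)" using y by (intro sum_nonneg) auto
    then have "ln ((\<Sum>i\<in>I. exp (a i) * y i) + \<delta>) \<le> ln (1 + e)"
      using le \<delta>(1) by (subst ln_le_cancel_iff) auto
    also have "\<dots> \<le> e" using e by (intro ln_add_one_self_le_self) auto
    finally have "D \<le> - (\<Sum>i\<in>I. a i * x i) + e" using D[OF \<delta>(1), of a] by simp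
    also have "- (\<Sum>i\<in>I. a i * x i) = (\<Sum>i\<in>I. x i * ln (y i / x i))"
      unfolding sum_negf[symmetric]
    proof (rule sum.cong[OF refl])
      fix i assume i: "i \<in> I"
      show "- (a i * x i) = x i * ln (y i / x i)"
        using x(1)[OF i] pos[OF i] by (cases "x i = 0") (auto simp: a_def ln_div algebra_simps)
    qed
    finally show ?thesis .
  qed
  then have "D \<le> (\<Sum>i\<in>I. x i * ln (y i / x i))" by (rule field_le_epsilon)
  then show ?thesis using sum_rel_log_real[of I x y] x(1) pos by simp
qed

text \<open>Jensen's inequality for the logarithm, obtained summand by summand from
  \<open>ln z \<le> z - 1\<close> with \<open>z = exp (s i) * y i / (x i * a)\<close>. A vanishing
  \<open>y i\<close> with \<open>0 < x i\<close> makes the left-hand side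
  \<open>-\<infinity>\<close>.\<close>

lemma sum_rel_log_le:
  fixes x y s :: "'i \<Rightarrow> real"
  assumes I: "finite I" and x: "\<And>i. i \<in> I \<Longrightarrow> 0 \<le> x i" "(\<Sum>i\<in>I. x i) = 1"
    and y: "\<And>i. i \<in> I \<Longrightarrow> 0 \<le> y i" and a: "(\<Sum>i\<in>I. exp (s i) * y i) \<le> a"
  shows "ereal (\<Sum>i\<in>I. s i * x i) + (\<Sum>i\<in>I. rel_log (x i) (y i)) \<le> eln a"
proof (cases "\<exists>i\<in>I. 0 < x i \<and> y i = 0")
  case True
  then show ?thesis using sum_rel_log_MInf[of I x _ y] I x(1) by auto
next
  case False
  then have pos: "0 < y i" if "i \<in> I" "0 < x i" for i using that y[of i] by (auto simp: less_le)
  obtain i0 where i0: "i0 \<in> I" "0 < x i0"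
    using x by (metis less_eq_real_def sum.neutral zero_neq_one)
  have "0 < exp (s i0) * y i0" using pos[OF i0] by simp
  also have "\<dots> \<le> (\<Sum>i\<in>I. exp (s i) * y i)" using I i0 y by (intro member_le_sum) auto
  finally have apos: "0 < a" using a by simp
  have "x i * (s i + ln (y i / x i) - ln a) \<le> exp (s i) * y i / a - x i" if i: "i \<in> I" for i
  proof (cases "x i = 0")
    case True
    then show ?thesis using y[OF i] apos by simp
  next
    case False
    then have xi: "0 < x i" using x(1)[OF i] by simp
    let ?z = "exp (s i) * y i / (x i * a)"
    have z: "0 < ?z" using xi pos[OF i xi] apos by simp
    have "s i + ln (y i / x i) - ln a = ln ?z"
      using xi pos[OF i xi] apos by (simp add: ln_mult ln_div)
    also have "\<dots> \<le> ?z - 1" using z by (rule ln_le_minus_one)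
    finally have "x i * (s i + ln (y i / x i) - ln a) \<le> x i * (?z - 1)" using xi by simp
    also have "\<dots> = exp (s i) * y i / a - x i" using xi apos by (simp add: field_simps)
    finally show ?thesis .
  qed
  then have "(\<Sum>i\<in>I. x i * (s i + ln (y i / x i) - ln a)) \<le> (\<Sum>i\<in>I. exp (s i) * y i / a - x i)"
    by (rule sum_mono)
  also have "\<dots> = (\<Sum>i\<in>I. exp (s i) * y i) / a - 1"
    using x(2) by (simp add: sum_subtractf sum_divide_distrib)
  also have "\<dots> \<le> 0" using a apos by simp
  also have "(\<Sum>i\<in>I. x i * (s i + ln (y i / x i) - ln a))
      = (\<Sum>i\<in>I. s i * x i) + (\<Sum>i\<in>I. x i * ln (y i / x i)) - (\<Sum>i\<in>I. x i) * ln a"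
    by (simp add: algebra_simps sum.distrib sum_subtractf sum_distrib_left)
  finally have "(\<Sum>i\<in>I. s i * x i) + (\<Sum>i\<in>I. x i * ln (y i / x i)) \<le> ln a" using x(2) by simp
  then show ?thesis using apos sum_rel_log_real[of I x y] x(1) pos by (simp add: eln_def)
qed

section \<open>A telescoping partition of unity on the real line\<close>

definition clamp01 :: "real \<Rightarrow> real" where "clamp01 t = max 0 (min 1 t)"

text \<open>The tent of width two centred at \<open>j\<close>, written as a difference so that sums
  over \<open>j\<close> telescope.\<close>

definition hat :: "nat \<Rightarrow> real \<Rightarrow> real" where
  "hat j t = clamp01 (t - real j + 1) - clamp01 (t - real j)"

lemma hat_nonneg: "0 \<le> hat j t"
  by (auto simp: hat_def clamp01_def)

lemma hat_support: "hat j t \<noteq> 0 \<Longrightarrow> \<bar>t - real j\<bar> \<le> 1"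
  by (auto simp: hat_def clamp01_def max_def min_def split: if_splits)

lemma continuous_hat: "continuous_on S f \<Longrightarrow> continuous_on S (\<lambda>x. hat j (f x))"
  unfolding hat_def clamp01_def by (intro continuous_intros)

lemma sum_hat:
  assumes "0 \<le> t" "t \<le> real N"
  shows "(\<Sum>j<Suc N. hat j t) = 1"
proof -
  have "(\<Sum>j<n. hat j t) = clamp01 (t + 1) - clamp01 (t - real n + 1)" for n
    by (induction n) (auto simp: hat_def)
  from this[of "Suc N"] show ?thesis using assms by (simp add: clamp01_def)
qed

section \<open>Entropy of invariant states\<close>

context transfer_on
begin

definition unity_sets :: "('a \<Rightarrow> real) set set" where
  "unity_sets = {G. finite G \<and>
     (\<forall>g\<in>G. continuous_on Y g \<and> (\<forall>x. 0 \<le> g x) \<and> (\<forall>x. x \<notin> Y \<longrightarrow> g x = 0)) \<and>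
     (\<forall>x\<in>Y. (\<Sum>g\<in>G. g x) = 1)}"

definition state_entropy :: "(('a \<Rightarrow> real) \<Rightarrow> real) \<Rightarrow> ereal" where
  "state_entropy m = (INF n\<in>{n::nat. 1 \<le> n}. ereal (1 / real n) *
     (INF G\<in>unity_sets. \<Sum>g\<in>G. rel_log (m g) (m ((T ^^ n) g))))"

context
  fixes m :: "('a \<Rightarrow> real) \<Rightarrow> real"
  assumes m: "invariant_state \<alpha> Y m"
begin

lemma m_add: "continuous_on Y f \<Longrightarrow> continuous_on Y g \<Longrightarrow> m (\<lambda>x. f x + g x) = m f + m g"
  and m_scale: "continuous_on Y f \<Longrightarrow> m (\<lambda>x. c * f x) = c * m f"
  and m_nonneg: "continuous_on Y f \<Longrightarrow> (\<And>x. x \<in> Y \<Longrightarrow> 0 \<le> f x) \<Longrightarrow> 0 \<le> m f"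
  and m_one: "m (\<lambda>_. 1) = 1"
  and m_inv: "continuous_on Y f \<Longrightarrow> m (\<lambda>x. f (\<alpha> x)) = m f"
  using m unfolding invariant_state_def by auto

lemma m_mono:
  assumes "continuous_on Y f" "continuous_on Y g" "\<And>x. x \<in> Y \<Longrightarrow> f x \<le> g x"
  shows "m f \<le> m g"
proof -
  have "0 \<le> m (\<lambda>x. g x + (-1) * f x)"
    using assms by (intro m_nonneg continuous_intros) auto
  also have "\<dots> = m g + (-1) * m f"
    using assms by (subst m_add) (auto intro!: continuous_intros simp only: m_scale)
  finally show ?thesis by simp
qed

lemma m_cong:
  assumes "continuous_on Y f" "\<And>x. x \<in> Y \<Longrightarrow> f x = g x"
  shows "m f = m g"
proof -
  have "continuous_on Y g" using assms continuous_on_cong by metis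
  then show ?thesis using assms by (intro antisym m_mono) auto
qed

lemma m_const: "m (\<lambda>_. c) = c"
  using m_scale[of "\<lambda>_. 1" c] m_one by simp

lemma m_sum:
  assumes "finite I" "\<And>i. i \<in> I \<Longrightarrow> continuous_on Y (f i)"
  shows "m (\<lambda>x. \<Sum>i\<in>I. f i x) = (\<Sum>i\<in>I. m (f i))"
  using assms by (induction I rule: finite_induct) (auto simp: m_const m_add continuous_on_sum)

lemma m_inv_funpow: "continuous_on Y f \<Longrightarrow> m (\<lambda>x. f ((\<alpha> ^^ n) x)) = m f"
proof (induction n)
  case (Suc n)
  then show ?case
    using m_inv[OF continuous_on_comp_funpow[of f n]] by (simp add: funpow_swap1)
qed simp

lemma m_birkhoff: "continuous_on Y \<phi> \<Longrightarrow> m (birkhoff \<phi> n) = real n * m \<phi>"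
  unfolding birkhoff_def[abs_def] by (subst m_sum) (auto simp: continuous_on_comp_funpow m_inv_funpow)

text \<open>Partitions of unity in the definition of the entropy are sets, so functions occurring several
  times in an indexed family have to be merged; \<open>rel_log\<close> is homogeneous, so this does not change
  the sum.\<close>

lemma unity_family_to_set:
  fixes g :: "nat \<Rightarrow> 'a \<Rightarrow> real"
  assumes "finite I" "\<And>i. i \<in> I \<Longrightarrow> continuous_on Y (g i)" "\<And>i x. i \<in> I \<Longrightarrow> 0 \<le> g i x"
    "\<And>i x. i \<in> I \<Longrightarrow> x \<notin> Y \<Longrightarrow> g i x = 0" "\<And>x. x \<in> Y \<Longrightarrow> (\<Sum>i\<in>I. g i x) = 1"
  shows "\<exists>G\<in>unity_sets. (\<Sum>g\<in>G. rel_log (m g) (m ((T ^^ n) g)))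
     = (\<Sum>i\<in>I. rel_log (m (g i)) (m ((T ^^ n) (g i))))"
  using assms
proof (induction "card I" arbitrary: I g rule: less_induct)
  case less
  show ?case
  proof (cases "inj_on g I")
    case True
    then have "g ` I \<in> unity_sets"
      using less.prems by (auto simp: unity_sets_def sum.reindex)
    then show ?thesis using True by (intro bexI[of _ "g ` I"]) (auto simp: sum.reindex)
  next
    case False
    then obtain i j where ij: "i \<in> I" "j \<in> I" "i \<noteq> j" "g i = g j" by (auto simp: inj_on_def)
    let ?I = "I - {j}" and ?g = "g(i := (\<lambda>x. 2 * g i x))"
    have split: "(\<Sum>k\<in>I. F (g k)) = (\<Sum>k\<in>?I. F (?g k))"
      if F: "F (\<lambda>x. 2 * g i x) = F (g i) + F (g i)" for F :: "('a \<Rightarrow> real) \<Rightarrow> 'b::comm_monoid_add"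
    proof -
      have "(\<Sum>k\<in>I. F (g k)) = F (g j) + (F (g i) + (\<Sum>k\<in>?I - {i}. F (g k)))"
        using less.prems(1) ij by (simp add: sum.remove[of I j] sum.remove[of "I - {j}" i])
      also have "\<dots> = F (?g i) + (\<Sum>k\<in>?I - {i}. F (?g k))"
        using F ij by (simp add: add.assoc)
      also have "\<dots> = (\<Sum>k\<in>?I. F (?g k))"
        using less.prems(1) ij by (subst (2) sum.remove[of _ i]) auto
      finally show ?thesis .
    qed
    have "\<exists>G\<in>unity_sets. (\<Sum>g\<in>G. rel_log (m g) (m ((T ^^ n) g)))
       = (\<Sum>i\<in>?I. rel_log (m (?g i)) (m ((T ^^ n) (?g i))))"
    proof (rule less.hyps)
      show "card ?I < card I" using ij less.prems(1) by (intro psubset_card_mono) auto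
      show "(\<Sum>k\<in>?I. ?g k x) = 1" if "x \<in> Y" for x
        using split[of "\<lambda>h. h x"] less.prems(5)[OF that] by simp
    qed (use less.prems in \<open>auto intro!: continuous_intros\<close>)
    moreover have "rel_log (m (\<lambda>x. 2 * g i x)) (m ((T ^^ n) (\<lambda>x. 2 * g i x)))
        = rel_log (m (g i)) (m ((T ^^ n) (g i))) + rel_log (m (g i)) (m ((T ^^ n) (g i)))"
    proof -
      have "rel_log (2 * x) (2 * y) = rel_log x y + rel_log x y" for x y
        by (cases "eln (y / x)") (auto simp: rel_log_def)
      then show ?thesis using less.prems(2) ij(1) by (simp add: Tn_scale m_scale Tn_cont)
    qed
    ultimately show ?thesis
      using split[of "\<lambda>h. rel_log (m h) (m ((T ^^ n) h))"] by simp
  qed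
qed

text \<open>Tents composed with the rescaled Birkhoff sum give a partition on whose members the sum
  stays within \<open>h\<close> of a level \<open>s j\<close>. Jensen uses the lower values
  \<open>s j - h\<close>, the integral of the Birkhoff sum the upper values \<open>s j + h\<close>;
  their difference \<open>2 * h\<close> is the error \<open>e\<close>.\<close>

lemma exists_fine_unity_family:
  assumes \<psi>: "continuous_on Y \<psi>" and n: "1 \<le> n" and e: "0 < e"
  shows "\<exists>G\<in>unity_sets. ereal (real n * m \<psi>) + (\<Sum>g\<in>G. rel_log (m g) (m ((T ^^ n) g)))
     \<le> eln (max_growth \<psi> n) + ereal e"
proof -
  let ?s = "birkhoff \<psi> n"
  have sc: "continuous_on Y ?s" by (rule continuous_birkhoff[OF \<psi>])
  obtain B where B: "\<And>x. x \<in> Y \<Longrightarrow> \<bar>?s x\<bar> \<le> B" using continuous_bounded_compact[OF compact_Y sc] by blast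
  define h where "h = e / 2"
  have h: "0 < h" using e by (simp add: h_def)
  obtain N where N: "2 * B / h < real N" using reals_Archimedean2 by blast
  define t where "t x = (?s x + B) / h" for x
  have tc: "continuous_on Y t" unfolding t_def using h by (intro continuous_intros sc) auto
  have t: "0 \<le> t x" "t x \<le> real N" if "x \<in> Y" for x
  proof -
    show "0 \<le> t x" unfolding t_def using B[OF that] h by (auto simp: abs_le_iff)
    have "t x \<le> 2 * B / h" unfolding t_def using B[OF that] h by (intro divide_right_mono) auto
    then show "t x \<le> real N" using N by simp
  qed
  define g where "g j x = (if x \<in> Y then hat j (t x) else 0)" for j x
  have gc: "continuous_on Y (g j)" for j
    using continuous_hat[OF tc, of j] unfolding g_def by (simp cong: continuous_on_cong)
  have g1: "(\<Sum>j<Suc N. g j x) = 1" if "x \<in> Y" for x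
    using sum_hat[OF t[OF that]] that by (simp add: g_def)
  have g0: "0 \<le> g j x" for j x by (simp add: g_def hat_nonneg)
  define s where "s j = real j * h - B" for j
  have near: "\<bar>?s x - s j\<bar> \<le> h" if "x \<in> Y" "g j x \<noteq> 0" for x j
  proof -
    have "\<bar>t x - real j\<bar> \<le> 1" using that by (intro hat_support) (simp add: g_def)
    then have "\<bar>t x - real j\<bar> * h \<le> 1 * h" using h by (intro mult_right_mono) auto
    moreover have "\<bar>t x - real j\<bar> * h = \<bar>(t x - real j) * h\<bar>" using h by (simp add: abs_mult)
    moreover have "(t x - real j) * h = ?s x - s j" using h by (simp add: t_def s_def field_simps)
    ultimately show ?thesis by simp
  qed
  define x where "x j = m (g j)" for j
  define y where "y j = m ((T ^^ n) (g j))" for j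
  let ?A = "\<Sum>j<Suc N. (s j - h) * x j" and ?R = "\<Sum>j<Suc N. rel_log (x j) (y j)"
  have x: "0 \<le> x j" "0 \<le> y j" for j
    unfolding x_def y_def by (auto intro!: m_nonneg gc g0 Tn_cont Tn_nonneg)
  have "(\<Sum>j<Suc N. x j) = m (\<lambda>x. \<Sum>j<Suc N. g j x)"
    unfolding x_def by (subst m_sum) (auto simp: gc)
  also have "\<dots> = m (\<lambda>_. 1)"
    using g1 by (intro m_cong continuous_on_sum gc) auto
  finally have x1: "(\<Sum>j<Suc N. x j) = 1" by (simp add: m_one)
  have "(\<Sum>j<Suc N. exp (s j - h) * y j) \<le> max_growth \<psi> n"
  proof -
    have egc: "continuous_on Y (\<lambda>x. exp (?s x) * g j x)" for j
      by (intro continuous_on_mult continuous_exp_birkhoff \<psi> gc)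
    have "exp (s j - h) * y j \<le> m ((T ^^ n) (\<lambda>x. exp (?s x) * g j x))" for j
    proof -
      have "exp (s j - h) * y j = m ((T ^^ n) (\<lambda>x. exp (s j - h) * g j x))"
        unfolding y_def by (simp add: Tn_scale m_scale gc Tn_cont)
      also have "\<dots> \<le> m ((T ^^ n) (\<lambda>x. exp (?s x) * g j x))"
      proof (intro m_mono Tn_mono Tn_cont egc continuous_on_mult continuous_on_const gc)
        fix z assume z: "z \<in> Y"
        show "exp (s j - h) * g j z \<le> exp (?s z) * g j z"
        proof (cases "g j z = 0")
          case False
          then have "s j - h \<le> ?s z" using near[OF z False] by (simp add: abs_le_iff)
          then show ?thesis by (intro mult_right_mono g0) auto
        qed simp
      qed auto
      finally show ?thesis .
    qed
    then have "(\<Sum>j<Suc N. exp (s j - h) * y j) \<le> (\<Sum>j<Suc N. m ((T ^^ n) (\<lambda>x. exp (?s x) * g j x)))"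
      by (rule sum_mono)
    also have "\<dots> = m ((T ^^ n) (\<lambda>x. \<Sum>j<Suc N. exp (?s x) * g j x))"
      by (subst Tn_sum, simp, rule egc, subst m_sum) (auto intro: Tn_cont egc)
    also have "\<dots> = m (growth \<psi> n)"
      unfolding growth_def
      using g1 by (intro m_cong Tn_cong Tn_cont continuous_on_sum egc) (auto simp flip: sum_distrib_left simp del: sum.lessThan_Suc)
    also have "\<dots> \<le> m (\<lambda>_. max_growth \<psi> n)"
      by (intro m_mono continuous_growth \<psi> continuous_on_const growth_le_max)
    finally show ?thesis by (simp add: m_const)
  qed
  then have J: "ereal ?A + ?R \<le> eln (max_growth \<psi> n)"
    using x x1 by (intro sum_rel_log_le) auto
  have "real n * m \<psi> = m ?s" by (simp add: m_birkhoff \<psi>)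
  also have "\<dots> = m (\<lambda>x. \<Sum>j<Suc N. ?s x * g j x)"
    using g1 by (intro m_cong sc) (auto simp flip: sum_distrib_left simp del: sum.lessThan_Suc)
  also have "\<dots> = (\<Sum>j<Suc N. m (\<lambda>x. ?s x * g j x))"
    by (rule m_sum) (auto intro!: continuous_on_mult sc gc)
  also have "\<dots> \<le> (\<Sum>j<Suc N. (s j + h) * x j)"
  proof (rule sum_mono)
    fix j
    have "m (\<lambda>x. ?s x * g j x) \<le> m (\<lambda>x. (s j + h) * g j x)"
    proof (intro m_mono continuous_on_mult sc gc continuous_on_const)
      fix z assume z: "z \<in> Y"
      show "?s z * g j z \<le> (s j + h) * g j z"
      proof (cases "g j z = 0")
        case False
        then have "?s z \<le> s j + h" using near[OF z False] by (simp add: abs_le_iff)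
        then show ?thesis by (intro mult_right_mono g0) auto
      qed simp
    qed
    then show "m (\<lambda>x. ?s x * g j x) \<le> (s j + h) * x j" by (simp add: m_scale gc x_def)
  qed
  also have "\<dots> = (\<Sum>j<Suc N. (s j - h) * x j + e * x j)"
    by (intro sum.cong) (auto simp: h_def algebra_simps simp flip: distrib_left)
  also have "\<dots> = ?A + e"
    using x1 by (simp only: sum.distrib sum_distrib_left[symmetric] mult_1_right)
  finally have "ereal (real n * m \<psi>) + ?R \<le> (ereal ?A + ereal e) + ?R" by (intro add_right_mono) simp
  also have "\<dots> = (ereal ?A + ?R) + ereal e" by (simp only: ac_simps)
  also have "\<dots> \<le> eln (max_growth \<psi> n) + ereal e" by (rule add_right_mono[OF J])
  finally have fam: "ereal (real n * m \<psi>) + ?R \<le> eln (max_growth \<psi> n) + ereal e" .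
  have "\<exists>G\<in>unity_sets. (\<Sum>g\<in>G. rel_log (m g) (m ((T ^^ n) g))) = ?R"
    unfolding x_def y_def by (rule unity_family_to_set) (use gc g0 g1 in \<open>auto simp: g_def simp del: sum.lessThan_Suc\<close>)
  then show ?thesis using fam by metis
qed

lemma state_entropy_le_pot:
  assumes \<psi>: "continuous_on Y \<psi>"
  shows "ereal (m \<psi>) + state_entropy m \<le> pot \<psi>"
  unfolding pot_def
proof (rule INF_greatest)
  fix n :: nat assume "n \<in> {n. 1 \<le> n}"
  then have n: "1 \<le> n" by simp
  let ?t = "INF G\<in>unity_sets. \<Sum>g\<in>G. rel_log (m g) (m ((T ^^ n) g))"
  have t: "ereal (real n * m \<psi>) + ?t \<le> eln (max_growth \<psi> n)"
  proof (rule ereal_le_epsilon2)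
    fix e :: real assume "0 < e"
    then obtain G where G: "G \<in> unity_sets" "ereal (real n * m \<psi>) + (\<Sum>g\<in>G. rel_log (m g) (m ((T ^^ n) g)))
        \<le> eln (max_growth \<psi> n) + ereal e"
      using exists_fine_unity_family[OF \<psi> n] by blast
    have "?t \<le> (\<Sum>g\<in>G. rel_log (m g) (m ((T ^^ n) g)))" using G(1) by (rule INF_lower)
    then show "ereal (real n * m \<psi>) + ?t \<le> eln (max_growth \<psi> n) + ereal e"
      using G(2) by (meson add_left_mono order_trans)
  qed
  have "state_entropy m \<le> ereal (1 / real n) * ?t"
    unfolding state_entropy_def using n by (intro INF_lower) auto
  then have "ereal (m \<psi>) + state_entropy m \<le> ereal (m \<psi>) + ereal (1 / real n) * ?t"
    by (rule add_left_mono)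
  also have "\<dots> \<le> eln (max_growth \<psi> n) / ereal (real n)"
  proof (cases ?t)
    case (real r)
    then have a: "0 < max_growth \<psi> n" "real n * m \<psi> + r \<le> ln (max_growth \<psi> n)"
      using t by (auto simp: eln_def split: if_splits)
    have "m \<psi> + r / real n = (real n * m \<psi> + r) / real n" using n by (simp add: field_simps)
    also have "\<dots> \<le> ln (max_growth \<psi> n) / real n" using a(2) by (intro divide_right_mono) auto
    finally show ?thesis using real a(1) n by (simp add: eln_def)
  next
    case PInf
    then show ?thesis using t by (auto simp: eln_def split: if_splits)
  next
    case MInf
    then show ?thesis using n by simp
  qed
  finally show "ereal (m \<psi>) + state_entropy m \<le> eln (max_growth \<psi> n) / ereal (real n)" .
qed

text \<open>For weights \<open>a\<close>, the potential \<open>\<phi> = \<Sum> a g * g\<close> satisfies \<open>T\<^sup>n e\<^sup>\<phi> \<le> v\<close>, and dividing by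
  \<open>v \<circ> \<alpha>\<^sup>n\<close> yields a potential of spectral radius at most \<open>1\<close>, to which the subgradient inequality
  is applied.\<close>

lemma subgradient_le_family:
  assumes \<psi>: "continuous_on Y \<psi>" and n: "1 \<le> n"
    and sub: "\<And>\<phi> c. continuous_on Y \<phi> \<Longrightarrow> pot \<phi> \<le> ereal c \<Longrightarrow> l + (m \<phi> - m \<psi>) \<le> c"
    and I: "finite I" and g: "\<And>i. i \<in> I \<Longrightarrow> continuous_on Y (g i)"
    "\<And>i x. i \<in> I \<Longrightarrow> x \<in> Y \<Longrightarrow> 0 \<le> g i x" "\<And>x. x \<in> Y \<Longrightarrow> (\<Sum>i\<in>I. g i x) = 1"
    and \<delta>: "0 < \<delta>"
  shows "real n * (l - m \<psi>) \<le> - (\<Sum>i\<in>I. a i * m (g i)) + ln ((\<Sum>i\<in>I. exp (a i) * m ((T ^^ n) (g i))) + \<delta>)"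
proof -
  define \<phi> where "\<phi> x = (\<Sum>i\<in>I. a i * g i x)" for x
  \<comment> \<open>The summand \<delta> bounds \<open>v\<close> away from 0, so \<open>ln v\<close>
    is continuous even where all \<open>(T ^^ n) (g i)\<close> vanish.\<close>
  define v where "v x = (\<Sum>i\<in>I. exp (a i) * (T ^^ n) (g i) x) + \<delta>" for x
  have \<phi>c: "continuous_on Y \<phi>" unfolding \<phi>_def by (intro continuous_intros g)
  have vc: "continuous_on Y v" unfolding v_def by (intro continuous_intros Tn_cont g)
  have v\<delta>: "\<delta> \<le> v x" if "x \<in> Y" for x
    unfolding v_def using g that by (auto intro!: sum_nonneg mult_nonneg_nonneg Tn_nonneg)
  then have vpos: "0 < v x" if "x \<in> Y" for x using \<delta> that by (meson less_le_trans)
  have lnvc: "continuous_on Y (\<lambda>x. ln (v x))" by (intro continuous_on_ln vc) (use vpos in force)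
  define \<phi>' where "\<phi>' x = \<phi> x + (-1) * ln (v ((\<alpha> ^^ n) x))" for x
  have \<phi>'c: "continuous_on Y \<phi>'"
    unfolding \<phi>'_def by (intro continuous_intros \<phi>c continuous_on_comp_funpow[OF lnvc])
  have ne: "I \<noteq> {}" using g(3) Y_ne by force
  have Tphi: "(T ^^ n) (\<lambda>x. exp (\<phi> x)) x \<le> v x" if x: "x \<in> Y" for x
  proof -
    have "(T ^^ n) (\<lambda>x. exp (\<phi> x)) x \<le> (T ^^ n) (\<lambda>x. \<Sum>i\<in>I. exp (a i) * g i x) x"
    proof (intro Tn_mono x continuous_on_exp \<phi>c continuous_on_sum continuous_on_mult continuous_on_const g)
      fix z assume z: "z \<in> Y"
      have "exp (\<Sum>i\<in>I. g i z *\<^sub>R a i) \<le> (\<Sum>i\<in>I. g i z * exp (a i))"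
        using g z I ne by (intro convex_on_sum[OF _ _ exp_convex]) auto
      then show "exp (\<phi> z) \<le> (\<Sum>i\<in>I. exp (a i) * g i z)" by (simp add: \<phi>_def mult.commute)
    qed
    also have "\<dots> = (\<Sum>i\<in>I. exp (a i) * (T ^^ n) (g i) x)"
      by (subst Tn_sum) (auto intro!: sum.cong continuous_intros I g simp: Tn_scale g)
    also have "\<dots> \<le> v x" using \<delta> by (simp add: v_def)
    finally show ?thesis .
  qed
  have "(T ^^ n) (\<lambda>x. exp (\<phi>' x)) x \<le> 1" if x: "x \<in> Y" for x
  proof -
    have "(T ^^ n) (\<lambda>x. exp (\<phi>' x)) x = (T ^^ n) (\<lambda>x. inverse (v ((\<alpha> ^^ n) x)) * exp (\<phi> x)) x"
      using vpos funpow_Y by (intro Tn_cong x) (auto simp: \<phi>'_def exp_diff divide_inverse)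
    also have "\<dots> = inverse (v x) * (T ^^ n) (\<lambda>x. exp (\<phi> x)) x"
      by (subst Tn_hom) (use vpos in \<open>auto intro!: continuous_on_inverse vc continuous_on_exp \<phi>c, force\<close>)
    also have "\<dots> \<le> inverse (v x) * v x"
      using Tphi[OF x] vpos[OF x] by (intro mult_left_mono) auto
    finally show ?thesis using vpos[OF x] by simp
  qed
  then have "pot (\<lambda>x. \<phi>' x / real n) \<le> ereal 0"
    using pot_le_zero_of_power[OF \<phi>'c n] by (simp add: zero_ereal_def)
  then have "l + (m (\<lambda>x. \<phi>' x / real n) - m \<psi>) \<le> 0"
    using n by (intro sub continuous_on_divide \<phi>'c) auto
  moreover have "m (\<lambda>x. \<phi>' x / real n) = m \<phi>' / real n"
    using m_scale[OF \<phi>'c, of "1 / real n"] by simp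
  ultimately have "real n * (l - m \<psi>) \<le> - m \<phi>'" using n by (simp add: field_simps)
  also have "m \<phi>' = m \<phi> - m (\<lambda>x. ln (v x))"
    unfolding \<phi>'_def
    using continuous_on_comp_funpow[OF lnvc, of n] m_inv_funpow[OF lnvc, of n]
    by (subst m_add) (auto intro!: continuous_intros \<phi>c simp only: m_scale)
  also have "m \<phi> = (\<Sum>i\<in>I. a i * m (g i))"
    unfolding \<phi>_def by (subst m_sum) (auto intro!: sum.cong continuous_intros I g simp: m_scale g)
  finally have 1: "real n * (l - m \<psi>) \<le> - (\<Sum>i\<in>I. a i * m (g i)) + m (\<lambda>x. ln (v x))" by simp
  let ?z = "m v"
  have "\<delta> \<le> ?z" using m_mono[of "\<lambda>_. \<delta>" v] vc v\<delta> by (simp add: m_const)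
  then have z: "0 < ?z" using \<delta> by simp
  \<comment> \<open>Jensen's inequality \<open>m (ln v) \<le> ln (m v)\<close>, through the tangent
    of the logarithm at \<open>m v\<close>.\<close>
  have "m (\<lambda>x. ln (v x)) \<le> m (\<lambda>x. (1 / ?z) * v x + (ln ?z - 1))"
  proof (intro m_mono lnvc continuous_intros vc)
    fix x assume "x \<in> Y"
    then have "ln (v x / ?z) \<le> v x / ?z - 1" using vpos z by (intro ln_le_minus_one) auto
    then show "ln (v x) \<le> (1 / ?z) * v x + (ln ?z - 1)" using vpos[OF \<open>x \<in> Y\<close>] z by (simp add: ln_div)
  qed
  also have "\<dots> = (1 / ?z) * ?z + (ln ?z - 1)"
    by (subst m_add) (auto intro!: continuous_intros vc simp only: m_scale[OF vc] m_const)
  also have "\<dots> = ln ?z" using z by simp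
  also have "?z = m (\<lambda>x. \<Sum>i\<in>I. exp (a i) * (T ^^ n) (g i) x) + \<delta>"
    unfolding v_def by (subst m_add) (auto intro!: continuous_intros Tn_cont g simp: m_const)
  also have "m (\<lambda>x. \<Sum>i\<in>I. exp (a i) * (T ^^ n) (g i) x) = (\<Sum>i\<in>I. exp (a i) * m ((T ^^ n) (g i)))"
    by (subst m_sum) (auto intro!: continuous_intros Tn_cont g sum.cong simp: I m_scale Tn_cont g)
  finally show ?thesis using 1 by simp
qed

lemma subgradient_le_entropy:
  assumes \<psi>: "continuous_on Y \<psi>"
    and sub: "\<And>\<phi> c. continuous_on Y \<phi> \<Longrightarrow> pot \<phi> \<le> ereal c \<Longrightarrow> l + (m \<phi> - m \<psi>) \<le> c"
  shows "ereal l \<le> ereal (m \<psi>) + state_entropy m"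
proof -
  have "ereal (l - m \<psi>) \<le> state_entropy m"
    unfolding state_entropy_def
  proof (rule INF_greatest)
    fix n :: nat assume "n \<in> {n. 1 \<le> n}"
    then have n: "1 \<le> n" by simp
    have "ereal (real n * (l - m \<psi>)) \<le> (INF G\<in>unity_sets. \<Sum>g\<in>G. rel_log (m g) (m ((T ^^ n) g)))"
    proof (rule INF_greatest)
      fix G assume G: "G \<in> unity_sets"
      then have Gp: "finite G" "\<And>g. g \<in> G \<Longrightarrow> continuous_on Y g" "\<And>g x. g \<in> G \<Longrightarrow> 0 \<le> g x"
          "\<And>x. x \<in> Y \<Longrightarrow> (\<Sum>g\<in>G. g x) = 1"
        by (auto simp: unity_sets_def)
      have "(\<Sum>g\<in>G. m g) = m (\<lambda>x. \<Sum>g\<in>G. g x)" using Gp by (subst m_sum) auto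
      also have "\<dots> = m (\<lambda>_. 1)" using Gp by (intro m_cong continuous_on_sum) auto
      finally have "(\<Sum>g\<in>G. m g) = 1" by (simp add: m_one)
      then show "ereal (real n * (l - m \<psi>)) \<le> (\<Sum>g\<in>G. rel_log (m g) (m ((T ^^ n) g)))"
        using Gp
        by (intro le_sum_rel_log subgradient_le_family[OF \<psi> n sub, of G "\<lambda>g. g"])
          (auto intro!: m_nonneg Tn_cont Tn_nonneg)
    qed
    then have "ereal (1 / real n) * ereal (real n * (l - m \<psi>))
        \<le> ereal (1 / real n) * (INF G\<in>unity_sets. \<Sum>g\<in>G. rel_log (m g) (m ((T ^^ n) g)))"
      by (rule ereal_mult_left_mono) auto
    then show "ereal (l - m \<psi>) \<le> ereal (1 / real n) * (INF G\<in>unity_sets. \<Sum>g\<in>G. rel_log (m g) (m ((T ^^ n) g)))"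
      using n by simp
  qed
  then have "ereal (m \<psi>) + ereal (l - m \<psi>) \<le> ereal (m \<psi>) + state_entropy m" by (rule add_left_mono)
  then show ?thesis by simp
qed

end

theorem state_variational_principle:
  assumes \<psi>: "continuous_on Y \<psi>"
  obtains m where "invariant_state \<alpha> Y m" "ereal (m \<psi>) + state_entropy m = pot \<psi>"
proof (cases "pot \<psi>")
  case (real l)
  then obtain m where "invariant_state \<alpha> Y m"
      "\<And>\<phi> c. continuous_on Y \<phi> \<Longrightarrow> pot \<phi> \<le> ereal c \<Longrightarrow> l + (m \<phi> - m \<psi>) \<le> c"
    using pot_subgradient[OF \<psi> real] by blast
  then show thesis
    using state_entropy_le_pot[OF _ \<psi>] subgradient_le_entropy[OF _ \<psi>] real
    by (intro that[of m] antisym) auto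
next
  case PInf
  then show thesis using pot_less_top[of \<psi>] by simp
next
  \<comment> \<open>No subgradient is available, but the inequality forces the value
    \<open>-\<infinity>\<close> for whichever invariant state is taken.\<close>
  case MInf
  obtain m where "invariant_state \<alpha> Y m"
    using exists_invariant_state[OF compact_Y Y_ne cont_\<alpha> \<alpha>_Y] by blast
  then show thesis using state_entropy_le_pot[OF _ \<psi>, of m] MInf by (intro that[of m]) auto
qed

end

section \<open>Transfer operators and their kernels\<close>

lemma set_integrable_continuous_closed:
  fixes f :: "'a::t2_space \<Rightarrow> 'b::{banach, second_countable_topology}"
  assumes comp: "compact (UNIV :: 'a set)" and M: "sets M = sets borel" "finite_measure M"
    and Y: "closed Y" and f: "continuous_on Y f"
  shows "set_integrable M Y f"
proof -
  interpret finite_measure M by fact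
  have "compact Y" using comp Y closed_Int_compact[of Y UNIV] by simp
  then have "bounded (f ` Y)" using f by (intro compact_imp_bounded compact_continuous_image)
  then obtain B where B: "0 < B" "\<And>x. x \<in> Y \<Longrightarrow> norm (f x) \<le> B" by (auto simp: bounded_pos)
  have "(\<lambda>x. indicator Y x *\<^sub>R f x) \<in> borel_measurable M"
    using borel_measurable_continuous_on_indicator[OF _ f] Y M(1) by (auto cong: measurable_cong_sets)
  then show ?thesis
    unfolding set_integrable_def
    using B by (intro integrable_const_bound[of _ B]) (auto simp: indicator_def)
qed

lemma set_integral_vanishing:
  fixes f :: "'a \<Rightarrow> 'b::{banach, second_countable_topology}"
  shows "(\<And>x. x \<notin> Y \<Longrightarrow> f x = 0) \<Longrightarrow> set_lebesgue_integral M Y f = (\<integral>x. f x \<partial>M)"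
  unfolding set_lebesgue_integral_def by (intro Bochner_Integration.integral_cong) (auto simp: indicator_def)

lemma set_integral_cong_on:
  "(\<And>x. x \<in> Y \<Longrightarrow> f x = g x) \<Longrightarrow> set_lebesgue_integral M Y f = set_lebesgue_integral M Y g"
  unfolding set_lebesgue_integral_def by (intro Bochner_Integration.integral_cong) (auto simp: indicator_def)

lemma emeasure_open_zero_regular:
  fixes M :: "'a::t2_space measure"
  assumes M: "regular_borel_measure M" and U: "open U" and K: "\<And>K. compact K \<Longrightarrow> K \<subseteq> U \<Longrightarrow> emeasure M K = 0"
  shows "emeasure M U = 0"
  using regular_borel_measure_inner[OF M, of U] U K by (auto simp: SUP_eq_iff intro!: antisym SUP_least)

section \<open>Kernel measures of a transfer operator\<close>

locale transfer_setting =
  fixes \<alpha> :: "'a::t2_space \<Rightarrow> 'a" and A :: "('a \<Rightarrow> complex) \<Rightarrow> 'a \<Rightarrow> complex"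
  assumes compact_UNIV: "compact (UNIV :: 'a set)"
    and continuous_\<alpha>: "continuous_on UNIV \<alpha>"
    and transfer: "transfer_operator \<alpha> A"
begin

abbreviation \<nu> :: "'a \<Rightarrow> 'a measure" where "\<nu> \<equiv> kernel_measure A"

lemma A_cfun: "f \<in> cfun UNIV \<Longrightarrow> A f \<in> cfun UNIV"
  and A_add: "f \<in> cfun UNIV \<Longrightarrow> g \<in> cfun UNIV \<Longrightarrow> A (\<lambda>x. f x + g x) = (\<lambda>x. A f x + A g x)"
  and A_scale: "f \<in> cfun UNIV \<Longrightarrow> A (\<lambda>x. c * f x) = (\<lambda>x. c * A f x)"
  and A_nonneg: "f \<in> cfun UNIV \<Longrightarrow> (\<And>x. f x \<in> \<real>\<^sub>\<ge>\<^sub>0) \<Longrightarrow> A f x \<in> \<real>\<^sub>\<ge>\<^sub>0"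
  and A_hom: "f \<in> cfun UNIV \<Longrightarrow> g \<in> cfun UNIV \<Longrightarrow> A (\<lambda>x. f (\<alpha> x) * g x) = (\<lambda>x. f x * A g x)"
  using transfer unfolding transfer_operator_def by blast+

lemma of_real_cfun: "continuous_on UNIV f \<Longrightarrow> (\<lambda>x. complex_of_real (f x)) \<in> cfun UNIV"
  by (simp add: cfun_def continuous_on_of_real)

text \<open>For a bound \<open>B\<close> of \<open>f\<close> both \<open>f + B\<close> and
  \<open>B\<close> are nonnegative, so their images have no imaginary part; subtracting removes it
  for \<open>f\<close>.\<close>

lemma A_of_real:
  assumes f: "continuous_on UNIV f"
  shows "A (\<lambda>y. complex_of_real (f y)) x = complex_of_real (Re (A (\<lambda>y. complex_of_real (f y)) x))"
proof -
  obtain B where B: "\<And>x. \<bar>f x\<bar> \<le> B" using continuous_bounded_compact[OF compact_UNIV f] by auto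
  have "0 \<le> f y + B" "0 \<le> B" for y using B[of y] by linarith+
  then have 1: "A (\<lambda>y. complex_of_real (f y + B)) x \<in> \<real>\<^sub>\<ge>\<^sub>0" and 2: "A (\<lambda>y. complex_of_real B) x \<in> \<real>\<^sub>\<ge>\<^sub>0"
    by (auto intro!: A_nonneg of_real_cfun continuous_intros f simp del: of_real_add)
  have "A (\<lambda>y. complex_of_real (f y + B)) x = A (\<lambda>y. complex_of_real (f y)) x + A (\<lambda>y. complex_of_real B) x"
    using A_add[OF of_real_cfun[OF f] of_real_cfun[of "\<lambda>_. B"]] by simp
  then have "Im (A (\<lambda>y. complex_of_real (f y)) x) = 0"
    using 1 2 by (auto simp: complex_nonneg_Reals_iff)
  then show ?thesis by (simp add: complex_eq_iff)
qed

lemma positive_functional_A: "positive_functional (\<lambda>f. Re (A (\<lambda>y. complex_of_real (f y)) x))"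
proof
  fix f g :: "'a \<Rightarrow> real" and c assume f: "continuous_on UNIV f"
  show "Re (A (\<lambda>y. complex_of_real (f y + g y)) x)
      = Re (A (\<lambda>y. complex_of_real (f y)) x) + Re (A (\<lambda>y. complex_of_real (g y)) x)"
    if g: "continuous_on UNIV g"
    using A_add[OF of_real_cfun[OF f] of_real_cfun[OF g]] by simp
  show "Re (A (\<lambda>y. complex_of_real (c * f y)) x) = c * Re (A (\<lambda>y. complex_of_real (f y)) x)"
    using A_scale[OF of_real_cfun[OF f], of "complex_of_real c"] by simp
  show "0 \<le> Re (A (\<lambda>y. complex_of_real (f y)) x)" if "\<And>x. 0 \<le> f x"
    using A_nonneg[OF of_real_cfun[OF f], of x] that by (simp add: complex_nonneg_Reals_iff)
qed (rule compact_UNIV)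

lemma kernel_exists:
  "\<exists>\<nu>. regular_borel_measure \<nu> \<and> (\<forall>f\<in>cfun UNIV. (\<integral>z. f z \<partial>\<nu>) = A f x)"
proof -
  interpret L: positive_functional "\<lambda>f. Re (A (\<lambda>y. complex_of_real (f y)) x)"
    by (rule positive_functional_A)
  let ?M = "L.riesz_measure"
  have int: "(\<integral>z. complex_of_real (f z) \<partial>?M) = A (\<lambda>y. complex_of_real (f y)) x" if f: "continuous_on UNIV f" for f
    using L.integral_riesz_measure[OF f] A_of_real[OF f, of x] by simp
  have "(\<integral>z. f z \<partial>?M) = A f x" if f: "f \<in> cfun UNIV" for f
  proof -
    have c: "continuous_on UNIV (\<lambda>z. Re (f z))" "continuous_on UNIV (\<lambda>z. Im (f z))"
      using f by (auto simp: cfun_def intro: continuous_intros)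
    have ic: "integrable ?M g" if "continuous_on UNIV g" for g :: "'a \<Rightarrow> complex"
      using that by (intro integrable_continuous_compact compact_UNIV L.finite_riesz_measure) auto
    have feq: "f = (\<lambda>z. complex_of_real (Re (f z)) + \<i> * complex_of_real (Im (f z)))"
      by (auto simp: complex_eq[symmetric])
    have i: "(\<lambda>z. \<i> * complex_of_real (Im (f z))) \<in> cfun UNIV"
      using of_real_cfun[OF c(2)] by (auto simp: cfun_def intro: continuous_intros)
    have "(\<integral>z. f z \<partial>?M) = (\<integral>z. complex_of_real (Re (f z)) \<partial>?M) + (\<integral>z. \<i> * complex_of_real (Im (f z)) \<partial>?M)"
      by (subst feq, rule Bochner_Integration.integral_add)
        (use c in \<open>auto intro!: ic continuous_intros continuous_on_of_real\<close>)
    also have "\<dots> = A (\<lambda>z. complex_of_real (Re (f z))) x + \<i> * A (\<lambda>z. complex_of_real (Im (f z))) x"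
      using int[OF c(1)] int[OF c(2)] by simp
    also have "\<dots> = A (\<lambda>z. complex_of_real (Re (f z)) + \<i> * complex_of_real (Im (f z))) x"
      using A_add[OF of_real_cfun[OF c(1)] i] A_scale[OF of_real_cfun[OF c(2)], of \<i>] by simp
    finally show ?thesis using feq by simp
  qed
  then show ?thesis using L.regular_riesz_measure by blast
qed

lemma integral_of_real_eqD:
  assumes "regular_borel_measure M" "\<forall>f\<in>cfun UNIV. (\<integral>z. f z \<partial>M) = A f x" "continuous_on UNIV f"
  shows "(\<integral>z. f z \<partial>M) = Re (A (\<lambda>y. complex_of_real (f y)) x)"
proof -
  have "complex_of_real (\<integral>z. f z \<partial>M) = A (\<lambda>y. complex_of_real (f y)) x"
    using assms(2)[rule_format, OF of_real_cfun[OF assms(3)]] by simp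
  then show ?thesis by (metis Re_complex_of_real)
qed

text \<open>The definite description in \<open>kernel_measure\<close> is justified by Riesz for
  existence and by regularity for uniqueness.\<close>

lemma kernel_measure:
  "regular_borel_measure (\<nu> x)" "f \<in> cfun UNIV \<Longrightarrow> (\<integral>z. f z \<partial>\<nu> x) = A f x"
proof -
  have "\<exists>!\<nu>. regular_borel_measure \<nu> \<and> (\<forall>f\<in>cfun UNIV. (\<integral>z. f z \<partial>\<nu>) = A f x)"
  proof (rule ex_ex1I[OF kernel_exists])
    fix M N assume "regular_borel_measure M \<and> (\<forall>f\<in>cfun UNIV. (\<integral>z. f z \<partial>M) = A f x)"
      "regular_borel_measure N \<and> (\<forall>f\<in>cfun UNIV. (\<integral>z. f z \<partial>N) = A f x)"
    then show "M = N"
      using integral_of_real_eqD[of M x] integral_of_real_eqD[of N x]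
      by (intro regular_borel_measure_eqI[OF compact_UNIV]) auto
  qed
  from theI'[OF this] show "regular_borel_measure (\<nu> x)" "f \<in> cfun UNIV \<Longrightarrow> (\<integral>z. f z \<partial>\<nu> x) = A f x"
    unfolding kernel_measure_def by blast+
qed

lemmas kernel_simps [simp] = regular_borel_measure_simps[OF kernel_measure(1)]

lemma A_of_real_integral:
  "continuous_on UNIV f \<Longrightarrow> A (\<lambda>y. complex_of_real (f y)) x = complex_of_real (\<integral>z. f z \<partial>\<nu> x)"
  using kernel_measure(2)[OF of_real_cfun, of f x] by simp

text \<open>Testing \<open>A\<close> on \<open>u \<circ> \<alpha>\<close> with
  \<open>u x = 0\<close> gives \<open>u x * A 1 x = 0\<close> by the homological identity, so
  compact sets missing the fibre over \<open>x\<close> are null; inner regularity extends this to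
  the whole complement.\<close>

lemma AE_kernel: "AE z in \<nu> x. \<alpha> z = x"
proof -
  let ?U = "- \<alpha> -` {x}"
  have U: "open ?U" using continuous_\<alpha> by (intro open_Compl closed_vimage) auto
  have "emeasure (\<nu> x) ?U = 0"
  proof (rule emeasure_open_zero_regular[OF kernel_measure(1) U])
    fix K assume K: "compact K" "K \<subseteq> ?U"
    have "compact (\<alpha> ` K)" using K(1) continuous_\<alpha> by (auto intro: compact_continuous_image continuous_on_subset)
    then have "closed (\<alpha> ` K)" "closed {x}" "\<alpha> ` K \<inter> {x} = {}" using K(2) by (auto simp: compact_imp_closed)
    then obtain u :: "'a \<Rightarrow> real" where u: "continuous_on UNIV u" "\<And>z. 0 \<le> u z" "\<And>z. u z \<le> 1"
      "\<And>z. z \<in> \<alpha> ` K \<Longrightarrow> u z = 1" "\<And>z. z \<in> {x} \<Longrightarrow> u z = 0"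
      by (rule Urysohn_function[OF compact_UNIV]) blast
    have c: "continuous_on UNIV (\<lambda>z. u (\<alpha> z))" using continuous_on_compose2[OF u(1) continuous_\<alpha>] by simp
    have "complex_of_real (\<integral>z. u (\<alpha> z) \<partial>\<nu> x) = A (\<lambda>z. complex_of_real (u (\<alpha> z)) * 1) x"
      using A_of_real_integral[OF c] by simp
    also have "\<dots> = 0"
      using A_hom[OF of_real_cfun[OF u(1)] of_real_cfun[of "\<lambda>_. 1"]] u(5) by simp
    finally have "(\<integral>z. u (\<alpha> z) \<partial>\<nu> x) = 0" by simp
    moreover have "emeasure (\<nu> x) K \<le> ennreal (\<integral>z. u (\<alpha> z) \<partial>\<nu> x)"
      using u c K(1) by (intro emeasure_closed_le_integral[OF compact_UNIV]) (auto simp: compact_imp_closed)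
    ultimately show "emeasure (\<nu> x) K = 0" by simp
  qed
  then show ?thesis using U by (intro AE_I[of _ _ ?U]) auto
qed

definition real_trace :: "'a set \<Rightarrow> ('a \<Rightarrow> real) \<Rightarrow> 'a \<Rightarrow> real" where
  "real_trace Y f x = (if x \<in> Y then set_lebesgue_integral (\<nu> x) Y f else 0)"

lemma trace_operator_of_real:
  "trace_operator A Y (\<lambda>x. complex_of_real (f x)) = (\<lambda>x. complex_of_real (real_trace Y f x))"
  by (auto simp: trace_operator_def real_trace_def set_integral_complex_of_real)

lemma trace_operator_cong: "(\<And>x. x \<in> Y \<Longrightarrow> f x = g x) \<Longrightarrow> trace_operator A Y f = trace_operator A Y g"
  unfolding trace_operator_def using set_integral_cong_on[of Y f g] by auto

lemma kernel_set_integrable: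
  fixes f :: "'a \<Rightarrow> 'b::{banach, second_countable_topology}"
  shows "closed Y \<Longrightarrow> continuous_on Y f \<Longrightarrow> set_integrable (\<nu> x) Y f"
  by (intro set_integrable_continuous_closed compact_UNIV) auto

lemma trace_operator_UNIV: "f \<in> cfun UNIV \<Longrightarrow> trace_operator A UNIV f = A f"
  by (auto simp: trace_operator_def set_lebesgue_integral_def kernel_measure(2))

lemma compatible_UNIV: "compatible A UNIV"
  unfolding compatible_def
proof
  fix f :: "'a \<Rightarrow> complex" assume f: "f \<in> cfun UNIV"
  then have eq: "(\<lambda>x. set_lebesgue_integral (\<nu> x) UNIV f) = A f"
    by (auto simp: set_lebesgue_integral_def kernel_measure(2))
  show "continuous_on UNIV (\<lambda>x. set_lebesgue_integral (\<nu> x) UNIV f)"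
    using A_cfun[OF f] unfolding eq by (simp add: cfun_def)
qed

text \<open>\<open>A\<close> is specified on continuous functions only, so its agreement with the
  trace on \<open>UNIV\<close> is carried through the iterates together with membership in
  \<open>cfun UNIV\<close>.\<close>

lemma spectral_potential_UNIV:
  assumes \<psi>: "continuous_on UNIV \<psi>"
  shows "spectral_potential UNIV A \<psi> = spectral_potential UNIV (trace_operator A UNIV) \<psi>"
proof -
  have "(weighted A \<psi> ^^ n) f = (weighted (trace_operator A UNIV) \<psi> ^^ n) f \<and> (weighted A \<psi> ^^ n) f \<in> cfun UNIV"
    if "f \<in> cfun UNIV" for n f
  proof (induction n)
    case (Suc n)
    have "(\<lambda>x. complex_of_real (exp (\<psi> x)) * (weighted A \<psi> ^^ n) f x) \<in> cfun UNIV"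
      using Suc \<psi> by (auto simp: cfun_def intro!: continuous_intros)
    then show ?case using Suc A_cfun by (simp add: weighted_def trace_operator_UNIV)
  qed (use that in auto)
  then have "op_norm UNIV (weighted A \<psi> ^^ n) = op_norm UNIV (weighted (trace_operator A UNIV) \<psi> ^^ n)" for n
    unfolding op_norm_def by (intro SUP_cong) auto
  then show ?thesis by (simp add: spectral_potential_def)
qed

end

section \<open>The trace on a compatible set as a real transfer operator\<close>

locale compatible_subset = transfer_setting +
  fixes Y :: "'a set"
  assumes nonempty: "Y \<noteq> {}" and closed_Y: "closed Y" and invariant_Y: "\<alpha> ` Y \<subseteq> Y"
    and compatible_Y: "compatible A Y"

lemma (in transfer_setting) compatible_subset_UNIV: "compatible_subset \<alpha> A UNIV"
  by unfold_locales (auto simp: compatible_UNIV)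

sublocale compatible_subset \<subseteq> transfer_on Y \<alpha> "real_trace Y"
proof
  show "compact Y" using compact_UNIV closed_Y closed_Int_compact[of Y UNIV] by simp
  show "continuous_on Y \<alpha>" using continuous_\<alpha> continuous_on_subset by blast
  fix f :: "'a \<Rightarrow> real"
  show "real_trace Y f = real_trace Y g" if "\<And>x. x \<in> Y \<Longrightarrow> f x = g x" for g
    unfolding real_trace_def[abs_def] using set_integral_cong_on[of Y f g] that by auto
  assume f: "continuous_on Y f"
  note int = kernel_set_integrable[OF closed_Y f]
  show "continuous_on Y (real_trace Y f)"
  proof -
    let ?f = "\<lambda>x. if x \<in> Y then complex_of_real (f x) else 0"
    have "?f \<in> cfun Y" using f by (auto simp: cfun_def continuous_on_of_real cong: continuous_on_cong)
    then have "continuous_on Y (\<lambda>x. Re (set_lebesgue_integral (\<nu> x) Y ?f))"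
      using compatible_Y unfolding compatible_def by (intro continuous_on_Re) blast
    moreover have "Re (set_lebesgue_integral (\<nu> x) Y ?f) = real_trace Y f x" if "x \<in> Y" for x
    proof -
      have "set_lebesgue_integral (\<nu> x) Y ?f = set_lebesgue_integral (\<nu> x) Y (\<lambda>x. complex_of_real (f x))"
        by (intro set_integral_cong_on) auto
      then show ?thesis using that by (simp add: set_integral_complex_of_real real_trace_def)
    qed
    ultimately show ?thesis by (simp cong: continuous_on_cong)
  qed
  show "real_trace Y (\<lambda>x. c * f x) = (\<lambda>x. c * real_trace Y f x)" for c
    by (auto simp: real_trace_def)
  show "0 \<le> real_trace Y f x" if "\<And>x. x \<in> Y \<Longrightarrow> 0 \<le> f x" for x
    using that by (auto simp: real_trace_def set_lebesgue_integral_def indicator_def intro!: Bochner_Integration.integral_nonneg)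
  fix g :: "'a \<Rightarrow> real" assume g: "continuous_on Y g"
  show "real_trace Y (\<lambda>x. f x + g x) = (\<lambda>x. real_trace Y f x + real_trace Y g x)"
    using int kernel_set_integrable[OF closed_Y g] by (auto simp: real_trace_def)
  \<comment> \<open>The identity for \<open>A\<close> does not apply to the cut-off integrand, which
    may be discontinuous. It holds because \<open>\<nu> x\<close> is carried by the fibre over
    \<open>x\<close>, where \<open>f \<circ> \<alpha>\<close> is the constant
    \<open>f x\<close>.\<close>
  show "real_trace Y (\<lambda>x. f (\<alpha> x) * g x) = (\<lambda>x. f x * real_trace Y g x)"
  proof
    fix x
    show "real_trace Y (\<lambda>x. f (\<alpha> x) * g x) x = f x * real_trace Y g x"
    proof (cases "x \<in> Y")
      case True
      have cf: "continuous_on Y (\<lambda>x. f (\<alpha> x))"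
        using continuous_on_subset[OF continuous_\<alpha>] invariant_Y by (intro continuous_on_compose2[OF f]) auto
      have "set_lebesgue_integral (\<nu> x) Y (\<lambda>z. f (\<alpha> z) * g z) = set_lebesgue_integral (\<nu> x) Y (\<lambda>z. f x * g z)"
        unfolding set_lebesgue_integral_def
      proof (rule integral_cong_AE)
        show "AE z in \<nu> x. indicator Y z *\<^sub>R (f (\<alpha> z) * g z) = indicator Y z *\<^sub>R (f x * g z)"
          using AE_kernel[of x] by eventually_elim simp
        show "(\<lambda>z. indicator Y z *\<^sub>R (f (\<alpha> z) * g z)) \<in> borel_measurable (\<nu> x)"
          "(\<lambda>z. indicator Y z *\<^sub>R (f x * g z)) \<in> borel_measurable (\<nu> x)"
          using kernel_set_integrable[OF closed_Y continuous_on_mult[OF cf g], of x]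
            kernel_set_integrable[OF closed_Y continuous_on_mult[OF continuous_on_const g], of x "f x"]
          unfolding set_integrable_def by auto
      qed
      then show ?thesis using True by (simp add: real_trace_def)
    qed (simp add: real_trace_def)
  qed
qed (use nonempty invariant_Y in auto)

section \<open>Operator norms of the weighted trace\<close>

context compatible_subset
begin

lemma growth_Suc:
  assumes "continuous_on Y \<psi>"
  shows "growth \<psi> (Suc n) = real_trace Y (\<lambda>x. exp (\<psi> x) * growth \<psi> n x)"
  using growth_add[OF assms, of 1 n] by (simp add: birkhoff_def)

lemma trace_cfun:
  assumes "f \<in> cfun Y"
  shows "trace_operator A Y f \<in> cfun Y"
proof -
  have "continuous_on Y (trace_operator A Y f)"
    using assms compatible_Y unfolding compatible_def trace_operator_def by (auto cong: continuous_on_cong)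
  then show ?thesis by (auto simp: cfun_def trace_operator_def)
qed

lemma weighted_trace_cfun:
  assumes \<psi>: "continuous_on Y \<psi>" and f: "f \<in> cfun Y"
  shows "(weighted (trace_operator A Y) \<psi> ^^ n) f \<in> cfun Y"
proof (induction n)
  case (Suc n)
  then show ?case
    using \<psi> by (auto simp: weighted_def cfun_def intro!: continuous_intros trace_cfun[unfolded cfun_def, THEN CollectD, THEN conjunct1]
      trace_cfun[unfolded cfun_def, THEN CollectD, THEN conjunct2, rule_format])
qed (simp add: f)

lemma norm_weighted_trace_le:
  assumes \<psi>: "continuous_on Y \<psi>" and f: "f \<in> cfun Y" "\<And>x. x \<in> Y \<Longrightarrow> norm (f x) \<le> 1" and x: "x \<in> Y"
  shows "norm ((weighted (trace_operator A Y) \<psi> ^^ n) f x) \<le> growth \<psi> n x"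
  using x
proof (induction n arbitrary: x)
  case 0
  then show ?case using f(2) by (simp add: growth_def birkhoff_def)
next
  case (Suc n)
  let ?F = "(weighted (trace_operator A Y) \<psi> ^^ n) f"
  have Fc: "continuous_on Y ?F" using weighted_trace_cfun[OF \<psi> f(1)] by (auto simp: cfun_def)
  have ci: "set_integrable (\<nu> x) Y (\<lambda>z. complex_of_real (exp (\<psi> z)) * ?F z)"
    by (intro kernel_set_integrable closed_Y continuous_intros continuous_on_of_real continuous_on_exp \<psi> Fc)
  have ri: "set_integrable (\<nu> x) Y (\<lambda>z. exp (\<psi> z) * growth \<psi> n z)"
    by (intro kernel_set_integrable closed_Y continuous_on_mult continuous_on_exp \<psi> continuous_growth)
  have "norm ((weighted (trace_operator A Y) \<psi> ^^ Suc n) f x)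
      = norm (\<integral>z. indicator Y z *\<^sub>R (complex_of_real (exp (\<psi> z)) * ?F z) \<partial>\<nu> x)"
    using Suc.prems by (simp add: weighted_def trace_operator_def set_lebesgue_integral_def)
  also have "\<dots> \<le> (\<integral>z. norm (indicator Y z *\<^sub>R (complex_of_real (exp (\<psi> z)) * ?F z)) \<partial>\<nu> x)"
    by (rule integral_norm_bound)
  also have "\<dots> \<le> (\<integral>z. indicator Y z *\<^sub>R (exp (\<psi> z) * growth \<psi> n z) \<partial>\<nu> x)"
  proof (rule integral_mono)
    show "integrable (\<nu> x) (\<lambda>z. norm (indicator Y z *\<^sub>R (complex_of_real (exp (\<psi> z)) * ?F z)))"
      using ci unfolding set_integrable_def by (rule integrable_norm)
    show "integrable (\<nu> x) (\<lambda>z. indicator Y z *\<^sub>R (exp (\<psi> z) * growth \<psi> n z))"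
      using ri unfolding set_integrable_def .
    show "norm (indicator Y z *\<^sub>R (complex_of_real (exp (\<psi> z)) * ?F z)) \<le> indicator Y z *\<^sub>R (exp (\<psi> z) * growth \<psi> n z)" for z
      using Suc.IH[of z] by (auto simp: indicator_def norm_mult)
  qed
  also have "\<dots> = growth \<psi> (Suc n) x"
    using Suc.prems by (simp add: growth_Suc[OF \<psi>] real_trace_def set_lebesgue_integral_def)
  finally show ?case .
qed

lemma weighted_trace_one:
  assumes \<psi>: "continuous_on Y \<psi>" and x: "x \<in> Y"
  shows "(weighted (trace_operator A Y) \<psi> ^^ n) (\<lambda>x. if x \<in> Y then 1 else 0) x = complex_of_real (growth \<psi> n x)"
  using x
proof (induction n arbitrary: x)
  case 0
  then show ?case by (simp add: growth_def birkhoff_def)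
next
  case (Suc n)
  let ?F = "(weighted (trace_operator A Y) \<psi> ^^ n) (\<lambda>x. if x \<in> Y then 1 else 0)"
  have "trace_operator A Y (\<lambda>z. complex_of_real (exp (\<psi> z)) * ?F z)
      = trace_operator A Y (\<lambda>z. complex_of_real (exp (\<psi> z) * growth \<psi> n z))"
    using Suc.IH by (intro trace_operator_cong) auto
  then show ?case
    by (simp add: weighted_def[of "trace_operator A Y" \<psi> ?F] growth_Suc[OF \<psi>] trace_operator_of_real del: of_real_mult)
qed

text \<open>A positive operator attains its norm at the constant 1, represented in
  \<open>cfun Y\<close> by the indicator of \<open>Y\<close>; its image under the iterate is
  \<open>growth\<close>.\<close>

lemma op_norm_weighted_trace:
  assumes \<psi>: "continuous_on Y \<psi>"
  shows "op_norm Y (weighted (trace_operator A Y) \<psi> ^^ n) = max_growth \<psi> n"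
proof (rule antisym)
  let ?W = "weighted (trace_operator A Y) \<psi> ^^ n"
  let ?one = "\<lambda>x. if x \<in> Y then 1 else 0 :: complex"
  have one: "?one \<in> cfun Y" "sup_norm Y ?one \<le> 1"
    using nonempty by (auto simp: cfun_def sup_norm_def cong: continuous_on_cong intro!: cSUP_least)
  have bd: "sup_norm Y (?W f) \<le> max_growth \<psi> n" if f: "f \<in> cfun Y" "sup_norm Y f \<le> 1" for f
  proof -
    have "norm (f x) \<le> 1" if "x \<in> Y" for x
    proof -
      have "continuous_on Y (\<lambda>x. norm (f x))" using f(1) by (auto simp: cfun_def intro: continuous_intros)
      then have "bdd_above ((\<lambda>x. norm (f x)) ` Y)"
        by (intro bounded_imp_bdd_above compact_imp_bounded compact_continuous_image compact_Y)
      then have "norm (f x) \<le> sup_norm Y f" unfolding sup_norm_def using that by (rule cSUP_upper2) auto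
      then show ?thesis using f(2) by simp
    qed
    then have "norm (?W f x) \<le> max_growth \<psi> n" if "x \<in> Y" for x
      using norm_weighted_trace_le[OF \<psi> f(1) _ that, of n] growth_le_max[OF \<psi> that, of n] by force
    then show ?thesis unfolding sup_norm_def using nonempty by (intro cSUP_least)
  qed
  show "op_norm Y ?W \<le> max_growth \<psi> n"
    unfolding op_norm_def using one bd by (intro cSUP_least) auto
  have "max_growth \<psi> n = sup_norm Y (?W ?one)"
    unfolding max_growth_def sup_norm_def
    by (intro SUP_cong) (auto simp: weighted_trace_one[OF \<psi>] growth_nonneg[OF \<psi>])
  also have "\<dots> \<le> op_norm Y ?W"
    unfolding op_norm_def using one bd by (intro cSUP_upper) (auto intro!: bdd_aboveI2)
  finally show "max_growth \<psi> n \<le> op_norm Y ?W" .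
qed

lemma spectral_potential_trace:
  assumes \<psi>: "continuous_on Y \<psi>"
  shows "spectral_potential Y (trace_operator A Y) \<psi> = pot \<psi>"
  unfolding spectral_potential_def op_norm_weighted_trace[OF \<psi>]
  by (rule limI[OF pot_tendsto[OF \<psi>]])

section \<open>Invariant states and invariant measures\<close>

lemma invariant_measure_state:
  assumes \<mu>: "\<mu> \<in> invariant_measures_on \<alpha> Y"
  shows "invariant_state \<alpha> Y (\<lambda>f. set_lebesgue_integral \<mu> Y f)"
proof -
  have r: "regular_borel_measure \<mu>" and p: "prob_space \<mu>" and d: "distr \<mu> borel \<alpha> = \<mu>" and z: "emeasure \<mu> (UNIV - Y) = 0"
    using \<mu> by (auto simp: invariant_measures_on_def invariant_measures_def)
  note s [simp] = regular_borel_measure_simps[OF r]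
  interpret prob_space \<mu> by (rule p)
  have int: "set_integrable \<mu> Y f" if "continuous_on Y f" for f :: "'a \<Rightarrow> real"
    using that by (intro set_integrable_continuous_closed compact_UNIV closed_Y) auto
  have ae: "AE x in \<mu>. x \<in> Y"
    using z closed_Y by (intro AE_I[of _ _ "UNIV - Y"]) auto
  show ?thesis
    unfolding invariant_state_def
  proof (intro conjI allI impI)
    fix f g :: "'a \<Rightarrow> real" assume "continuous_on Y f" "continuous_on Y g"
    then show "set_lebesgue_integral \<mu> Y (\<lambda>x. f x + g x) = set_lebesgue_integral \<mu> Y f + set_lebesgue_integral \<mu> Y g"
      using int by simp
  next
    fix f :: "'a \<Rightarrow> real" assume "\<forall>x\<in>Y. 0 \<le> f x"
    then show "0 \<le> set_lebesgue_integral \<mu> Y f"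
      by (auto simp: set_lebesgue_integral_def indicator_def intro!: Bochner_Integration.integral_nonneg)
  next
    have "set_lebesgue_integral \<mu> Y (\<lambda>_. 1 :: real) = (\<integral>x. 1 \<partial>\<mu>)"
      unfolding set_lebesgue_integral_def using ae closed_Y
      by (intro integral_cong_AE) (auto intro!: borel_measurable_indicator)
    then show "set_lebesgue_integral \<mu> Y (\<lambda>_. 1 :: real) = 1" using prob_space by simp
  next
    fix f :: "'a \<Rightarrow> real" assume f: "continuous_on Y f"
    have m: "\<alpha> \<in> measurable \<mu> borel"
      using borel_measurable_continuous_onI[OF continuous_\<alpha>] by (simp cong: measurable_cong_sets)
    have fm: "(\<lambda>x. indicator Y x *\<^sub>R f x) \<in> borel_measurable borel"
      using closed_Y f by (intro borel_measurable_continuous_on_indicator) auto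
    have "continuous_on Y (\<lambda>x. f (\<alpha> x))"
      using continuous_on_subset[OF continuous_\<alpha>] invariant_Y by (intro continuous_on_compose2[OF f]) auto
    then have fam: "(\<lambda>x. indicator Y x *\<^sub>R f (\<alpha> x)) \<in> borel_measurable \<mu>"
      using int unfolding set_integrable_def by auto
    have "set_lebesgue_integral \<mu> Y f = (\<integral>x. indicator Y x *\<^sub>R f x \<partial>distr \<mu> borel \<alpha>)"
      by (simp add: d set_lebesgue_integral_def)
    also have "\<dots> = (\<integral>x. indicator Y (\<alpha> x) *\<^sub>R f (\<alpha> x) \<partial>\<mu>)"
      by (rule integral_distr[OF m fm])
    also have "\<dots> = (\<integral>x. indicator Y x *\<^sub>R f (\<alpha> x) \<partial>\<mu>)"
    proof (rule integral_cong_AE)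
      show "AE x in \<mu>. indicator Y (\<alpha> x) *\<^sub>R f (\<alpha> x) = indicator Y x *\<^sub>R f (\<alpha> x)"
        using ae by eventually_elim (use invariant_Y in \<open>auto simp: indicator_def\<close>)
      show "(\<lambda>x. indicator Y (\<alpha> x) *\<^sub>R f (\<alpha> x)) \<in> borel_measurable \<mu>"
        using measurable_compose[OF m fm] .
    qed (rule fam)
    finally show "set_lebesgue_integral \<mu> Y (\<lambda>x. f (\<alpha> x)) = set_lebesgue_integral \<mu> Y f"
      by (simp add: set_lebesgue_integral_def)
  qed simp
qed

lemma set_integral_invariant_measure:
  fixes f :: "'a \<Rightarrow> real"
  assumes \<mu>: "\<mu> \<in> invariant_measures_on \<alpha> Y" and f: "continuous_on UNIV f"
  shows "set_lebesgue_integral \<mu> Y f = (\<integral>x. f x \<partial>\<mu>)"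
proof -
  have r: "regular_borel_measure \<mu>" and z: "emeasure \<mu> (UNIV - Y) = 0"
    using \<mu> by (auto simp: invariant_measures_on_def invariant_measures_def)
  note s [simp] = regular_borel_measure_simps[OF r]
  have ae: "AE x in \<mu>. x \<in> Y"
    using z closed_Y by (intro AE_I[of _ _ "UNIV - Y"]) auto
  have fm: "f \<in> borel_measurable \<mu>"
    using borel_measurable_continuous_onI[OF f] by (simp cong: measurable_cong_sets)
  moreover have "(\<lambda>x. indicator Y x *\<^sub>R f x) \<in> borel_measurable \<mu>"
    using closed_Y by (intro borel_measurable_scaleR borel_measurable_indicator fm) simp
  ultimately show ?thesis
    unfolding set_lebesgue_integral_def using ae by (intro integral_cong_AE) auto
qed

text \<open>Riesz is applied on the whole space. Urysohn functions vanishing on \<open>Y\<close>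
  show that the measure lives on \<open>Y\<close>, uniqueness of regular measures gives its
  invariance, and Tietze extension carries the formula over to functions continuous on
  \<open>Y\<close> only.\<close>

lemma invariant_state_measure:
  assumes m: "invariant_state \<alpha> Y m"
  obtains \<mu> where "\<mu> \<in> invariant_measures_on \<alpha> Y" "\<And>f. continuous_on Y f \<Longrightarrow> m f = set_lebesgue_integral \<mu> Y f"
proof -
  have cY: "continuous_on Y f" if "continuous_on UNIV f" for f :: "'a \<Rightarrow> real"
    using that continuous_on_subset by blast
  interpret L: positive_functional m
    by standard (use compact_UNIV m_add[OF m] m_scale[OF m] m_nonneg[OF m] cY in auto)
  let ?\<mu> = "L.riesz_measure"
  note r = L.regular_riesz_measure
  note s [simp] = regular_borel_measure_simps[OF r]
  have int: "(\<integral>x. f x \<partial>?\<mu>) = m f" if "continuous_on UNIV f" for f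
    using L.integral_riesz_measure[OF that] .
  have z: "emeasure ?\<mu> (UNIV - Y) = 0"
  proof (rule emeasure_open_zero_regular[OF r])
    show "open (UNIV - Y)" using closed_Y by (intro open_Diff) auto
    fix K assume K: "compact K" "K \<subseteq> UNIV - Y"
    then have "closed K" "K \<inter> Y = {}" by (auto simp: compact_imp_closed)
    then obtain u :: "'a \<Rightarrow> real" where u: "continuous_on UNIV u" "\<And>z. 0 \<le> u z" "\<And>z. u z \<le> 1"
      "\<And>z. z \<in> K \<Longrightarrow> u z = 1" "\<And>z. z \<in> Y \<Longrightarrow> u z = 0"
      using closed_Y by (rule_tac Urysohn_function[OF compact_UNIV, of K Y]) blast+
    have "emeasure ?\<mu> K \<le> ennreal (\<integral>z. u z \<partial>?\<mu>)"
      using u \<open>closed K\<close> by (intro emeasure_closed_le_integral[OF compact_UNIV]) auto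
    also have "(\<integral>z. u z \<partial>?\<mu>) = m (\<lambda>_. 0)"
      unfolding int[OF u(1)] using u by (intro m_cong[OF m] cY) auto
    also have "\<dots> = 0" by (rule m_const[OF m])
    finally show "emeasure ?\<mu> K = 0" by simp
  qed
  have "emeasure ?\<mu> UNIV = 1" using L.emeasure_riesz_measure_UNIV m_one[OF m] by simp
  then have p: "prob_space ?\<mu>" by (intro prob_spaceI) simp
  have am: "\<alpha> \<in> measurable ?\<mu> borel"
    using borel_measurable_continuous_onI[OF continuous_\<alpha>] by (simp cong: measurable_cong_sets)
  have d: "distr ?\<mu> borel \<alpha> = ?\<mu>"
  proof (rule regular_borel_measure_eqI[OF compact_UNIV regular_borel_measure_distr[OF compact_UNIV r continuous_\<alpha>] r])
    fix f :: "'a \<Rightarrow> real" assume f: "continuous_on UNIV f"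
    have "continuous_on UNIV (\<lambda>x. f (\<alpha> x))" using continuous_on_compose2[OF f continuous_\<alpha>] by simp
    then have "(\<integral>x. f (\<alpha> x) \<partial>?\<mu>) = m f" using int m_inv[OF m cY[OF f]] by simp
    then show "(\<integral>x. f x \<partial>distr ?\<mu> borel \<alpha>) = (\<integral>x. f x \<partial>?\<mu>)"
      using integral_distr[OF am borel_measurable_continuous_onI[OF f]] int[OF f] by simp
  qed
  have \<mu>: "?\<mu> \<in> invariant_measures_on \<alpha> Y"
    using r p d z by (simp add: invariant_measures_on_def invariant_measures_def)
  moreover have "m f = set_lebesgue_integral ?\<mu> Y f" if f: "continuous_on Y f" for f
  proof -
    obtain g where g: "continuous_on UNIV g" "\<And>x. x \<in> Y \<Longrightarrow> g x = f x"
      using continuous_extension[OF compact_UNIV closed_Y f] by blast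
    have "m f = m g" using g by (intro m_cong[OF m] f) auto
    also have "\<dots> = set_lebesgue_integral ?\<mu> Y g"
      using int[OF g(1)] set_integral_invariant_measure[OF \<mu> g(1)] by simp
    also have "\<dots> = set_lebesgue_integral ?\<mu> Y f" using g by (intro set_integral_cong_on) auto
    finally show ?thesis .
  qed
  ultimately show thesis by (rule that)
qed

text \<open>Members of a partition of unity have nonnegative real values, so complex partitions are
  exactly the complexifications of real ones, and the trace respects complexification.\<close>

lemma t_entropy_trace:
  fixes \<mu> defines "m \<equiv> \<lambda>f :: 'a \<Rightarrow> real. set_lebesgue_integral \<mu> Y f"
  shows "t_entropy Y (trace_operator A Y) \<mu> = state_entropy m"
proof -
  define c where "c g x = complex_of_real (g x)" for g :: "'a \<Rightarrow> real" and x
  have inj: "inj_on c G" for G by (auto simp: c_def inj_on_def fun_eq_iff)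
  have pu: "partitions_of_unity Y = (`) c ` unity_sets"
  proof (intro equalityI subsetI)
    fix H assume "H \<in> (`) c ` unity_sets"
    then obtain G where G: "G \<in> unity_sets" "H = c ` G" by blast
    then have "(\<Sum>h\<in>H. h x) = complex_of_real (\<Sum>g\<in>G. g x)" for x
      using inj by (simp add: sum.reindex c_def)
    then have "(\<Sum>h\<in>H. h x) = 1" if "x \<in> Y" for x
      using G(1) that by (simp add: unity_sets_def del: of_real_sum)
    then show "H \<in> partitions_of_unity Y"
      using G by (auto simp: partitions_of_unity_def unity_sets_def cfun_def c_def[abs_def] continuous_on_of_real)
  next
    fix H assume H: "H \<in> partitions_of_unity Y"
    define G where "G = (\<lambda>h x. Re (h x)) ` H"
    have cR: "c (\<lambda>x. Re (h x)) = h" if "h \<in> H" for h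
      using H that by (auto simp: partitions_of_unity_def c_def fun_eq_iff complex_nonneg_Reals_iff complex_eq_iff)
    then have HG: "H = c ` G" by (force simp: G_def image_image)
    have "complex_of_real (\<Sum>g\<in>G. g x) = (\<Sum>h\<in>H. h x)" for x
      using inj by (simp add: HG sum.reindex c_def)
    then have "(\<Sum>g\<in>G. g x) = 1" if "x \<in> Y" for x
      using H that unfolding partitions_of_unity_def by (metis (mono_tags, lifting) mem_Collect_eq of_real_eq_1_iff)
    then have "G \<in> unity_sets"
      using H by (auto simp: unity_sets_def G_def partitions_of_unity_def cfun_def complex_nonneg_Reals_iff
          intro!: continuous_on_Re)
    then show "H \<in> (`) c ` unity_sets" using HG by blast
  qed
  have pow: "(trace_operator A Y ^^ n) (c g) = c ((real_trace Y ^^ n) g)" for n g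
    by (induction n) (auto simp: c_def[abs_def] trace_operator_of_real)
  \<comment> \<open>\<open>mean\<close> integrates over the whole space and \<open>m\<close> over
    \<open>Y\<close>. They agree on functions vanishing off \<open>Y\<close>, a property that the
    iterates of the trace preserve.\<close>
  have mean: "mean \<mu> (c g) = m g" if "\<And>x. x \<notin> Y \<Longrightarrow> g x = 0" for g
    using that by (simp add: mean_def c_def m_def set_integral_vanishing)
  have zero: "(real_trace Y ^^ n) g x = 0" if "\<And>x. x \<notin> Y \<Longrightarrow> g x = 0" "x \<notin> Y" for n g x
    using that by (cases n) (auto simp: real_trace_def)
  have "(\<Sum>h\<in>c ` G. if mean \<mu> h = 0 then 0
          else ereal (mean \<mu> h) * eln (mean \<mu> ((trace_operator A Y ^^ n) h) / mean \<mu> h))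
     = (\<Sum>g\<in>G. rel_log (m g) (m ((real_trace Y ^^ n) g)))" if G: "G \<in> unity_sets" for G n
  proof -
    have "g x = 0" if "g \<in> G" "x \<notin> Y" for g x using G that by (auto simp: unity_sets_def)
    then show ?thesis
      using inj by (subst sum.reindex) (auto simp: pow mean zero rel_log_def intro!: sum.cong)
  qed
  then show ?thesis
    unfolding t_entropy_def state_entropy_def pu by (auto simp: image_image intro!: INF_cong arg_cong2[where f = times])
qed

theorem variational_principle:
  assumes \<psi>: "continuous_on UNIV \<psi>"
  shows "is_max_over (pot \<psi>) (\<lambda>\<mu>. ereal (\<integral>x. \<psi> x \<partial>\<mu>) + t_entropy Y (trace_operator A Y) \<mu>)
           (invariant_measures_on \<alpha> Y)"
proof -
  have \<psi>Y: "continuous_on Y \<psi>" using \<psi> continuous_on_subset by blast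
  have eq: "ereal (\<integral>x. \<psi> x \<partial>\<mu>) + t_entropy Y (trace_operator A Y) \<mu>
      = ereal (set_lebesgue_integral \<mu> Y \<psi>) + state_entropy (\<lambda>f. set_lebesgue_integral \<mu> Y f)"
    if "\<mu> \<in> invariant_measures_on \<alpha> Y" for \<mu>
    by (simp add: t_entropy_trace set_integral_invariant_measure[OF that \<psi>])
  obtain m where m: "invariant_state \<alpha> Y m" "ereal (m \<psi>) + state_entropy m = pot \<psi>"
    using state_variational_principle[OF \<psi>Y] by blast
  obtain \<mu> where \<mu>: "\<mu> \<in> invariant_measures_on \<alpha> Y" "\<And>f. continuous_on Y f \<Longrightarrow> m f = set_lebesgue_integral \<mu> Y f"
    using invariant_state_measure[OF m(1)] by blast
  have "state_entropy m = state_entropy (\<lambda>f. set_lebesgue_integral \<mu> Y f)"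
    unfolding state_entropy_def unity_sets_def using \<mu>(2)
    by (intro INF_cong arg_cong2[where f = times] sum.cong refl) (auto simp: Tn_cont)
  then have "ereal (\<integral>x. \<psi> x \<partial>\<mu>) + t_entropy Y (trace_operator A Y) \<mu> = pot \<psi>"
    using m(2) \<mu> eq[OF \<mu>(1)] \<psi>Y by simp
  then show ?thesis
    unfolding is_max_over_def using \<mu>(1) eq state_entropy_le_pot[OF invariant_measure_state \<psi>Y] by auto
qed

text \<open>Going from \<open>Y\<close> to the whole space enlarges the domain of integration of a
  nonnegative integrand at every iterate, which compares the growths by induction at the points of
  \<open>Y\<close>.\<close>

lemma pot_le_whole:
  assumes \<psi>: "continuous_on UNIV \<psi>"
  shows "pot \<psi> \<le> transfer_on.pot UNIV \<alpha> (real_trace UNIV) \<psi>"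
proof -
  interpret X: compatible_subset \<alpha> A UNIV by (rule compatible_subset_UNIV)
  have \<psi>Y: "continuous_on Y \<psi>" using \<psi> continuous_on_subset by blast
  have g: "growth \<psi> n x \<le> X.growth \<psi> n x" if "x \<in> Y" for n x
    using that
  proof (induction n arbitrary: x)
    case 0
    then show ?case by (simp add: growth_def X.growth_def birkhoff_def X.birkhoff_def)
  next
    case (Suc n)
    have "growth \<psi> (Suc n) x = (\<integral>z. indicator Y z *\<^sub>R (exp (\<psi> z) * growth \<psi> n z) \<partial>\<nu> x)"
      using Suc.prems by (simp add: growth_Suc[OF \<psi>Y] real_trace_def set_lebesgue_integral_def)
    also have "\<dots> \<le> (\<integral>z. indicator UNIV z *\<^sub>R (exp (\<psi> z) * X.growth \<psi> n z) \<partial>\<nu> x)"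
    proof (rule integral_mono)
      show "integrable (\<nu> x) (\<lambda>z. indicator Y z *\<^sub>R (exp (\<psi> z) * growth \<psi> n z))"
        using kernel_set_integrable[OF closed_Y continuous_on_mult[OF continuous_on_exp[OF \<psi>Y] continuous_growth[OF \<psi>Y]]]
        unfolding set_integrable_def .
      show "integrable (\<nu> x) (\<lambda>z. indicator UNIV z *\<^sub>R (exp (\<psi> z) * X.growth \<psi> n z))"
        using kernel_set_integrable[OF closed_UNIV continuous_on_mult[OF continuous_on_exp[OF \<psi>] X.continuous_growth[OF \<psi>]]]
        unfolding set_integrable_def .
      show "indicator Y z *\<^sub>R (exp (\<psi> z) * growth \<psi> n z) \<le> indicator UNIV z *\<^sub>R (exp (\<psi> z) * X.growth \<psi> n z)" for z
        using Suc.IH[of z] X.growth_nonneg[OF \<psi>, of z n] by (auto simp: indicator_def)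
    qed
    also have "\<dots> = X.growth \<psi> (Suc n) x"
      by (simp add: X.growth_Suc[OF \<psi>] real_trace_def set_lebesgue_integral_def)
    finally show ?case .
  qed
  have "max_growth \<psi> n \<le> X.max_growth \<psi> n" for n
    using g X.growth_le_max[OF \<psi>] by (intro max_growth_le) (meson UNIV_I order_trans)
  then show ?thesis
    unfolding pot_def X.pot_def
    by (intro INF_mono) (auto intro!: ereal_divide_right_mono eln_mono)
qed

end

section \<open>The essential set\<close>

context transfer_setting
begin

lemma closed_essential_set: "closed (essential_set \<alpha>)"
proof -
  have "- essential_set \<alpha> = \<Union>{V. open V \<and> (\<forall>\<mu>\<in>invariant_measures \<alpha>. emeasure \<mu> V = 0)}"
    by (auto simp: essential_set_def)
  then have "open (- essential_set \<alpha>)" by (simp add: open_Union)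
  then show ?thesis by (simp add: closed_def)
qed

lemma invariant_measure_distr:
  assumes "\<mu> \<in> invariant_measures \<alpha>" "open V"
  shows "emeasure \<mu> (\<alpha> -` V) = emeasure \<mu> V"
proof -
  have r: "regular_borel_measure \<mu>" and d: "distr \<mu> borel \<alpha> = \<mu>"
    using assms by (auto simp: invariant_measures_def)
  have "\<alpha> \<in> measurable \<mu> borel"
    using borel_measurable_continuous_onI[OF continuous_\<alpha>] regular_borel_measure_simps(1)[OF r]
    by (simp cong: measurable_cong_sets)
  then have "emeasure (distr \<mu> borel \<alpha>) V = emeasure \<mu> (\<alpha> -` V)"
    using assms(2) regular_borel_measure_simps(2)[OF r] by (subst emeasure_distr) auto
  then show ?thesis by (simp add: d)
qed

lemma essential_set_invariant: "\<alpha> ` essential_set \<alpha> \<subseteq> essential_set \<alpha>"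
proof
  fix y assume "y \<in> \<alpha> ` essential_set \<alpha>"
  then obtain x where x: "x \<in> essential_set \<alpha>" "y = \<alpha> x" by blast
  have "\<exists>\<mu>\<in>invariant_measures \<alpha>. 0 < emeasure \<mu> V" if V: "open V" "y \<in> V" for V
  proof -
    have "open (\<alpha> -` V)" "x \<in> \<alpha> -` V" using V x continuous_\<alpha> by (auto intro: open_vimage)
    then obtain \<mu> where "\<mu> \<in> invariant_measures \<alpha>" "0 < emeasure \<mu> (\<alpha> -` V)"
      using x(1) by (auto simp: essential_set_def)
    then show ?thesis using invariant_measure_distr[OF _ V(1)] by auto
  qed
  then show "y \<in> essential_set \<alpha>" by (auto simp: essential_set_def)
qed

text \<open>An uncountable union of null open sets need not be null. Regularity reduces the claim to
  compact sets, which are covered by finitely many null neighbourhoods of points that are not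
  essential.\<close>

lemma invariant_measures_on_essential_set:
  "invariant_measures_on \<alpha> (essential_set \<alpha>) = invariant_measures \<alpha>"
proof -
  have "emeasure \<mu> (UNIV - essential_set \<alpha>) = 0" if \<mu>: "\<mu> \<in> invariant_measures \<alpha>" for \<mu>
  proof (rule emeasure_open_zero_regular)
    show r: "regular_borel_measure \<mu>" using \<mu> by (simp add: invariant_measures_def)
    note s [simp] = regular_borel_measure_simps[OF r]
    show "open (UNIV - essential_set \<alpha>)" using closed_essential_set by (intro open_Diff) auto
    fix K assume K: "compact K" "K \<subseteq> UNIV - essential_set \<alpha>"
    let ?C = "{V. open V \<and> emeasure \<mu> V = 0}"
    have "K \<subseteq> \<Union>?C"
    proof
      fix x assume "x \<in> K"
      then have "x \<notin> essential_set \<alpha>" using K(2) by blast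
      then obtain V where "open V" "x \<in> V" "\<not> 0 < emeasure \<mu> V" using \<mu> unfolding essential_set_def by blast
      then show "x \<in> \<Union>?C" by auto
    qed
    then obtain D where D: "D \<subseteq> ?C" "finite D" "K \<subseteq> \<Union>D" using K(1) by (auto elim: compactE)
    then have "\<Union>D \<in> null_sets \<mu>"
      by (intro null_sets.finite_Union) (auto simp: null_sets_def)
    moreover from this have "emeasure \<mu> K \<le> emeasure \<mu> (\<Union>D)"
      using D(3) by (intro emeasure_mono) auto
    ultimately show "emeasure \<mu> K = 0" by (simp add: null_sets_def)
  qed
  then show ?thesis by (auto simp: invariant_measures_on_def)
qed

lemma essential_set_nonempty: "essential_set \<alpha> \<noteq> {}"
proof
  assume empty: "essential_set \<alpha> = {}"
  interpret X: compatible_subset \<alpha> A UNIV by (rule compatible_subset_UNIV)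
  obtain m where "invariant_state \<alpha> UNIV m"
    using exists_invariant_state[OF X.compact_Y X.Y_ne X.cont_\<alpha> X.\<alpha>_Y] by blast
  then obtain \<mu> where \<mu>: "\<mu> \<in> invariant_measures_on \<alpha> UNIV"
    using X.invariant_state_measure by metis
  then have "\<mu> \<in> invariant_measures_on \<alpha> (essential_set \<alpha>)"
    unfolding invariant_measures_on_essential_set by (simp add: invariant_measures_on_def)
  then have "emeasure \<mu> UNIV = 0" by (simp add: invariant_measures_on_def empty)
  moreover have "prob_space \<mu>" "space \<mu> = UNIV"
    using \<mu> regular_borel_measure_simps(2)[of \<mu>] by (auto simp: invariant_measures_on_def invariant_measures_def)
  ultimately show False using prob_space.emeasure_space_1[of \<mu>] by simp
qed

end

section \<open>Reduction of the growth on the whole space to a set carrying all invariant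
  measures\<close>

context compatible_subset
begin

text \<open>Outer regularity gives the estimate at a single point; as in Dini's theorem, compatibility and
  compactness make it uniform.\<close>

lemma trace_upper_approximation_step:
  assumes F: "continuous_on UNIV F" "\<And>x. 0 \<le> F x" and e: "0 < e"
  obtains h where "continuous_on UNIV h" "\<And>x. 0 \<le> h x" "\<And>x. h x \<le> (1::real)" "\<And>x. x \<in> Y \<Longrightarrow> h x = 1"
    "\<And>x. x \<in> Y \<Longrightarrow> real_trace UNIV (\<lambda>x. h x * F x) x \<le> real_trace Y F x + e"
proof -
  interpret X: compatible_subset \<alpha> A UNIV by (rule compatible_subset_UNIV)
  let ?T = "real_trace UNIV"
  have FY: "continuous_on Y F" using F(1) continuous_on_subset by blast
  obtain B where B: "0 < B" "\<And>x. \<bar>F x\<bar> \<le> B" using continuous_bounded_compact[OF compact_UNIV F(1)] by auto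
  define cut where "cut h \<longleftrightarrow> continuous_on UNIV h \<and> (\<forall>x. 0 \<le> h x \<and> h x \<le> (1::real)) \<and> (\<forall>x\<in>Y. h x = 1)" for h :: "'a \<Rightarrow> real"
  have point: "\<exists>h. cut h \<and> ?T (\<lambda>x. h x * F x) x < real_trace Y F x + e" if x: "x \<in> Y" for x
  proof -
    interpret \<nu>: finite_measure "\<nu> x" by simp
    obtain U where U: "open U" "Y \<subseteq> U" "measure (\<nu> x) U < measure (\<nu> x) Y + e / B"
      using regular_borel_measure_outer_approx[OF kernel_measure(1), of Y "e / B" x] closed_Y e B by auto
    have "closed (-U)" "Y \<inter> -U = {}" using U by auto
    then obtain h :: "'a \<Rightarrow> real" where h: "continuous_on UNIV h" "\<And>z. 0 \<le> h z" "\<And>z. h z \<le> 1"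
      "\<And>z. z \<in> Y \<Longrightarrow> h z = 1" "\<And>z. z \<in> -U \<Longrightarrow> h z = 0"
      by (rule Urysohn_function[OF compact_UNIV closed_Y]) blast
    have iU: "integrable (\<nu> x) (\<lambda>z. indicator (U - Y) z * B)"
      using U(1) closed_Y by (intro integrable_mult_left integrable_real_indicator) (auto simp: less_top[symmetric])
    have iY: "integrable (\<nu> x) (\<lambda>z. indicator Y z *\<^sub>R F z)"
      using kernel_set_integrable[OF closed_Y FY] unfolding set_integrable_def .
    have "?T (\<lambda>x. h x * F x) x = (\<integral>z. h z * F z \<partial>\<nu> x)"
      by (simp add: real_trace_def set_lebesgue_integral_def)
    also have "\<dots> \<le> (\<integral>z. indicator Y z *\<^sub>R F z + indicator (U - Y) z * B \<partial>\<nu> x)"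
    proof (rule integral_mono[OF _ Bochner_Integration.integrable_add[OF iY iU]])
      show "integrable (\<nu> x) (\<lambda>z. h z * F z)"
        using h(1) F(1) by (intro integrable_continuous_compact compact_UNIV continuous_on_mult) auto
      fix z
      have "h z * F z \<le> 1 * B" using h(2,3)[of z] F(2)[of z] B(2)[of z] by (intro mult_mono) auto
      then show "h z * F z \<le> indicator Y z *\<^sub>R F z + indicator (U - Y) z * B"
        using h(4,5)[of z] B(1) U(2) by (cases "z \<in> Y"; cases "z \<in> U") auto
    qed
    also have "\<dots> = real_trace Y F x + measure (\<nu> x) (U - Y) * B"
      using x iY iU U(1) closed_Y by (subst Bochner_Integration.integral_add) (auto simp: real_trace_def set_lebesgue_integral_def)
    also have "measure (\<nu> x) (U - Y) = measure (\<nu> x) U - measure (\<nu> x) Y"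
      using U closed_Y by (intro \<nu>.finite_measure_Diff) auto
    also have "(measure (\<nu> x) U - measure (\<nu> x) Y) * B < e / B * B"
      using U(3) B(1) by (intro mult_strict_right_mono) auto
    also have "e / B * B = e" using B(1) by simp
    finally have "?T (\<lambda>x. h x * F x) x < real_trace Y F x + e" by simp
    then show ?thesis using h by (intro exI[of _ h]) (auto simp: cut_def)
  qed
  then obtain h where h: "\<And>x. x \<in> Y \<Longrightarrow> cut (h x)" "\<And>x. x \<in> Y \<Longrightarrow> ?T (\<lambda>z. h x z * F z) x < real_trace Y F x + e"
    by metis
  \<comment> \<open>The trace is continuous on \<open>Y\<close> only; extending it makes the
    neighbourhoods \<open>V x\<close> open in the whole space.\<close>
  obtain R where R: "continuous_on UNIV R" "\<And>x. x \<in> Y \<Longrightarrow> R x = real_trace Y F x"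
    using continuous_extension[OF compact_UNIV closed_Y T_cont[OF FY]] by blast
  define V where "V x = {y. ?T (\<lambda>z. h x z * F z) y < R y + e}" for x
  have V: "open (V x)" if x: "x \<in> Y" for x
  proof -
    have "continuous_on UNIV (\<lambda>z. h x z * F z)"
      using h(1)[OF x] F(1) by (intro continuous_on_mult) (auto simp: cut_def)
    then show ?thesis
      unfolding V_def by (intro open_Collect_less X.T_cont continuous_on_add R continuous_on_const)
  qed
  have "Y \<subseteq> (\<Union>x\<in>Y. V x)" using h(2) R(2) by (auto simp: V_def)
  then obtain D where D: "D \<subseteq> Y" "finite D" "Y \<subseteq> (\<Union>x\<in>D. V x)"
    using compact_Y V by (metis compactE_image)
  \<comment> \<open>The product over the finite cover stays 1 on \<open>Y\<close> and lies below
    every factor, so by positivity it satisfies all the local estimates at once.\<close>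
  define k where "k z = (\<Prod>x\<in>D. h x z)" for z
  have hc: "continuous_on UNIV (h x)" "0 \<le> h x z" "h x z \<le> 1" "z \<in> Y \<Longrightarrow> h x z = 1" if "x \<in> D" for x z
    using h(1) D(1) that by (auto simp: cut_def subset_iff)
  have kc: "continuous_on UNIV k" unfolding k_def by (intro continuous_on_prod hc)
  have kb: "0 \<le> k z" "k z \<le> 1" "z \<in> Y \<Longrightarrow> k z = 1" for z
    unfolding k_def using hc by (auto intro!: prod_nonneg prod_le_1)
  have kh: "k z \<le> h x z" if "x \<in> D" for x z
  proof -
    have "k z = h x z * (\<Prod>y\<in>D - {x}. h y z)" unfolding k_def using D(2) that by (rule prod.remove)
    also have "\<dots> \<le> h x z * 1"
      using hc that by (intro mult_left_mono prod_le_1) auto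
    finally show ?thesis by simp
  qed
  show thesis
  proof (rule that[OF kc kb])
    fix y assume y: "y \<in> Y"
    then obtain x where x: "x \<in> D" "y \<in> V x" using D(3) by blast
    have "?T (\<lambda>z. k z * F z) y \<le> ?T (\<lambda>z. h x z * F z) y"
      using X.Tn_mono[of "\<lambda>z. k z * F z" "\<lambda>z. h x z * F z" y 1] kc hc(1)[OF x(1)] kh[OF x(1)] F
      by (auto intro!: continuous_on_mult mult_right_mono)
    also have "\<dots> < real_trace Y F y + e" using x(2) y R(2) by (simp add: V_def)
    finally show "?T (\<lambda>x. k x * F x) y \<le> real_trace Y F y + e" by simp
  qed
qed

text \<open>The one-step result is applied to the outcome of \<open>n\<close> iterates and yields a
  further cutoff \<open>k\<close>. Composed with \<alpha>^n, it leaves the \<open>n\<close> iterates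
  by the homological identity, and invariance of \<open>Y\<close> keeps the product of the cutoffs
  equal to 1 there.\<close>

lemma trace_upper_approximation:
  assumes F: "continuous_on UNIV F" "\<And>x. 0 \<le> F x" and e: "0 < e"
  shows "\<exists>h. continuous_on UNIV h \<and> (\<forall>x. 0 \<le> h x \<and> h x \<le> (1::real)) \<and> (\<forall>x\<in>Y. h x = 1) \<and>
    (\<forall>x\<in>Y. (real_trace UNIV ^^ n) (\<lambda>x. h x * F x) x \<le> (real_trace Y ^^ n) F x + e)"
  using e
proof (induction n arbitrary: e)
  case 0
  then show ?case by (intro exI[of _ "\<lambda>_. 1"]) auto
next
  case (Suc n)
  interpret X: compatible_subset \<alpha> A UNIV by (rule compatible_subset_UNIV)
  have FY: "continuous_on Y F" using F(1) continuous_on_subset by blast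
  \<comment> \<open>\<open>D\<close> bounds the trace of 1 and turns the inductive error
    \<open>d\<close> into \<open>e / 2\<close>; the added 1 keeps it positive.\<close>
  define D where "D = max_growth (\<lambda>_. 0) 1 + 1"
  have D: "real_trace Y (\<lambda>_. 1) x \<le> D" if "x \<in> Y" for x
    using growth_le_max[of "\<lambda>_. 0" x 1] that by (simp add: growth_def birkhoff_def D_def)
  have D1: "1 \<le> D" using max_growth_nonneg[of "\<lambda>_. 0" 1] by (simp add: D_def)
  define d where "d = e / (2 * D)"
  have d: "0 < d" "d * D = e / 2" using D1 Suc.prems by (auto simp: d_def)
  obtain h where h: "continuous_on UNIV h" "\<And>x. 0 \<le> h x" "\<And>x. h x \<le> 1" "\<And>x. x \<in> Y \<Longrightarrow> h x = 1"
      "\<And>x. x \<in> Y \<Longrightarrow> (real_trace UNIV ^^ n) (\<lambda>x. h x * F x) x \<le> (real_trace Y ^^ n) F x + d"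
    using Suc.IH[OF d(1)] by blast
  define G where "G = (real_trace UNIV ^^ n) (\<lambda>x. h x * F x)"
  have hF: "continuous_on UNIV (\<lambda>x. h x * F x)" by (intro continuous_on_mult h F)
  have Gc: "continuous_on UNIV G" unfolding G_def by (intro X.Tn_cont hF)
  have G0: "0 \<le> G x" for x unfolding G_def using h F by (intro X.Tn_nonneg hF) auto
  obtain k where k: "continuous_on UNIV k" "\<And>x. 0 \<le> k x" "\<And>x. k x \<le> (1::real)" "\<And>x. x \<in> Y \<Longrightarrow> k x = 1"
      "\<And>x. x \<in> Y \<Longrightarrow> real_trace UNIV (\<lambda>x. k x * G x) x \<le> real_trace Y G x + e / 2"
    using trace_upper_approximation_step[OF Gc G0, of "e / 2"] Suc.prems by auto
  let ?h = "\<lambda>x. k ((\<alpha> ^^ n) x) * h x"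
  have "(real_trace UNIV ^^ Suc n) (\<lambda>x. ?h x * F x) x \<le> (real_trace Y ^^ Suc n) F x + e" if x: "x \<in> Y" for x
  proof -
    have "(real_trace UNIV ^^ n) (\<lambda>x. ?h x * F x) = (\<lambda>x. k x * G x)"
      using X.Tn_hom[OF k(1) hF, of n] by (simp add: G_def mult.assoc)
    then have "(real_trace UNIV ^^ Suc n) (\<lambda>x. ?h x * F x) x = real_trace UNIV (\<lambda>x. k x * G x) x"
      by simp
    also have "\<dots> \<le> real_trace Y G x + e / 2" by (rule k(5)[OF x])
    also have "real_trace Y G x \<le> real_trace Y (\<lambda>x. (real_trace Y ^^ n) F x + d * 1) x"
    proof -
      have "continuous_on Y G" using Gc continuous_on_subset by blast
      moreover have "continuous_on Y (\<lambda>x. (real_trace Y ^^ n) F x + d * 1)"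
        by (intro continuous_intros Tn_cont FY)
      ultimately show ?thesis
        using Tn_mono[of G "\<lambda>x. (real_trace Y ^^ n) F x + d * 1" x 1] h(5) x by (simp add: G_def)
    qed
    also have "\<dots> = (real_trace Y ^^ Suc n) F x + d * real_trace Y (\<lambda>_. 1) x"
      by (subst T_add) (auto intro!: Tn_cont FY simp: T_scale[of "\<lambda>_. 1" d, simplified])
    also have "\<dots> \<le> (real_trace Y ^^ Suc n) F x + e / 2"
    proof -
      have "d * real_trace Y (\<lambda>_. 1) x \<le> d * D" using D[OF x] d(1) by (intro mult_left_mono) auto
      then show ?thesis using d(2) by simp
    qed
    finally show ?thesis by simp
  qed
  moreover have "continuous_on UNIV ?h" by (intro continuous_on_mult X.continuous_on_comp_funpow k h)
  moreover have "0 \<le> ?h x" "?h x \<le> 1" for x using h k by (auto intro: mult_le_one)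
  moreover have "?h x = 1" if "x \<in> Y" for x using h k funpow_Y that by simp
  ultimately show ?case by (intro exI[of _ ?h]) auto
qed

text \<open>Every subgradient of the spectral potential at \<open>\<psi>\<close> ignores functions vanishing on the set of
  essential points. Hence a penalty \<open>M * \<phi>\<close> with \<open>\<phi> \<ge> 0\<close> vanishing on \<open>Y\<close> does not lower
  the spectral potential, while for large \<open>M\<close> it kills the mass off \<open>Y\<close>.\<close>

lemma whole_pot_le:
  assumes supp: "invariant_measures_on \<alpha> Y = invariant_measures \<alpha>" and \<psi>: "continuous_on UNIV \<psi>"
  shows "transfer_on.pot UNIV \<alpha> (real_trace UNIV) \<psi> \<le> pot \<psi>"
proof -
  interpret X: compatible_subset \<alpha> A UNIV by (rule compatible_subset_UNIV)
  let ?T = "real_trace UNIV"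
  have \<psi>Y: "continuous_on Y \<psi>" using \<psi> continuous_on_subset by blast
  show ?thesis
  proof (cases "X.pot \<psi>")
    case MInf
    then show ?thesis by simp
  next
    case PInf
    then show ?thesis using X.pot_less_top[of \<psi>] by simp
  next
    case (real l)
    obtain m where m: "invariant_state \<alpha> UNIV m"
        "\<And>\<phi> c. continuous_on UNIV \<phi> \<Longrightarrow> X.pot \<phi> \<le> ereal c \<Longrightarrow> l + (m \<phi> - m \<psi>) \<le> c"
      using X.pot_subgradient[OF \<psi> real] by blast
    obtain \<mu> where \<mu>: "\<mu> \<in> invariant_measures_on \<alpha> UNIV"
        "\<And>f. continuous_on UNIV f \<Longrightarrow> m f = set_lebesgue_integral \<mu> UNIV f"
      using X.invariant_state_measure[OF m(1)] by blast
    then have "\<mu> \<in> invariant_measures \<alpha>" by (simp add: invariant_measures_on_def)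
    then have \<mu>Y: "\<mu> \<in> invariant_measures_on \<alpha> Y" using supp by simp
    have m0: "m \<phi> = 0" if "continuous_on UNIV \<phi>" "\<And>x. x \<in> Y \<Longrightarrow> \<phi> x = 0" for \<phi>
    proof -
      have "m \<phi> = set_lebesgue_integral \<mu> Y \<phi>"
        using \<mu> that(1) X.set_integral_invariant_measure[OF \<mu>(1) that(1)] set_integral_invariant_measure[OF \<mu>Y that(1)] by simp
      also have "\<dots> = set_lebesgue_integral \<mu> Y (\<lambda>_. 0)" using that(2) by (rule set_integral_cong_on)
      finally show ?thesis by simp
    qed
    have "ereal l \<le> ereal c" if c: "pot \<psi> < ereal c" for c
    proof -
      obtain c' where c': "pot \<psi> < ereal c'" "ereal c' < ereal c" using ereal_dense2[OF c] by blast
      obtain n where n: "1 \<le> n" "max_growth \<psi> n < exp (real n * c')"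
        using c'(1) unfolding pot_def INF_less_iff by (auto simp: eln_div_less_iff)
      have n0: "0 < real n" using n by simp
      let ?S = "X.birkhoff \<psi> n"
      have eS: "continuous_on UNIV (\<lambda>x. exp (?S x))" by (rule X.continuous_exp_birkhoff[OF \<psi>])
      define e where "e = (exp (real n * c') - max_growth \<psi> n) / 2"
      have e: "0 < e" using n by (simp add: e_def)
      obtain h where h: "continuous_on UNIV h" "\<And>x. 0 \<le> h x" "\<And>x. h x \<le> (1::real)" "\<And>x. x \<in> Y \<Longrightarrow> h x = 1"
          "\<And>x. x \<in> Y \<Longrightarrow> (?T ^^ n) (\<lambda>x. h x * exp (?S x)) x \<le> (real_trace Y ^^ n) (\<lambda>x. exp (?S x)) x + e"
        using trace_upper_approximation[OF eS _ e, of n] by auto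
      define H where "H = (?T ^^ n) (\<lambda>x. h x * exp (?S x))"
      have hS: "continuous_on UNIV (\<lambda>x. h x * exp (?S x))" by (intro continuous_on_mult h eS)
      have Hc: "continuous_on UNIV H" unfolding H_def by (rule X.Tn_cont[OF hS])
      have HY: "H x < exp (real n * c')" if "x \<in> Y" for x
      proof -
        have "H x \<le> growth \<psi> n x + e" using h(5)[OF that] by (simp add: H_def growth_def)
        also have "\<dots> \<le> max_growth \<psi> n + e" using growth_le_max[OF \<psi>Y that] by simp
        also have "\<dots> < exp (real n * c')" using n(2) by (simp add: e_def field_simps)
        finally show ?thesis .
      qed
      let ?N = "{x. exp (real n * c') \<le> H x}"
      have "closed ?N" by (intro closed_Collect_le continuous_on_const Hc)
      moreover have "?N \<inter> Y = {}" using HY by force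
      ultimately obtain u :: "'a \<Rightarrow> real" where u: "continuous_on UNIV u" "\<And>x. 0 \<le> u x" "\<And>x. u x \<le> 1"
          "\<And>x. x \<in> ?N \<Longrightarrow> u x = 1" "\<And>x. x \<in> Y \<Longrightarrow> u x = 0"
        using closed_Y by (rule_tac Urysohn_function[OF compact_UNIV, of ?N Y]) blast+
      \<comment> \<open>Two penalties act at the two ends of an orbit segment. \<open>1 - h\<close>
        replaces the weight \<open>exp ?S\<close> inside the iterate by \<open>h * exp ?S\<close>,
        up to order \<open>1 / M\<close>. \<open>u \<circ> \<alpha>^n\<close> leaves the iterate as
        a factor \<open>exp (- M * u x)\<close>, which suppresses the points where \<open>H\<close>
        is too large.\<close>
      define \<phi> where "\<phi> x = (1 - h x) + u ((\<alpha> ^^ n) x)" for x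
      have \<phi>c: "continuous_on UNIV \<phi>"
        unfolding \<phi>_def by (intro continuous_intros h X.continuous_on_comp_funpow[OF u(1)])
      have \<phi>0: "0 \<le> \<phi> x" for x unfolding \<phi>_def using h u by (simp add: add_nonneg_nonneg)
      have \<phi>Y: "\<phi> x = 0" if "x \<in> Y" for x unfolding \<phi>_def using h(4) u(5) funpow_Y that by simp
      define K where "K = X.max_growth \<psi> n + 1"
      have K: "1 \<le> K" using X.max_growth_nonneg[OF \<psi>, of n] by (simp add: K_def)
      have gK: "X.growth \<psi> n x \<le> K" for x using X.growth_le_max[OF \<psi>, of x n] by (simp add: K_def)
      define gap where "gap = exp (real n * c) - exp (real n * c')"
      have gap: "0 < gap" using c'(2) n0 by (simp add: gap_def)
      \<comment> \<open>Each summand serves one estimate: \<open>K / M \<le> gap\<close> is used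
        where \<open>H\<close> is small, \<open>2 * K / M \<le> exp (real n * c)\<close> on
        \<open>?N\<close>, and \<open>1 \<le> M\<close> gives \<open>K / M \<le> K\<close>.\<close>
      define M where "M = 1 + K / gap + 2 * K / exp (real n * c)"
      have M: "1 \<le> M" "K / gap \<le> M" "2 * K / exp (real n * c) \<le> M"
        unfolding M_def using K gap by auto
      have M0: "0 < M" using M(1) by simp
      have Kgap: "K / M \<le> gap" using M(2) M0 gap by (simp add: field_simps)
      have KM: "2 * K / M \<le> exp (real n * c)" using M(3) M0 by (simp add: field_simps)
      define \<psi>' where "\<psi>' x = \<psi> x + (- M) * \<phi> x" for x
      have \<psi>'c: "continuous_on UNIV \<psi>'" unfolding \<psi>'_def by (intro continuous_intros \<psi> \<phi>c)
      \<comment> \<open>With \<open>t = 1 - h y\<close> this dominates the exponential penalty by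
        \<open>h y + 1 / M\<close>, which is linear in \<open>h y\<close>, so that linearity of the
        iterate brings in \<open>H\<close>.\<close>
      have exp_le: "exp (- M * t) \<le> (1 - t) + 1 / M" if t: "0 \<le> t" "t \<le> 1" for t
      proof -
        have pos: "0 < 1 + M * t" using M0 t by (simp add: add_pos_nonneg)
        have "1 + M * t \<le> exp (M * t)" by (rule exp_ge_add_one_self)
        then have "exp (- M * t) \<le> 1 / (1 + M * t)"
          using pos by (simp add: exp_minus field_simps)
        also have "\<dots> \<le> (1 - t) + 1 / M"
        proof -
          have "((1 - t) + 1 / M) * (1 + M * t) = 1 + 1 / M + M * (t * (1 - t))"
            using M0 by (simp add: field_simps power2_eq_square)
          moreover have "0 \<le> M * (t * (1 - t))" using M0 t by simp
          ultimately have "1 \<le> ((1 - t) + 1 / M) * (1 + M * t)" using M0 by (simp add: add_nonneg_nonneg)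
          then show ?thesis using pos by (simp add: divide_le_eq)
        qed
        finally show ?thesis .
      qed
      \<comment> \<open>All terms of the Birkhoff sum of \<phi> are nonnegative; the one at time 0
        is kept and already contains both penalties.\<close>
      have b: "X.birkhoff \<psi>' n y \<le> ?S y - M * (1 - h y) - M * u ((\<alpha> ^^ n) y)" for y
      proof -
        have "X.birkhoff \<psi>' n y = ?S y - M * X.birkhoff \<phi> n y"
          by (simp add: X.birkhoff_def \<psi>'_def sum_subtractf sum_distrib_left)
        moreover have "\<phi> ((\<alpha> ^^ 0) y) \<le> X.birkhoff \<phi> n y"
          unfolding X.birkhoff_def using n(1) \<phi>0 by (intro member_le_sum) auto
        then have "M * \<phi> y \<le> M * X.birkhoff \<phi> n y" using M0 by simp
        ultimately show ?thesis by (simp add: \<phi>_def algebra_simps)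
      qed
      have "X.growth \<psi>' n x \<le> exp (real n * c)" for x
      proof -
        let ?E = "\<lambda>y. h y * exp (?S y) + (1 / M) * exp (?S y)"
        have Ec: "continuous_on UNIV ?E" by (intro continuous_on_add hS continuous_on_mult continuous_on_const eS)
        have euc: "continuous_on UNIV (\<lambda>y. exp (- M * u y))"
          by (intro continuous_intros u)
        have "X.growth \<psi>' n x \<le> (?T ^^ n) (\<lambda>y. exp (- M * u ((\<alpha> ^^ n) y)) * ?E y) x"
          unfolding X.growth_def
        proof (intro X.Tn_mono X.continuous_exp_birkhoff \<psi>'c continuous_on_mult Ec X.continuous_on_comp_funpow[OF euc])
          fix y
          have "exp (X.birkhoff \<psi>' n y) \<le> exp (?S y - M * (1 - h y) - M * u ((\<alpha> ^^ n) y))" using b by simp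
          also have "\<dots> = exp (- M * u ((\<alpha> ^^ n) y)) * (exp (- M * (1 - h y)) * exp (?S y))"
            by (simp flip: exp_add)
          also have "\<dots> \<le> exp (- M * u ((\<alpha> ^^ n) y)) * (((1 - (1 - h y)) + 1 / M) * exp (?S y))"
            using exp_le[of "1 - h y"] h(2,3)[of y] by (intro mult_left_mono mult_right_mono) auto
          also have "\<dots> = exp (- M * u ((\<alpha> ^^ n) y)) * ?E y" by (simp add: algebra_simps)
          finally show "exp (X.birkhoff \<psi>' n y) \<le> exp (- M * u ((\<alpha> ^^ n) y)) * ?E y" .
        qed auto
        also have "\<dots> = exp (- M * u x) * (?T ^^ n) ?E x"
          using X.Tn_hom[OF euc Ec, of n] by simp
        also have "(?T ^^ n) ?E x = H x + (1 / M) * X.growth \<psi> n x"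
          unfolding H_def X.growth_def
          by (subst X.Tn_add) (auto intro!: hS continuous_on_mult continuous_on_const eS simp only: X.Tn_scale[OF eS])
        also have "exp (- M * u x) * (H x + (1 / M) * X.growth \<psi> n x) \<le> exp (- M * u x) * (H x + K / M)"
          using gK[of x] M0 by (intro mult_left_mono add_left_mono) (auto simp: divide_right_mono)
        also have "\<dots> \<le> exp (real n * c)"
        proof (cases "x \<in> ?N")
          case True
          have "H x \<le> X.growth \<psi> n x"
            unfolding H_def X.growth_def using h(3) by (intro X.Tn_mono hS eS) (auto simp: mult_left_le_one_le h(2))
          then have "H x + K / M \<le> K + K / 1"
            using gK[of x] M K by (intro add_mono divide_left_mono) auto
          moreover have "exp (- M * u x) \<le> 1 / M"
          proof -
            have "M \<le> exp M" using exp_ge_add_one_self[of M] by linarith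
            then show ?thesis using u(4)[OF True] M0 by (simp add: exp_minus field_simps)
          qed
          moreover have "0 \<le> 2 * K" using K by simp
          ultimately have "exp (- M * u x) * (H x + K / M) \<le> (1 / M) * (2 * K)"
            by (smt (verit) exp_ge_zero mult_left_mono mult_right_mono div_by_1)
          then show ?thesis using KM by simp
        next
          case False
          then have "H x + K / M \<le> exp (real n * c)" using Kgap by (simp add: gap_def)
          moreover have "0 \<le> H x + K / M"
            unfolding H_def using h(2) K M0 by (intro add_nonneg_nonneg X.Tn_nonneg hS) auto
          moreover have "exp (- M * u x) \<le> 1" using M0 u(2)[of x] by simp
          ultimately show ?thesis
            by (meson mult_left_le_one_le exp_ge_zero order_trans)
        qed
        finally show ?thesis .
      qed
      then have "X.max_growth \<psi>' n \<le> exp (real n * c)" by (rule X.max_growth_le)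
      then have "eln (X.max_growth \<psi>' n) / ereal (real n) \<le> ereal c" using n(1) by (simp add: eln_div_le_iff)
      then have "X.pot \<psi>' \<le> ereal c" using X.pot_le[OF n(1), of \<psi>'] by (rule order_trans[rotated])
      then have "l + (m \<psi>' - m \<psi>) \<le> c" by (rule m(2)[OF \<psi>'c])
      moreover have "m \<psi>' = m \<psi> + (- M) * m \<phi>"
        unfolding \<psi>'_def by (subst X.m_add[OF m(1)]) (auto intro!: \<psi> \<phi>c continuous_intros simp only: X.m_scale[OF m(1) \<phi>c])
      moreover have "m \<phi> = 0" using m0[OF \<phi>c \<phi>Y] .
      ultimately show ?thesis by simp
    qed
    then show ?thesis unfolding real by (metis dense_ge ereal_dense2 less_le_trans linorder_not_le order_less_imp_le)
  qed
qed

end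

theorem theorem5:
  fixes \<alpha> :: "'a::t2_space \<Rightarrow> 'a"
    and A :: "('a \<Rightarrow> complex) \<Rightarrow> ('a \<Rightarrow> complex)"
  assumes "compact (UNIV :: 'a set)"
    and "continuous_on UNIV \<alpha>"
    and "transfer_operator \<alpha> A"
  shows "(\<forall>Y. Y \<noteq> {} \<and> closed Y \<and> \<alpha> ` Y \<subseteq> Y \<and> compatible A Y \<longrightarrow>
            (\<forall>\<psi> :: 'a \<Rightarrow> real. continuous_on UNIV \<psi> \<longrightarrow>
               spectral_potential UNIV A \<psi> \<ge> spectral_potential Y (trace_operator A Y) \<psi> \<and>
               is_max_over (spectral_potential Y (trace_operator A Y) \<psi>)
                 (\<lambda>\<mu>. ereal (\<integral>x. \<psi> x \<partial>\<mu>) + t_entropy Y (trace_operator A Y) \<mu>)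
                 (invariant_measures_on \<alpha> Y)))
       \<and> (compatible A (essential_set \<alpha>) \<longrightarrow>
            (\<forall>\<psi> :: 'a \<Rightarrow> real. continuous_on UNIV \<psi> \<longrightarrow>
               spectral_potential UNIV A \<psi> =
                 spectral_potential (essential_set \<alpha>) (trace_operator A (essential_set \<alpha>)) \<psi> \<and>
               is_max_over
                 (spectral_potential (essential_set \<alpha>) (trace_operator A (essential_set \<alpha>)) \<psi>)
                 (\<lambda>\<mu>. ereal (\<integral>x. \<psi> x \<partial>\<mu>) +
                       t_entropy (essential_set \<alpha>) (trace_operator A (essential_set \<alpha>)) \<mu>)
                 (invariant_measures \<alpha>)))"
proof -
  interpret transfer_setting \<alpha> A by unfold_locales (fact assms)+
  interpret X: compatible_subset \<alpha> A UNIV by (rule compatible_subset_UNIV)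
  \<comment> \<open>Reading \<open>A\<close> as its own trace on \<open>UNIV\<close> puts both sides
    of the comparison into the same setting.\<close>
  have X: "spectral_potential UNIV A \<psi> = X.pot \<psi>" if "continuous_on UNIV \<psi>" for \<psi> :: "'a \<Rightarrow> real"
    using spectral_potential_UNIV[OF that] X.spectral_potential_trace[OF that] by simp
  have part: "spectral_potential Y (trace_operator A Y) \<psi> \<le> spectral_potential UNIV A \<psi> \<and>
      is_max_over (spectral_potential Y (trace_operator A Y) \<psi>)
        (\<lambda>\<mu>. ereal (\<integral>x. \<psi> x \<partial>\<mu>) + t_entropy Y (trace_operator A Y) \<mu>) (invariant_measures_on \<alpha> Y)"
    if Y: "Y \<noteq> {}" "closed Y" "\<alpha> ` Y \<subseteq> Y" "compatible A Y" and \<psi>: "continuous_on UNIV \<psi>" for Y \<psi>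
  proof -
    interpret Y: compatible_subset \<alpha> A Y by unfold_locales (fact Y)+
    have "continuous_on Y \<psi>" using \<psi> continuous_on_subset by blast
    then show ?thesis
      using Y.spectral_potential_trace Y.pot_le_whole[OF \<psi>] Y.variational_principle[OF \<psi>] X[OF \<psi>] by simp
  qed
  have le: "spectral_potential UNIV A \<psi> \<le> spectral_potential (essential_set \<alpha>) (trace_operator A (essential_set \<alpha>)) \<psi>"
    if c: "compatible A (essential_set \<alpha>)" and \<psi>: "continuous_on UNIV \<psi>" for \<psi>
  proof -
    interpret E: compatible_subset \<alpha> A "essential_set \<alpha>"
      by unfold_locales (fact essential_set_nonempty closed_essential_set essential_set_invariant c)+
    have "continuous_on (essential_set \<alpha>) \<psi>" using \<psi> continuous_on_subset by blast
    then show ?thesis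
      using E.spectral_potential_trace E.whole_pot_le[OF invariant_measures_on_essential_set \<psi>] X[OF \<psi>] by simp
  qed
  show ?thesis
    using part le part[OF essential_set_nonempty closed_essential_set essential_set_invariant]
    by (auto simp: invariant_measures_on_essential_set intro: antisym)
qed

end
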